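(* Let $X$ be a strictly stable process on $\mathbb R$ with index $\alpha>1$, and let $Y_t=e^{2\pi i X_t}$ be the corresponding stable process on the unit circle $\mathbb T$. (a) Let $\Xi$ be the set-valued coalescing stable process on $\mathbb R$ (built from $X$) with $\Xi_0$ (nonempty) compact. Almost surely, $\Xi_t$ is a finite set for all $t>0$. (b) Let $\Xi$ be the set-valued coalescing stable process on $\mathbb T$ (built from $Y$, with $\Xi_0$ a nonempty compact subset of $\mathbb T$). Almost surely, $\Xi_t$ is a finite set for all $t>0$.
   Context: Stable process. $X$ is the Lévy process on $\mathbb R$ such that, when started at $0$, $X_t$ has characteristic function $\lambda\mapsto\exp(-t\Psi(\lambda))$, with $\Psi(\lambda)=c|\lambda|^\alpha\bigl(1-i\upsilon\,\mathrm{sgn}(\lambda)\tan(\pi\alpha/2)\bigr)$, where $c>0$, $\upsilon\in[-1,1]$. Set-valued coalescing process. Let $X$ be a Feller process (with càdlàg paths) on a locally compact, second-countable, Hausdorff space $E$. Given a finite or infinite sequence $(x_1,x_2,\ldots)$ of points of $E$, let $\xi_1,\xi_2,\ldots$ be independent copies of $X$ with $\xi_i(0)=x_i$. Define $\zeta_1=\xi_1$, and for $i>1$ let $T_i=\inf\{t\ge 0:\xi_i(t)\in\{\zeta_1(t),\ldots,\zeta_{i-1}(t)\}\}$ (with $\inf\emptyset=\infty$), let $J_i=\min\{j\in\{1,\dots,i-1\}:\xi_i(T_i)=\zeta_j(T_i)\}$ if $T_i<\infty$, and set $\zeta_i(t)=\xi_i(t)$ for $t<T_i$ and $\zeta_i(t)=\zeta_{J_i}(t)$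 for $t\ge T_i$. Let $\Xi_t$ be the closure in $E$ of $\{\zeta_i(t):i\ge 1\}$. The set-valued coalescing process started from a nonempty closed set $Q\subseteq E$ is $\Xi=(\Xi_t)_{t\ge 0}$ obtained from any sequence $(x_i)$ with the closure of $\{x_i\}$ equal to $Q$, so that $\Xi_0=Q$ (in the present setting the law of $\Xi$ does not depend on the choice of sequence). *)

theory Defs
  imports "HOL-Probability.Probability"
begin

section \<open>Processes and their laws\<close>

text \<open>Processes are functions of a real time parameter; only times \<open>t \<ge> 0\<close> are meaningful.
  The state space is a subset \<open>E\<close> of a topological type.\<close>

definition cadlag_in :: "'e::topological_space set \<Rightarrow> (real \<Rightarrow> 'e) \<Rightarrow> bool" where
  "cadlag_in E f \<longleftrightarrow>
     (\<forall>t\<ge>0. f t \<in> E) \<and>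
     (\<forall>t\<ge>0. (f \<longlongrightarrow> f t) (at_right t)) \<and>
     (\<forall>t>0. \<exists>l\<in>E. (f \<longlongrightarrow> l) (at_left t))"

definition path_space :: "(real \<Rightarrow> 'e::topological_space) measure" where
  "path_space = PiM {0..} (\<lambda>_. borel)"

definition path_of :: "(real \<Rightarrow> 'w \<Rightarrow> 'e) \<Rightarrow> 'w \<Rightarrow> real \<Rightarrow> 'e" where
  "path_of X \<omega> = (\<lambda>t\<in>{0..}. X t \<omega>)"

definition path_law ::
    "'w measure \<Rightarrow> (real \<Rightarrow> 'w \<Rightarrow> 'e::topological_space) \<Rightarrow> (real \<Rightarrow> 'e) measure" where
  "path_law M X = distr M path_space (path_of X)"


section \<open>Strictly stable processes\<close>

definition levy_process :: "'w measure \<Rightarrow> (real \<Rightarrow> 'w \<Rightarrow> real) \<Rightarrow> bool" where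
  "levy_process M X \<longleftrightarrow>
     prob_space M \<and>
     (\<forall>t\<ge>0. X t \<in> borel_measurable M) \<and>
     (AE \<omega> in M. X 0 \<omega> = 0) \<and>
     (\<forall>(s::nat \<Rightarrow> real) n. 0 \<le> s 0 \<and> mono s \<longrightarrow>
        prob_space.indep_vars M (\<lambda>_. borel) (\<lambda>k \<omega>. X (s (Suc k)) \<omega> - X (s k) \<omega>) {..<n}) \<and>
     (\<forall>s\<ge>0. \<forall>t\<ge>0. distr M borel (\<lambda>\<omega>. X (s + t) \<omega> - X s \<omega>) = distr M borel (X t)) \<and>
     (AE \<omega> in M. cadlag_in UNIV (\<lambda>t. X t \<omega>))"

definition stable_exponent :: "real \<Rightarrow> real \<Rightarrow> real \<Rightarrow> real \<Rightarrow> complex" where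
  "stable_exponent \<alpha> c \<upsilon> u =
     of_real (c * \<bar>u\<bar> powr \<alpha>) * (1 - \<i> * of_real (\<upsilon> * sgn u * tan (pi * \<alpha> / 2)))"

text \<open>The index 1 is excluded because the exponent above is meaningless there: the tangent has a
  pole at \<open>pi / 2\<close> (and is 0 by convention in the library).  For \<open>\<alpha> = 2\<close> the tangent vanishes and
  the process is a multiple of Brownian motion.\<close>

definition strictly_stable_process :: "'w measure \<Rightarrow> real \<Rightarrow> (real \<Rightarrow> 'w \<Rightarrow> real) \<Rightarrow> bool" where
  "strictly_stable_process M \<alpha> X \<longleftrightarrow>
     0 < \<alpha> \<and> \<alpha> \<le> 2 \<and> \<alpha> \<noteq> 1 \<and>
     levy_process M X \<and>
     (\<exists>c \<upsilon>. 0 < c \<and> -1 \<le> \<upsilon> \<and> \<upsilon> \<le> 1 \<and>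
        (\<forall>t\<ge>0. \<forall>u. char (distr M borel (X t)) u = exp (- of_real t * stable_exponent \<alpha> c \<upsilon> u)))"

text \<open>A process with arbitrary starting points is given by the laws on path space of its versions
  started at the various points.  Below, \<open>X\<close> starts at 0, so \<open>x + X\<close> is the process started
  at \<open>x\<close>; and since \<open>exp (2 * pi * \<i> * (x + X)) = exp (2 * pi * \<i> * x) * exp (2 * pi * \<i> * X)\<close>, the
  projected process started at \<open>z\<close> on the unit circle is \<open>z * exp (2 * pi * \<i> * X)\<close>.\<close>

definition line_laws :: "'w measure \<Rightarrow> (real \<Rightarrow> 'w \<Rightarrow> real) \<Rightarrow> real \<Rightarrow> (real \<Rightarrow> real) measure" where
  "line_laws M X x = path_law M (\<lambda>t \<omega>. x + X t \<omega>)"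

definition circle_laws ::
    "'w measure \<Rightarrow> (real \<Rightarrow> 'w \<Rightarrow> real) \<Rightarrow> complex \<Rightarrow> (real \<Rightarrow> complex) measure" where
  "circle_laws M X z = path_law M (\<lambda>t \<omega>. z * exp (2 * of_real pi * \<i> * of_real (X t \<omega>)))"


section \<open>Coalescing paths\<close>

text \<open>\<open>x\<close> is the path of the particle with index \<open>i\<close>, and \<open>\<zeta> j\<close> for \<open>j < i\<close> are the already
  coalesced paths.  The infimum of the empty set is \<open>\<infinity>\<close> in \<^typ>\<open>ereal\<close>.\<close>

definition meet_time :: "(real \<Rightarrow> 'e) \<Rightarrow> (nat \<Rightarrow> real \<Rightarrow> 'e) \<Rightarrow> nat \<Rightarrow> ereal" where
  "meet_time x \<zeta> i = Inf (ereal ` {t. 0 \<le> t \<and> (\<exists>j<i. x t = \<zeta> j t)})"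

definition meet_index :: "(real \<Rightarrow> 'e) \<Rightarrow> (nat \<Rightarrow> real \<Rightarrow> 'e) \<Rightarrow> nat \<Rightarrow> nat" where
  "meet_index x \<zeta> i =
     (LEAST j. j < i \<and> x (real_of_ereal (meet_time x \<zeta> i)) = \<zeta> j (real_of_ereal (meet_time x \<zeta> i)))"

lemma meet_time_cong [fundef_cong]:
  assumes "x = x'" "i = i'" "\<And>j t. j < i' \<Longrightarrow> \<zeta> j t = \<zeta>' j t"
  shows "meet_time x \<zeta> i = meet_time x' \<zeta>' i'"
  unfolding meet_time_def using assms
  by (intro arg_cong[where f = Inf] arg_cong[where f = "(`) ereal"]) auto

lemma meet_index_cong [fundef_cong]:
  assumes "x = x'" "i = i'" "\<And>j t. j < i' \<Longrightarrow> \<zeta> j t = \<zeta>' j t"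
  shows "meet_index x \<zeta> i = meet_index x' \<zeta>' i'"
proof -
  have T: "meet_time x \<zeta> i = meet_time x' \<zeta>' i'"
    using assms by (rule meet_time_cong)
  show ?thesis
    unfolding meet_index_def T using assms
    by (intro arg_cong[where f = Least]) auto
qed

text \<open>Indices start at 0.  The condition \<open>meet_index \<dots> < i\<close> only serves to make the recursion total:
  it holds automatically for right-continuous paths, see \<open>meet_index_less\<close> and
  \<open>coalesced_eq\<close> below.\<close>

fun coalesced :: "(nat \<Rightarrow> real \<Rightarrow> 'e) \<Rightarrow> nat \<Rightarrow> real \<Rightarrow> 'e" where
  "coalesced \<xi> i t =
     (if meet_time (\<xi> i) (\<lambda>j s. coalesced \<xi> j s) i \<le> ereal t \<and>
         meet_index (\<xi> i) (\<lambda>j s. coalesced \<xi> j s) i < i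
      then coalesced \<xi> (meet_index (\<xi> i) (\<lambda>j s. coalesced \<xi> j s) i) t
      else \<xi> i t)"

declare coalesced.simps [simp del]

lemma meet_index_less:
  fixes x :: "real \<Rightarrow> 'e::t2_space"
  assumes x: "\<And>t. 0 \<le> t \<Longrightarrow> (x \<longlongrightarrow> x t) (at_right t)"
    and z: "\<And>j t. j < i \<Longrightarrow> 0 \<le> t \<Longrightarrow> (\<zeta> j \<longlongrightarrow> \<zeta> j t) (at_right t)"
    and fin: "meet_time x \<zeta> i < \<infinity>"
  shows "meet_index x \<zeta> i < i \<and>
    x (real_of_ereal (meet_time x \<zeta> i)) = \<zeta> (meet_index x \<zeta> i) (real_of_ereal (meet_time x \<zeta> i))"
proof -
  define A where "A = {t. 0 \<le> t \<and> (\<exists>j<i. x t = \<zeta> j t)}"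
  have mt: "meet_time x \<zeta> i = Inf (ereal ` A)"
    unfolding meet_time_def A_def ..
  have ne: "A \<noteq> {}"
    using fin unfolding mt by (auto simp: top_ereal_def)
  have nonneg: "0 \<le> Inf (ereal ` A)"
    by (intro Inf_greatest) (auto simp: A_def)
  obtain T where T: "meet_time x \<zeta> i = ereal T"
    using fin nonneg unfolding mt by (cases "Inf (ereal ` A)") auto
  have T0: "0 \<le> T"
    using nonneg T mt by simp
  have lb: "T \<le> a" if "a \<in> A" for a
  proof -
    have "Inf (ereal ` A) \<le> ereal a"
      using that by (intro Inf_lower) auto
    then show ?thesis
      using T mt by simp
  qed
  have "\<exists>j<i. x T = \<zeta> j T"
  proof (rule ccontr)
    assume no: "\<not> ?thesis"
    have "eventually (\<lambda>t. x t \<noteq> \<zeta> j t) (at_right T)" if "j < i" for j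
    proof -
      have "x T \<noteq> \<zeta> j T"
        using no that by blast
      from hausdorff[OF this] obtain U V where UV: "open U" "open V" "x T \<in> U" "\<zeta> j T \<in> V" "U \<inter> V = {}"
        by blast
      have "eventually (\<lambda>t. x t \<in> U) (at_right T)" "eventually (\<lambda>t. \<zeta> j t \<in> V) (at_right T)"
        using topological_tendstoD[OF x[OF T0]] topological_tendstoD[OF z[OF that T0]] UV by auto
      then show ?thesis
        by eventually_elim (use UV in auto)
    qed
    then have "eventually (\<lambda>t. \<forall>j\<in>{..<i}. x t \<noteq> \<zeta> j t) (at_right T)"
      by (intro eventually_ball_finite) auto
    then obtain b where b: "T < b" "\<And>t. T < t \<Longrightarrow> t < b \<Longrightarrow> \<forall>j\<in>{..<i}. x t \<noteq> \<zeta> j t"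
      by (auto simp: eventually_at_right_field)
    have "b \<le> a" if "a \<in> A" for a
    proof (rule ccontr)
      assume "\<not> b \<le> a"
      then have "a = T \<or> (T < a \<and> a < b)"
        using lb[OF that] by linarith
      then show False
        using that b(2)[of a] no by (auto simp: A_def)
    qed
    then have "ereal b \<le> Inf (ereal ` A)"
      by (intro Inf_greatest) auto
    then show False
      using T mt b(1) by simp
  qed
  then show ?thesis
    unfolding meet_index_def T by (auto intro: LeastI2)
qed

lemma coalesced_right_continuous:
  fixes \<xi> :: "nat \<Rightarrow> real \<Rightarrow> 'e::t2_space"
  assumes "\<And>j s. j \<le> i \<Longrightarrow> 0 \<le> s \<Longrightarrow> (\<xi> j \<longlongrightarrow> \<xi> j s) (at_right s)" and "0 \<le> t"
  shows "(coalesced \<xi> i \<longlongrightarrow> coalesced \<xi> i t) (at_right t)"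
  using assms
proof (induction i arbitrary: t rule: less_induct)
  case (less i)
  let ?T = "meet_time (\<xi> i) (coalesced \<xi>) i" and ?J = "meet_index (\<xi> i) (coalesced \<xi>) i"
  note eq = coalesced.simps[of \<xi> i]
  show ?case
  proof (cases "?T \<le> ereal t \<and> ?J < i")
    case True
    have "eventually (\<lambda>s. coalesced \<xi> ?J s = coalesced \<xi> i s) (at_right t)"
      using eventually_at_right_less[of t]
    proof eventually_elim
      case (elim s)
      then have "?T \<le> ereal s"
        using True by (meson ereal_less_eq(3) less_imp_le order_trans)
      then show ?case
        using True by (simp add: eq)
    qed
    moreover have "(coalesced \<xi> ?J \<longlongrightarrow> coalesced \<xi> ?J t) (at_right t)"
      using less.IH[of ?J t] less.prems True by auto
    ultimately show ?thesis
      using True by (subst eq) (auto elim: Lim_transform_eventually[rotated])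
  next
    case False
    have "eventually (\<lambda>s. \<xi> i s = coalesced \<xi> i s) (at_right t)"
    proof (cases "?J < i")
      case True
      then have "ereal t < ?T"
        using False by auto
      then obtain r where r: "ereal t < r" "r < ?T"
        using dense by blast
      then obtain b where b: "r = ereal b"
        by (cases r) auto
      have "t < b"
        using r b by simp
      from eventually_at_right_real[OF this] show ?thesis
      proof eventually_elim
        case (elim s)
        then have "ereal s < ?T"
          using r(2) b by (meson greaterThanLessThan_iff less_ereal.simps(1) less_trans)
        then show ?case
          by (auto simp: eq not_le[symmetric])
      qed
    next
      case False
      then show ?thesis
        by (auto simp: eq)
    qed
    then show ?thesis
      using less.prems False by (subst eq) (auto elim: Lim_transform_eventually[rotated])
  qed
qed

lemma coalesced_eq:
  fixes \<xi> :: "nat \<Rightarrow> real \<Rightarrow> 'e::t2_space"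
  assumes "\<And>j s. j \<le> i \<Longrightarrow> 0 \<le> s \<Longrightarrow> (\<xi> j \<longlongrightarrow> \<xi> j s) (at_right s)"
  shows "coalesced \<xi> i t =
    (if ereal t < meet_time (\<xi> i) (coalesced \<xi>) i then \<xi> i t
     else coalesced \<xi> (meet_index (\<xi> i) (coalesced \<xi>) i) t)"
proof (cases "ereal t < meet_time (\<xi> i) (coalesced \<xi>) i")
  case True
  then show ?thesis
    by (subst coalesced.simps) auto
next
  case False
  then have "meet_time (\<xi> i) (coalesced \<xi>) i < \<infinity>"
    by (auto simp: not_less intro: le_less_trans)
  then have "meet_index (\<xi> i) (coalesced \<xi>) i < i"
    using assms by (intro meet_index_less[THEN conjunct1] coalesced_right_continuous) auto
  then show ?thesis
    using False by (subst coalesced.simps) auto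
qed

section \<open>Set-valued coalescing processes\<close>

text \<open>The family \<open>\<xi>\<close>, indexed by \<open>I\<close>, consists of independent processes in \<open>E\<close> with cadlag paths, the
  one with index \<open>i\<close> being a version of the process with laws \<open>P\<close> started at \<open>x i\<close>.\<close>

definition independent_copies ::
    "'w measure \<Rightarrow> 'e::{second_countable_topology, t2_space} set \<Rightarrow> ('e \<Rightarrow> (real \<Rightarrow> 'e) measure) \<Rightarrow>
     nat set \<Rightarrow> (nat \<Rightarrow> 'e) \<Rightarrow> (nat \<Rightarrow> real \<Rightarrow> 'w \<Rightarrow> 'e) \<Rightarrow> bool" where
  "independent_copies M E P I x \<xi> \<longleftrightarrow>
     prob_space M \<and>
     prob_space.indep_vars M (\<lambda>_. path_space) (\<lambda>i. path_of (\<xi> i)) I \<and>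
     (\<forall>i\<in>I. path_law M (\<xi> i) = P (x i)) \<and>
     (\<forall>i\<in>I. AE \<omega> in M. \<xi> i 0 \<omega> = x i) \<and>
     (\<forall>i\<in>I. AE \<omega> in M. cadlag_in E (\<lambda>t. \<xi> i t \<omega>))"

text \<open>The sequence of starting points may be finite or infinite, so the index set is an initial
  segment of the natural numbers.  Closures are taken in \<open>E\<close>.\<close>

definition set_coalescing_process ::
    "'w measure \<Rightarrow> 'e::{second_countable_topology, t2_space} set \<Rightarrow> ('e \<Rightarrow> (real \<Rightarrow> 'e) measure) \<Rightarrow>
     'e set \<Rightarrow> (real \<Rightarrow> 'w \<Rightarrow> 'e set) \<Rightarrow> bool" where
  "set_coalescing_process M E P Q \<Xi> \<longleftrightarrow>
     (\<exists>I x \<xi>. (I = UNIV \<or> (\<exists>n. I = {..<n})) \<and>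
        x ` I \<subseteq> E \<and> (top_of_set E) closure_of (x ` I) = Q \<and>
        independent_copies M E P I x \<xi> \<and>
        (\<forall>\<omega>\<in>space M. \<forall>t\<ge>0. \<Xi> t \<omega> =
           (top_of_set E) closure_of ((\<lambda>i. coalesced (\<lambda>j s. \<xi> j s \<omega>) i t) ` I)))"

end

theory Submission
  imports Defs
begin

text \<open>Let \<open>a t\<close> be the expected number of free particles, out of the first \<open>n\<close>, that have not met an
earlier coalesced path by time \<open>t\<close>.  Each \<open>\<zeta>\<^sub>i(t)\<close> is the position of such a surviving particle, so
it suffices to bound \<open>a t\<close> for each \<open>t > 0\<close> by a number that does not depend on \<open>n\<close>: by
Borel-Cantelli only finitely many particles then survive up to time \<open>t\<close>.

The bound comes from a recursion.  Two independent copies that start at distance at most \<open>l\<close> meet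
within a time \<open>\<tau> * l powr \<alpha>\<close> with probability at least \<open>p > 0\<close>, because their difference is a
symmetric stable process of index \<open>\<alpha> > 1\<close>, which hits points; by scaling \<open>p\<close> and \<open>\<tau>\<close> do not depend
on \<open>l\<close>.  Cut a bounded window into cells of width \<open>l\<close> and pair off the survivors within each cell.
If two free paths meet, at most one of the two particles is still alive afterwards, so in time
\<open>\<tau> * l powr \<alpha>\<close> the expected number of survivors drops from \<open>a\<close> to at most
\<open>(1 - p / 2) * a + (p / 2) * N\<close>, where \<open>N\<close> is the number of cells plus the expected number of
survivors outside the window.  The Markov property is needed at fixed times only.  Applying this a
fixed number of times for each of \<open>l = 2 powr (- j)\<close> with decreasing \<open>j\<close> brings the expectation down to a constant,
whatever its initial value, in a total time comparable to a geometric series with ratio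
\<open>2 powr (- \<alpha>)\<close>; as \<open>\<alpha> > 1\<close>, large jumps carry only a bounded expected number of survivors out of
slowly growing windows (\<open>instantaneous_bound\<close>, \<open>expected_alive_step\<close>,
\<open>expected_outside_step\<close>, \<open>expected_alive_bounded\<close>).

That points are hit is shown by a second moment estimate for a Gaussian-weighted occupation sum of
the difference at finitely many rational times (\<open>collision_prob\<close>).  It yields times at which the two
paths are arbitrarily close, hence a meeting, unless they have equal left limits at a time where one
of them jumps away.  The latter has probability 0, since near such a time the difference is small at
a point of a grid of mesh \<open>1 / m\<close>, an event of small probability, and then has an independent
increment of fixed size, an event of probability of order \<open>1 / m\<close>
(\<open>AE_no_jumps_off_coincidence\<close>).

The line and the circle are treated together: the state space is the image of the real line under a
map \<open>\<pi>\<close>, which is the identity or \<open>x \<mapsto> exp (2 * pi * \<i> * x)\<close>, and all estimates are made for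
the real lifts, whose law is the product of the laws on path space.\<close>

section \<open>Meetings of right-continuous paths\<close>

text \<open>Two paths come arbitrarily close to each other at rational times up to \<open>q\<close>.  Unlike an actual
meeting, this is an event in the product \<open>\<sigma>\<close>-algebra on path space.\<close>

definition near :: "(nat \<Rightarrow> real \<Rightarrow> 'e::metric_space) \<Rightarrow> nat \<Rightarrow> nat \<Rightarrow> real \<Rightarrow> bool" where
  "near f i j q \<longleftrightarrow> (\<forall>e::nat. \<exists>u\<in>\<rat>. 0 \<le> u \<and> u \<le> q \<and> dist (f i u) (f j u) < 1 / Suc e)"

text \<open>A particle is dead at time \<open>t\<close> if it has approached the free path of an earlier particle that was
still alive.  For rational \<open>t\<close> this is the measurable counterpart of \<open>meet_time \<dots> \<le> t\<close>: a
coalesced path always follows the free path of some particle that is alive.\<close>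

fun dead :: "(nat \<Rightarrow> real \<Rightarrow> 'e::metric_space) \<Rightarrow> nat \<Rightarrow> real \<Rightarrow> bool" where
  "dead f i t \<longleftrightarrow> (\<exists>j\<in>{..<i}. \<exists>q\<in>\<rat>. 0 \<le> q \<and> q \<le> t \<and> near f i j q \<and> \<not> dead f j q)"

declare dead.simps [simp del]

lemma near_sym: "near f i j q \<longleftrightarrow> near f j i q"
  by (simp add: near_def dist_commute)

lemma dead_mono: "dead f i t \<Longrightarrow> t \<le> t' \<Longrightarrow> dead f i t'"
  by (auto simp: dead.simps[of f i] intro: order_trans)

lemma near_cong:
  assumes "\<And>u. 0 \<le> u \<Longrightarrow> u \<le> q \<Longrightarrow> f i u = g i u" "\<And>u. 0 \<le> u \<Longrightarrow> u \<le> q \<Longrightarrow> f j u = g j u"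
  shows "near f i j q \<longleftrightarrow> near g i j q"
proof -
  have "(0 \<le> u \<and> u \<le> q \<and> dist (f i u) (f j u) < r) \<longleftrightarrow> (0 \<le> u \<and> u \<le> q \<and> dist (g i u) (g j u) < r)" for u r
    using assms[of u] by auto
  then show ?thesis unfolding near_def by simp
qed

lemma dead_cong:
  assumes "\<And>k u. k \<le> i \<Longrightarrow> 0 \<le> u \<Longrightarrow> u \<le> t \<Longrightarrow> f k u = g k u"
  shows "dead f i t \<longleftrightarrow> dead g i t"
  using assms
proof (induction i arbitrary: t rule: less_induct)
  case (less i)
  have eq: "near f i j q \<and> \<not> dead f j q \<longleftrightarrow> near g i j q \<and> \<not> dead g j q" if "j < i" "q \<le> t" for j q
  proof -
    have "near f i j q \<longleftrightarrow> near g i j q"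
      using that by (intro near_cong less.prems) auto
    moreover have "dead f j q \<longleftrightarrow> dead g j q"
      using that by (intro less.IH less.prems) auto
    ultimately show ?thesis by simp
  qed
  have "(q \<le> t \<and> near f i j q \<and> \<not> dead f j q) \<longleftrightarrow> (q \<le> t \<and> near g i j q \<and> \<not> dead g j q)"
    if "j \<in> {..<i}" for j q
    using eq[of j q] that by auto
  then show ?case
    by (simp add: dead.simps[of _ i])
qed

lemma two_alive_not_near:
  assumes "\<not> dead f i t" "\<not> dead f j t" "i \<noteq> j" "t \<in> \<rat>" "0 \<le> t"
  shows "\<not> near f i j t"
proof -
  have *: "\<not> near f i j t" if "j < i" "\<not> dead f i t" "\<not> dead f j t" for i j
    using that assms(4,5) unfolding dead.simps[of f i] by blast
  show ?thesis
    using assms *[of i j] *[of j i] near_sym[of f i j t] by (cases i j rule: linorder_cases) auto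
qed

text \<open>At every time a coalesced path sits on the free path of a particle that has not merged yet.\<close>

lemma coalesced_is_free_path:
  fixes \<xi> :: "nat \<Rightarrow> real \<Rightarrow> 'e::t2_space"
  assumes rc: "\<And>j s. 0 \<le> s \<Longrightarrow> (\<xi> j \<longlongrightarrow> \<xi> j s) (at_right s)"
  shows "\<exists>j\<le>i. ereal t < meet_time (\<xi> j) (coalesced \<xi>) j \<and> coalesced \<xi> i t = \<xi> j t"
proof (induction i rule: less_induct)
  case (less i)
  note eq = coalesced_eq[of i \<xi> t, OF rc]
  show ?case
  proof (cases "ereal t < meet_time (\<xi> i) (coalesced \<xi>) i")
    case True
    then show ?thesis using eq by auto
  next
    case False
    then have "meet_time (\<xi> i) (coalesced \<xi>) i < \<infinity>"
      by (auto simp: not_less intro: le_less_trans)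
    then have J: "meet_index (\<xi> i) (coalesced \<xi>) i < i"
      using rc by (intro meet_index_less[THEN conjunct1] coalesced_right_continuous) auto
    from less[OF J] show ?thesis
      using eq False J by (auto intro: order_trans less_imp_le)
  qed
qed

lemma near_of_meeting:
  assumes rc: "\<And>k s. 0 \<le> s \<Longrightarrow> (f k \<longlongrightarrow> f k s) (at_right s)"
    and u: "0 \<le> u" "u < q \<or> u = q \<and> q \<in> \<rat>" and eq: "f i u = f j u"
  shows "near f i j q"
proof (cases "u = q")
  case True
  then show ?thesis using u eq by (auto simp: near_def)
next
  case False
  then have uq: "u < q" using u by auto
  show ?thesis unfolding near_def
  proof
    fix e :: nat
    have "((\<lambda>v. dist (f i v) (f j v)) \<longlongrightarrow> dist (f i u) (f j u)) (at_right u)"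
      by (intro tendsto_dist rc u)
    then have "eventually (\<lambda>v. dist (f i v) (f j v) < 1 / Suc e) (at_right u)"
      using eq by (intro order_tendstoD(2)) auto
    then obtain b where b: "u < b" "\<And>v. u < v \<Longrightarrow> v < b \<Longrightarrow> dist (f i v) (f j v) < 1 / Suc e"
      by (auto simp: eventually_at_right_field)
    obtain v where "v \<in> \<rat>" "u < v" "v < min b q"
      using Rats_dense_in_real[of u "min b q"] b uq by auto
    then show "\<exists>u\<in>\<rat>. 0 \<le> u \<and> u \<le> q \<and> dist (f i u) (f j u) < 1 / Suc e"
      using b u by (intro bexI[of _ v]) auto
  qed
qed

text \<open>The hypothesis \<open>good\<close> says that approach implies meeting; it can only fail through a coincidence
of left limits that is destroyed by a jump.\<close>

lemma dead_iff_meet_time: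
  fixes f :: "nat \<Rightarrow> real \<Rightarrow> 'e::metric_space"
  assumes rc: "\<And>k s. 0 \<le> s \<Longrightarrow> (f k \<longlongrightarrow> f k s) (at_right s)"
    and good: "\<And>i j q. i \<noteq> j \<Longrightarrow> q \<in> \<rat> \<Longrightarrow> 0 \<le> q \<Longrightarrow> near f i j q \<Longrightarrow> \<exists>u. 0 \<le> u \<and> u \<le> q \<and> f i u = f j u"
    and "t \<in> \<rat>" "0 \<le> t"
  shows "dead f i t \<longleftrightarrow> meet_time (f i) (coalesced f) i \<le> ereal t"
  using assms(3,4)
proof (induction i arbitrary: t rule: less_induct)
  case (less i)
  let ?T = "\<lambda>i. meet_time (f i) (coalesced f) i"
  show ?case
  proof
    assume "dead f i t"
    then obtain j q where jq: "j < i" "q \<in> \<rat>" "0 \<le> q" "q \<le> t" "near f i j q" "\<not> dead f j q"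
      by (auto simp: dead.simps[of _ i])
    then have T: "ereal q < ?T j"
      using less.IH[of j q] by (auto simp: not_le)
    obtain u where u: "0 \<le> u" "u \<le> q" "f i u = f j u"
      using good[of i j q] jq by auto
    have "ereal u < ?T j" using u T by (meson ereal_less_eq(3) le_less_trans)
    then have "coalesced f j u = f j u"
      by (subst coalesced_eq) (use rc in auto)
    then have "f i u = coalesced f j u" using u by simp
    then have "?T i \<le> ereal u"
      unfolding meet_time_def using u(1) jq(1) by (intro Inf_lower imageI) blast
    also have "\<dots> \<le> ereal t" using u jq by simp
    finally show "?T i \<le> ereal t" .
  next
    assume T: "?T i \<le> ereal t"
    then have "?T i < \<infinity>" by (auto intro: le_less_trans)
    from meet_index_less[OF rc _ this] have
      m: "meet_index (f i) (coalesced f) i < i"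
         "f i (real_of_ereal (?T i)) = coalesced f (meet_index (f i) (coalesced f) i) (real_of_ereal (?T i))"
      using coalesced_right_continuous[of _ f] rc by auto
    have "0 \<le> ?T i" unfolding meet_time_def by (intro Inf_greatest) auto
    then obtain u where u: "?T i = ereal u" "0 \<le> u" "u \<le> t"
      using T by (cases "?T i") auto
    obtain j where j: "j < i" "ereal u < ?T j" "f i u = f j u"
      using coalesced_is_free_path[of f "meet_index (f i) (coalesced f) i" u, OF rc] m u
      by (metis le_less_trans real_of_ereal.simps(1))
    obtain q where q: "q \<in> \<rat>" "u < q \<or> u = q" "q \<le> t" "ereal q < ?T j"
    proof (cases "u = t")
      case True
      then show ?thesis using that[of t] less.prems j by auto
    next
      case False
      obtain r where r: "ereal u < ereal r" "ereal r < ?T j"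
        using j(2) by (meson ereal_dense2)
      obtain q where "q \<in> \<rat>" "u < q" "q < min r t"
        using Rats_dense_in_real[of u "min r t"] r False u by auto
      then show ?thesis using that[of q] r
        by (metis ereal_less_eq(3) less_eq_real_def less_trans min_less_iff_conj order_le_less_trans)
    qed
    have "near f i j q"
      using near_of_meeting[of f u q i j] rc u j q by auto
    moreover have "\<not> dead f j q"
      using less.IH[OF j(1) q(1)] q u by auto
    ultimately show "dead f i t"
      using j q u unfolding dead.simps[of f i] by (intro bexI[of _ j] bexI[of _ q]) auto
  qed
qed

text \<open>If two cadlag paths approach each other without meeting, then their left limits agree at some time
\<open>u > 0\<close> at which their values differ.  On a fine grid this is visible at the two grid points
around \<open>u\<close>.\<close>

lemma near_without_meeting_jumps:
  fixes f :: "nat \<Rightarrow> real \<Rightarrow> 'e::metric_space" and T :: nat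
  assumes rc: "\<And>k s. 0 \<le> s \<Longrightarrow> (f k \<longlongrightarrow> f k s) (at_right s)"
    and ll: "\<And>k s. 0 < s \<Longrightarrow> \<exists>l. (f k \<longlongrightarrow> l) (at_left s)"
    and near: "near f i j q" and no: "\<And>u. 0 \<le> u \<Longrightarrow> u \<le> q \<Longrightarrow> f i u \<noteq> f j u"
    and T: "q \<le> real T"
  shows "\<exists>d::nat. \<forall>e::nat. \<exists>m0. \<forall>m\<ge>m0. \<exists>k<T * m.
           dist (f i (real k / m)) (f j (real k / m)) < 1 / Suc e \<and>
           dist (f i (real (Suc k) / m)) (f j (real (Suc k) / m)) > 1 / Suc d"
proof -
  define D where "D u = dist (f i u) (f j u)" for u
  have Drc: "(D \<longlongrightarrow> D u) (at_right u)" if "0 \<le> u" for u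
    unfolding D_def by (intro tendsto_dist rc that)
  have Dpos: "D u > 0" if "0 \<le> u" "u \<le> q" for u
    using no[OF that] by (simp add: D_def)
  obtain w where w: "\<And>n::nat. 0 \<le> w n" "\<And>n. w n \<le> q" "\<And>n. D (w n) < 1 / Suc n"
    using near unfolding near_def D_def by metis
  have "compact {0..q}" by simp
  then obtain u r where u: "u \<in> {0..q}" and r: "strict_mono r" and lim: "(w \<circ> r) \<longlonglongrightarrow> u"
    unfolding compact_def using w by (metis atLeastAtMost_iff)
  have D0: "(\<lambda>n. D (w n)) \<longlonglongrightarrow> 0"
    by (rule real_tendsto_sandwich[OF _ _ tendsto_const LIMSEQ_inverse_real_of_nat])
       (use w(3) in \<open>auto simp: D_def inverse_eq_divide less_imp_le\<close>)
  have D0': "(\<lambda>n. D ((w \<circ> r) n)) \<longlonglongrightarrow> 0"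
    using LIMSEQ_subseq_LIMSEQ[OF D0 r] by (simp add: o_def)
  have Du: "D u > 0" using u Dpos by auto
  have "eventually (\<lambda>v. D v > D u / 2) (at_right u)"
    using Drc[of u] u Du by (intro order_tendstoD(1)) auto
  then obtain b where b: "u < b" "\<And>v. u < v \<Longrightarrow> v < b \<Longrightarrow> D v > D u / 2"
    by (auto simp: eventually_at_right_field)
  have b': "D v > D u / 2" if "u \<le> v" "v < b" for v
    using that b Du by (cases "v = u") auto
  \<comment> \<open>By right continuity at the limit point, the approach must happen from the left.\<close>
  have "eventually (\<lambda>n. (w \<circ> r) n < b \<and> D ((w \<circ> r) n) < D u / 2) sequentially"
    using order_tendstoD(2)[OF lim b(1)] order_tendstoD(2)[OF D0', of "D u / 2"] Du
    by (auto simp: eventually_conj_iff)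
  then have ev: "eventually (\<lambda>n. (w \<circ> r) n < u) sequentially"
  proof eventually_elim
    case (elim n)
    then show ?case using b'[of "(w \<circ> r) n"] by linarith
  qed
  have u0: "u > 0"
    using ev w(1) by (auto simp: eventually_sequentially) (meson le_less_trans order_refl)
  obtain l1 l2 where "(f i \<longlongrightarrow> l1) (at_left u)" "(f j \<longlongrightarrow> l2) (at_left u)"
    using ll[OF u0] by metis
  then have Dl: "(D \<longlongrightarrow> dist l1 l2) (at_left u)"
    unfolding D_def by (intro tendsto_dist)
  have "filterlim (w \<circ> r) (at_left u) sequentially"
    using lim ev by (auto simp: filterlim_at elim: eventually_mono)
  from filterlim_compose[OF Dl this] have "dist l1 l2 = 0"
    by (rule LIMSEQ_unique[OF _ D0'])
  then have Dl0: "(D \<longlongrightarrow> 0) (at_left u)" using Dl by simp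
  obtain d :: nat where d: "1 / Suc d < D u / 2"
    using nat_approx_posE[of "D u / 2"] Du by auto
  show ?thesis
  proof (rule exI[of _ d], intro allI)
    fix e :: nat
    have "eventually (\<lambda>v. D v < 1 / Suc e) (at_left u)"
      using Dl0 by (intro order_tendstoD(2)) auto
    then obtain c where c: "c < u" "\<And>v. c < v \<Longrightarrow> v < u \<Longrightarrow> D v < 1 / Suc e"
      by (auto simp: eventually_at_left_field)
    obtain m0 :: nat where m0: "1 / Suc m0 < min (u - c) (b - u)"
      using nat_approx_posE[of "min (u - c) (b - u)"] b c by auto
    show "\<exists>m0. \<forall>m\<ge>m0. \<exists>k<T * m.
           dist (f i (real k / m)) (f j (real k / m)) < 1 / Suc e \<and>
           dist (f i (real (Suc k) / m)) (f j (real (Suc k) / m)) > 1 / Suc d"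
    proof (rule exI[of _ "Suc m0"], intro allI impI)
      fix m assume m: "Suc m0 \<le> m"
      then have "1 / real m \<le> 1 / Suc m0"
        by (intro divide_left_mono) auto
      then have m1: "1 / real m < u - c" "1 / real m < b - u" using m0 by auto
      have mpos: "real m > 0" using m by auto
      define K where "K = nat \<lceil>u * m\<rceil>"
      have cpos: "\<lceil>u * m\<rceil> > 0" using u0 mpos by simp
      then have K: "real K \<ge> u * m" "real K < u * m + 1" "K > 0"
        unfolding K_def by linarith+
      define k where "k = K - 1"
      have kK: "K = Suc k" using K by (simp add: k_def)
      have "real k / m < u" "u \<le> real (Suc k) / m" "real (Suc k) / m < u + 1 / m"
        using K mpos unfolding kK by (auto simp: field_simps)
      moreover have "real k / m = real (Suc k) / m - 1 / m"
        using mpos by (simp add: field_simps)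
      ultimately have "D (real k / m) < 1 / Suc e" "D (real (Suc k) / m) > 1 / Suc d"
        using c(2)[of "real k / m"] b'[of "real (Suc k) / m"] m1 d by auto
      moreover have "k < T * m"
      proof -
        have "real k < u * m" using \<open>real k / m < u\<close> mpos by (simp add: field_simps)
        also have "\<dots> \<le> real T * m" using u T mpos by (intro mult_right_mono) auto
        finally have "real k < real (T * m)" by simp
        then show ?thesis by linarith
      qed
      ultimately show "\<exists>k<T * m.
           dist (f i (real k / m)) (f j (real k / m)) < 1 / Suc e \<and>
           dist (f i (real (Suc k) / m)) (f j (real (Suc k) / m)) > 1 / Suc d"
        unfolding D_def by blast
    qed
  qed
qed

section \<open>A multiscale recursion\<close>

text \<open>Here \<open>w i\<close> is the probability that particle \<open>i\<close> survives and \<open>c i\<close> is its cell: pairing off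
within cells leaves at most one particle per cell unpaired.\<close>

lemma sum_pairing_bound:
  fixes w :: "'i \<Rightarrow> real" and c :: "'i \<Rightarrow> 'c"
  assumes "finite A" "finite C" "c ` A \<subseteq> C" and p: "0 \<le> p" "p \<le> 2"
    and w1: "\<And>i. i \<in> A \<Longrightarrow> w i \<le> 1"
    and w2: "\<And>i j. i \<in> A \<Longrightarrow> j \<in> A \<Longrightarrow> i \<noteq> j \<Longrightarrow> c i = c j \<Longrightarrow> w i + w j \<le> 2 - p"
  shows "(\<Sum>i\<in>A. w i) \<le> (1 - p / 2) * card A + p / 2 * card C"
  using assms(1,3) w1 w2
proof (induction A rule: finite_psubset_induct)
  case (psubset A)
  show ?case
  proof (cases "inj_on c A")
    case True
    then have "card A \<le> card C"
      using card_inj_on_le psubset assms by blast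
    then have "p / 2 * card A \<le> p / 2 * card C"
      using p by (intro mult_left_mono) auto
    moreover have "(\<Sum>i\<in>A. w i) \<le> (\<Sum>i\<in>A. 1)"
      using psubset by (intro sum_mono) auto
    ultimately show ?thesis by (simp add: algebra_simps)
  next
    case False
    then obtain i j where ij: "i \<in> A" "j \<in> A" "i \<noteq> j" "c i = c j"
      by (auto simp: inj_on_def)
    define B where "B = A - {i, j}"
    have A: "A = insert i (insert j B)" "finite B" "i \<notin> insert j B" "j \<notin> B"
      using ij psubset by (auto simp: B_def)
    have "(\<Sum>i\<in>B. w i) \<le> (1 - p / 2) * card B + p / 2 * card C"
      using psubset.prems ij by (intro psubset.IH) (auto simp: B_def)
    moreover have "w i + w j \<le> 2 - p" using psubset.prems ij by auto
    moreover have "(\<Sum>i\<in>A. w i) = w i + (w j + (\<Sum>i\<in>B. w i))"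
      unfolding A(1) using A by simp
    moreover have "real (card A) = card B + 2"
      unfolding A(1) using A by simp
    ultimately show ?thesis by (simp add: algebra_simps)
  qed
qed

text \<open>In the next three lemmas \<open>a t\<close> is the expected number of survivors at time \<open>t\<close> and \<open>b K t\<close> the
expected number of those outside the window of radius \<open>K\<close>.  At one scale, \<open>J\<close> steps of length
\<open>h\<close> are made while the window grows by \<open>d\<close> in each step.\<close>

lemma one_scale_bound:
  fixes a :: "real \<Rightarrow> real" and b :: "real \<Rightarrow> real \<Rightarrow> real"
  assumes q: "0 < q" "q < 1" and h: "0 \<le> h" "h \<in> \<rat>" and eps: "0 \<le> eps" and d: "0 \<le> d"
    and stepa: "\<And>t K. t \<in> \<rat> \<Longrightarrow> 0 \<le> t \<Longrightarrow> K0 \<le> K \<Longrightarrow> K \<le> K0 + 1 \<Longrightarrow> b K t \<le> 1 \<Longrightarrow> a (t + h) \<le> q * a t + (1 - q) * L"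
    and stepb: "\<And>t K. t \<in> \<rat> \<Longrightarrow> 0 \<le> t \<Longrightarrow> K0 \<le> K \<Longrightarrow> b (K + d) (t + h) \<le> b K t + eps * a t"
    and start: "t \<in> \<rat>" "0 \<le> t" "K0 \<le> K" "a t \<le> 4 * L" "0 \<le> L"
    and K: "K + J * d \<le> K0 + 1" and bb: "b K t + J * (eps * (4 * L)) \<le> 1"
  shows "a (t + J * h) \<le> q ^ J * (4 * L) + L \<and> b (K + J * d) (t + J * h) \<le> b K t + J * (eps * (4 * L))"
proof -
  have "m \<le> J \<Longrightarrow> a (t + m * h) \<le> q ^ m * (4 * L) + (1 - q ^ m) * L \<and> b (K + m * d) (t + m * h) \<le> b K t + m * (eps * (4 * L))" for m
  proof (induction m)
    case 0
    then show ?case using start by simp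
  next
    case (Suc m)
    let ?t = "t + m * h" and ?K = "K + m * d"
    have IH: "a ?t \<le> q ^ m * (4 * L) + (1 - q ^ m) * L" "b ?K ?t \<le> b K t + m * (eps * (4 * L))"
      using Suc by auto
    have t: "?t \<in> \<rat>" "0 \<le> ?t" using start h by auto
    have "real m * d \<le> real J * d" using Suc d by (intro mult_right_mono) auto
    moreover have "0 \<le> real m * d" using d by simp
    ultimately have K: "K0 \<le> ?K" "?K \<le> K0 + 1" using K start by linarith+
    have "real m * (eps * (4 * L)) \<le> real J * (eps * (4 * L))"
      using Suc eps start by (intro mult_right_mono) auto
    then have b1: "b ?K ?t \<le> 1" using IH bb by linarith
    have "a (?t + h) \<le> q * a ?t + (1 - q) * L"
      by (rule stepa[OF t K b1])
    also have "\<dots> \<le> q * (q ^ m * (4 * L) + (1 - q ^ m) * L) + (1 - q) * L"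
      using IH q by (intro add_right_mono mult_left_mono) auto
    also have "\<dots> = q ^ Suc m * (4 * L) + (1 - q ^ Suc m) * L"
      by (simp add: algebra_simps)
    finally have A: "a (?t + h) \<le> q ^ Suc m * (4 * L) + (1 - q ^ Suc m) * L" .
    have "q ^ m * L \<le> 1 * L" using q start by (intro mult_right_mono power_le_one) auto
    then have "a ?t \<le> 4 * L" using IH(1) by (simp add: algebra_simps)
    then have "eps * a ?t \<le> eps * (4 * L)" using eps by (intro mult_left_mono) auto
    moreover have "b (?K + d) (?t + h) \<le> b ?K ?t + eps * a ?t"
      by (rule stepb[OF t K(1)])
    ultimately have "b (?K + d) (?t + h) \<le> b K t + Suc m * (eps * (4 * L))"
      using IH(2) by (simp add: algebra_simps)
    then show ?case using A by (simp add: algebra_simps)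
  qed
  from this[of J] have "a (t + J * h) \<le> q ^ J * (4 * L) + (1 - q ^ J) * L"
     "b (K + J * d) (t + J * h) \<le> b K t + J * (eps * (4 * L))" by auto
  moreover have "0 \<le> q ^ J * L" using q start by simp
  ultimately show ?thesis by (simp add: algebra_simps)
qed

text \<open>Scale \<open>j\<close> stands for cells of width proportional to \<open>1 / 2 ^ j\<close>.  Starting from scale
\<open>k0 + N\<close>, the \<open>J\<close> steps at scale \<open>j\<close> halve the bound \<open>4 * L j\<close>.  The sequence \<open>m\<close>
controls at once the time spent, the growth of the window and the number of escapes.\<close>

lemma multiscale_bound:
  fixes a :: "real \<Rightarrow> real" and b :: "real \<Rightarrow> real \<Rightarrow> real" and h d eps L m :: "nat \<Rightarrow> real"
  assumes q: "0 < q" "q < 1" "q ^ J \<le> 1 / 4"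
    and h: "\<And>j. k0 \<le> j \<Longrightarrow> 0 \<le> h j" "\<And>j. k0 \<le> j \<Longrightarrow> h j \<in> \<rat>"
    and eps: "\<And>j. k0 \<le> j \<Longrightarrow> 0 \<le> eps j" and d: "\<And>j. k0 \<le> j \<Longrightarrow> 0 \<le> d j"
    and L: "\<And>j. 0 \<le> L j" "\<And>j. L (Suc j) = 2 * L j"
    and stepa: "\<And>j t K. k0 \<le> j \<Longrightarrow> t \<in> \<rat> \<Longrightarrow> 0 \<le> t \<Longrightarrow> K0 \<le> K \<Longrightarrow> K \<le> K0 + 1 \<Longrightarrow> b K t \<le> 1 \<Longrightarrow> a (t + h j) \<le> q * a t + (1 - q) * L j"
    and stepb: "\<And>j t K. k0 \<le> j \<Longrightarrow> t \<in> \<rat> \<Longrightarrow> 0 \<le> t \<Longrightarrow> K0 \<le> K \<Longrightarrow> b (K + d j) (t + h j) \<le> b K t + eps j * a t"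
    and start: "a 0 \<le> 4 * L (k0 + N)" "b K0 0 \<le> 0"
    and m: "\<And>j. k0 \<le> j \<Longrightarrow> J * h j \<le> m j" "\<And>j. k0 \<le> j \<Longrightarrow> J * d j \<le> m j"
      "\<And>j. k0 \<le> j \<Longrightarrow> J * (eps j * (4 * L j)) \<le> m j"
    and summ: "\<And>M. (\<Sum>j=k0..M. m j) \<le> 1" "\<And>M. (\<Sum>j=k0..M. m j) \<le> s"
  shows "\<exists>t. 0 \<le> t \<and> t \<le> s \<and> a t \<le> 4 * L k0"
proof -
  have m0: "0 \<le> m j" if "k0 \<le> j" for j
    using m(1)[OF that] h(1)[OF that] by (meson mult_nonneg_nonneg of_nat_0_le_iff order_trans)
  have "k \<le> N \<Longrightarrow> \<exists>t K. t \<in> \<rat> \<and> 0 \<le> t \<and> t \<le> (\<Sum>j\<in>{k0+N-k<..k0+N}. m j) \<and> K0 \<le> K \<and> K \<le> K0 + (\<Sum>j\<in>{k0+N-k<..k0+N}. m j) \<and>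
      a t \<le> 4 * L (k0 + N - k) \<and> b K t \<le> (\<Sum>j\<in>{k0+N-k<..k0+N}. m j)" for k
  proof (induction k)
    case 0
    then show ?case using start by (intro exI[of _ 0] exI[of _ K0]) auto
  next
    case (Suc k)
    define j where "j = k0 + N - k"
    have j: "k0 < j" "k0 + N - Suc k = j - 1" using Suc by (auto simp: j_def)
    let ?S = "\<Sum>i\<in>{j<..k0+N}. m i"
    have jj: "{j - 1<..k0+N} = insert j {j<..k0+N}" using j Suc by (auto simp: j_def)
    then have SS: "(\<Sum>i\<in>{j-1<..k0+N}. m i) = m j + ?S" by simp
    have "m j + ?S = (\<Sum>i\<in>insert j {j<..k0+N}. m i)" by simp
    also have "\<dots> \<le> (\<Sum>i=k0..k0+N. m i)"
      using m0 j Suc by (intro sum_mono2) (auto simp: j_def)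
    finally have S1: "m j + ?S \<le> 1" using summ(1)[of "k0+N"] by linarith
    obtain t K where tK: "t \<in> \<rat>" "0 \<le> t" "t \<le> ?S" "K0 \<le> K" "K \<le> K0 + ?S" "a t \<le> 4 * L j" "b K t \<le> ?S"
      using Suc by (auto simp: j_def)
    have "a (t + J * h j) \<le> q ^ J * (4 * L j) + L j \<and> b (K + J * d j) (t + J * h j) \<le> b K t + J * (eps j * (4 * L j))"
      using tK S1 m(2,3)[of j] j
      by (intro one_scale_bound[where ?K0.0 = K0] q h eps d stepa stepb L) auto
    moreover have "q ^ J * (4 * L j) \<le> 1 / 4 * (4 * L j)"
      using q L by (intro mult_right_mono) auto
    moreover have "L j = 2 * L (j - 1)" using L(2)[of "j - 1"] j by simp
    ultimately have "a (t + J * h j) \<le> 4 * L (j - 1)" "b (K + J * d j) (t + J * h j) \<le> b K t + J * (eps j * (4 * L j))"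
      by auto
    moreover have "0 \<le> J * h j" "0 \<le> J * d j" using h(1)[of j] d(1)[of j] j by auto
    moreover have "t + J * h j \<in> \<rat>" using tK h(2)[of j] j by auto
    ultimately show ?case
      using tK m[of j] j unfolding j(2) SS
      by (intro exI[of _ "t + J * h j"] exI[of _ "K + J * d j"]) auto
  qed
  from this[of N] obtain t where t: "0 \<le> t" "t \<le> (\<Sum>j\<in>{k0<..k0+N}. m j)" "a t \<le> 4 * L k0" by auto
  have "(\<Sum>j\<in>{k0<..k0+N}. m j) \<le> (\<Sum>j=k0..k0+N. m j)"
    using m0 by (intro sum_mono2) auto
  then show ?thesis using t summ(2)[of "k0+N"] by (intro exI[of _ t]) auto
qed

text \<open>The bound at the time \<open>s > 0\<close> does not involve the initial value \<open>a 0\<close>.  The first hypothesis on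
\<open>a\<close> and \<open>b\<close> is the effect of meetings within cells of width \<open>l\<close>, the second the effect of jumps
of size at least \<open>d\<close>.\<close>

lemma instantaneous_bound:
  fixes \<alpha> q \<tau> C K0 s :: real
  assumes al: "\<alpha> > 1" and q: "0 < q" "q < 1" and tau: "\<tau> > 0" and C: "C \<ge> 0" and K0: "K0 \<ge> 0" and s: "s > 0"
  shows "\<exists>B. \<forall>(a :: real \<Rightarrow> real) (b :: real \<Rightarrow> real \<Rightarrow> real).
    (\<forall>l t h K. 0 < l \<longrightarrow> t \<in> \<rat> \<longrightarrow> h \<in> \<rat> \<longrightarrow> 0 \<le> t \<longrightarrow> \<tau> * l powr \<alpha> \<le> h \<longrightarrow> K0 \<le> K \<longrightarrow>
        a (t + h) \<le> q * a t + (1 - q) * (2 * K / l + 2 + b K t)) \<longrightarrow>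
    (\<forall>t h d K. t \<in> \<rat> \<longrightarrow> h \<in> \<rat> \<longrightarrow> 0 \<le> t \<longrightarrow> 0 < h \<longrightarrow> 0 < d \<longrightarrow> K0 \<le> K \<longrightarrow>
        b (K + d) (t + h) \<le> b K t + C * h * d powr (-\<alpha>) * a t) \<longrightarrow>
    (\<forall>t t'. 0 \<le> t \<longrightarrow> t \<le> t' \<longrightarrow> a t' \<le> a t) \<longrightarrow> b K0 0 \<le> 0 \<longrightarrow> a s \<le> B"
proof -
  define D where "D = 2 * (K0 + 1) + 3"
  have D: "D > 0" using K0 by (simp add: D_def)
  obtain J :: nat where J: "q ^ J \<le> 1 / 4"
    using real_arch_pow_inv[of "1/4" q] q by (auto intro: less_imp_le)
  \<comment> \<open>If the window grows by \<open>2 powr (- \<beta> * j)\<close> at scale \<open>j\<close>, the expected number of escapes is of order \<open>2 powr (- j * (\<alpha> - 1) / 2)\<close>.\<close>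
  define \<beta> where "\<beta> = (\<alpha> - 1) / (2 * \<alpha>)"
  define \<rho> where "\<rho> = 2 powr (-\<beta>)"
  have beta: "\<beta> > 0" using al by (simp add: \<beta>_def)
  have rho: "0 < \<rho>" "\<rho> < 1" using beta by (auto simp: \<rho>_def powr_less_one)
  have rhopow: "\<rho> ^ j = 2 powr (- \<beta> * real j)" for j
    unfolding \<rho>_def by (simp add: powr_powr flip: powr_realpow)
  have "\<exists>h\<in>\<rat>. \<tau> * (1 / 2 ^ j) powr \<alpha> \<le> h \<and> h \<le> 2 * \<tau> * (1 / 2 ^ j) powr \<alpha>" for j :: nat
  proof -
    have "\<tau> * (1 / 2 ^ j) powr \<alpha> < 2 * \<tau> * (1 / 2 ^ j) powr \<alpha>" using tau by simp
    from Rats_dense_in_real[OF this] show ?thesis by (auto intro: less_imp_le)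
  qed
  then obtain h where h: "\<And>j. h j \<in> \<rat>" "\<And>j::nat. \<tau> * (1 / 2 ^ j) powr \<alpha> \<le> h j" "\<And>j. h j \<le> 2 * \<tau> * (1 / 2 ^ j) powr \<alpha>"
    by metis
  have hpos: "h j > 0" for j using h(2)[of j] tau by (smt (verit) divide_pos_pos mult_pos_pos powr_gt_zero zero_less_power)
  have pw: "(1 / 2 ^ j) powr \<alpha> = 2 powr (- \<alpha> * j)" for j :: nat
  proof -
    have "1 / 2 ^ j = (2::real) powr (- real j)"
      by (subst powr_minus_divide, subst powr_realpow) auto
    then have "(1 / 2 ^ j) powr \<alpha> = 2 powr (- real j * \<alpha>)"
      by (metis powr_powr)
    then show ?thesis by (simp only: minus_mult_commute mult.commute minus_mult_left)
  qed
  define L where "L j = D * 2 ^ j" for j :: nat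
  define d where "d j = \<rho> ^ j" for j :: nat
  define eps where "eps j = C * h j * d j powr (-\<alpha>)" for j
  define E where "E = J * (2 * \<tau>) + J + J * (C * (2 * \<tau>) * 4 * D)"
  have E0: "0 \<le> J * (2 * \<tau>)" "0 \<le> J * (C * (2 * \<tau>) * 4 * D)" using tau C D by auto
  have rj0: "\<rho> ^ j \<ge> 0" for j using rho by simp
  have m1: "J * h j \<le> E * \<rho> ^ j" for j
  proof -
    have "\<beta> \<le> 1" using al by (simp add: \<beta>_def field_simps)
    then have "\<beta> \<le> \<alpha>" using al by simp
    then have "(1 / 2 ^ j) powr \<alpha> \<le> \<rho> ^ j"
      unfolding pw rhopow by (intro powr_mono) (auto intro: mult_right_mono)
    then have "h j \<le> 2 * \<tau> * \<rho> ^ j"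
      using h(3)[of j] tau by (smt (verit) mult_left_mono)
    then have "J * h j \<le> J * (2 * \<tau> * \<rho> ^ j)" by (intro mult_left_mono) auto
    also have "\<dots> = (J * (2 * \<tau>)) * \<rho> ^ j" by simp
    also have "\<dots> \<le> E * \<rho> ^ j" unfolding E_def using E0 rj0 by (intro mult_right_mono) auto
    finally show ?thesis .
  qed
  have m2: "J * d j \<le> E * \<rho> ^ j" for j
    unfolding E_def d_def using E0 rj0 by (intro mult_right_mono) auto
  have m3: "J * (eps j * (4 * L j)) \<le> E * \<rho> ^ j" for j
  proof -
    have "d j powr (-\<alpha>) = 2 powr (\<alpha> * \<beta> * j)"
      unfolding d_def rhopow by (simp add: powr_powr mult_ac)
    then have "eps j \<le> C * (2 * \<tau> * 2 powr (- \<alpha> * j)) * 2 powr (\<alpha> * \<beta> * j)"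
      unfolding eps_def using h(3)[of j] C tau unfolding pw by (intro mult_mono) (auto intro: mult_left_mono less_imp_le[OF hpos])
    then have "eps j * (4 * L j) \<le> (C * (2 * \<tau> * 2 powr (- \<alpha> * j)) * 2 powr (\<alpha> * \<beta> * j)) * (4 * L j)"
      using D by (intro mult_right_mono) (auto simp: L_def)
    also have "\<dots> = (C * (2 * \<tau>) * 4 * D) * (2 powr (- \<alpha> * j) * 2 powr (\<alpha> * \<beta> * j) * 2 powr (real j))"
      by (simp add: L_def powr_realpow)
    also have "2 powr (- \<alpha> * j) * 2 powr (\<alpha> * \<beta> * j) * 2 powr (real j) = 2 powr ((- (\<alpha> - 1) / 2) * j)"
    proof -
      have ab: "\<alpha> * \<beta> = (\<alpha> - 1) / 2" using al by (simp add: \<beta>_def)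
      have "- \<alpha> * j + \<alpha> * \<beta> * j + j = (- (\<alpha> - 1) / 2) * real j"
        unfolding ab by (simp add: field_simps)
      then show ?thesis unfolding powr_add[symmetric] by (simp only:)
    qed
    also have "(C * (2 * \<tau>) * 4 * D) * 2 powr ((- (\<alpha> - 1) / 2) * j) \<le> (C * (2 * \<tau>) * 4 * D) * \<rho> ^ j"
    proof (intro mult_left_mono)
      have "\<beta> \<le> (\<alpha> - 1) / 2"
        unfolding \<beta>_def using al by (intro divide_left_mono) auto
      then have "- (\<alpha> - 1) / 2 \<le> - \<beta>" by simp
      then have "- (\<alpha> - 1) / 2 * real j \<le> - \<beta> * real j" by (intro mult_right_mono) auto
      then show "2 powr ((- (\<alpha> - 1) / 2) * j) \<le> \<rho> ^ j"
        unfolding rhopow by (intro powr_mono) auto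
    qed (use C tau D in auto)
    finally have "J * (eps j * (4 * L j)) \<le> J * ((C * (2 * \<tau>) * 4 * D) * \<rho> ^ j)" by (intro mult_left_mono) auto
    also have "\<dots> = (J * (C * (2 * \<tau>) * 4 * D)) * \<rho> ^ j" by simp
    also have "\<dots> \<le> E * \<rho> ^ j" unfolding E_def using E0 rj0 by (intro mult_right_mono) auto
    finally show ?thesis .
  qed
  have Epos: "E \<ge> 0" using E0 by (simp add: E_def)
  have "(\<lambda>k. E * \<rho> ^ k / (1 - \<rho>)) \<longlonglongrightarrow> E * 0 / (1 - \<rho>)"
    using rho by (intro tendsto_intros LIMSEQ_power_zero) auto
  then have "eventually (\<lambda>k. E * \<rho> ^ k / (1 - \<rho>) < min 1 s) sequentially"
    using s by (intro order_tendstoD(2)) auto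
  then obtain k0 where k0: "E * \<rho> ^ k0 / (1 - \<rho>) < min 1 s" by (auto simp: eventually_sequentially)
  have tail: "(\<Sum>j=k0..M. E * \<rho> ^ j) \<le> min 1 s" for M
  proof -
    have "(\<Sum>j=k0..M. \<rho> ^ j) \<le> \<rho> ^ k0 / (1 - \<rho>)"
      using rho by (cases "M < k0") (auto simp: sum_gp field_simps)
    then have "E * (\<Sum>j=k0..M. \<rho> ^ j) \<le> E * (\<rho> ^ k0 / (1 - \<rho>))"
      using Epos by (intro mult_left_mono)
    then show ?thesis using k0 by (simp add: sum_distrib_left)
  qed
  show ?thesis
  proof (rule exI[of _ "4 * L k0"], intro allI impI)
    fix a :: "real \<Rightarrow> real" and b :: "real \<Rightarrow> real \<Rightarrow> real"
    assume A: "\<forall>l t h K. 0 < l \<longrightarrow> t \<in> \<rat> \<longrightarrow> h \<in> \<rat> \<longrightarrow> 0 \<le> t \<longrightarrow> \<tau> * l powr \<alpha> \<le> h \<longrightarrow> K0 \<le> K \<longrightarrow>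
        a (t + h) \<le> q * a t + (1 - q) * (2 * K / l + 2 + b K t)"
      and B: "\<forall>t h d K. t \<in> \<rat> \<longrightarrow> h \<in> \<rat> \<longrightarrow> 0 \<le> t \<longrightarrow> 0 < h \<longrightarrow> 0 < d \<longrightarrow> K0 \<le> K \<longrightarrow>
        b (K + d) (t + h) \<le> b K t + C * h * d powr (-\<alpha>) * a t"
      and mono: "\<forall>t t'. 0 \<le> t \<longrightarrow> t \<le> t' \<longrightarrow> a t' \<le> a t" and b0: "b K0 0 \<le> 0"
    obtain N :: nat where N: "a 0 / (4 * D) < 2 ^ N"
      using real_arch_pow[of 2 "a 0 / (4 * D)"] by auto
    have "a 0 < 4 * D * 2 ^ N" using N D by (simp add: field_simps)
    also have "\<dots> \<le> 4 * L (k0 + N)" using D by (simp add: L_def power_add)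
    finally have N': "a 0 \<le> 4 * L (k0 + N)" by simp
    have "\<exists>t. 0 \<le> t \<and> t \<le> s \<and> a t \<le> 4 * L k0"
    proof (rule multiscale_bound[where m = "\<lambda>j. E * \<rho> ^ j" and h = h and d = d and eps = eps and L = L and q = q and J = J and N = N and b = b and ?K0.0 = K0])
      fix j :: nat and t K :: real assume jt: "k0 \<le> j" "t \<in> \<rat>" "0 \<le> t" "K0 \<le> K" "K \<le> K0 + 1" "b K t \<le> 1"
      have "a (t + h j) \<le> q * a t + (1 - q) * (2 * K / (1 / 2 ^ j) + 2 + b K t)"
        by (rule A[rule_format]) (use jt h in auto)
      also have "\<dots> \<le> q * a t + (1 - q) * L j"
      proof (intro add_left_mono mult_left_mono)
        have "2 * K * 2 ^ j \<le> 2 * (K0 + 1) * 2 ^ j" using jt by (intro mult_right_mono) auto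
        moreover have "1 \<le> (2::real) ^ j" by simp
        then have "3 \<le> 3 * (2::real) ^ j" by linarith
        ultimately have "2 * K * 2 ^ j + 2 + b K t \<le> 2 * (K0 + 1) * 2 ^ j + 3 * 2 ^ j" using jt by linarith
        then show "2 * K / (1 / 2 ^ j) + 2 + b K t \<le> L j" by (simp add: L_def D_def algebra_simps)
      qed (use q in auto)
      finally show "a (t + h j) \<le> q * a t + (1 - q) * L j" .
    next
      fix j :: nat and t K :: real assume jt: "k0 \<le> j" "t \<in> \<rat>" "0 \<le> t" "K0 \<le> K"
      show "b (K + d j) (t + h j) \<le> b K t + eps j * a t"
        unfolding eps_def using B jt h hpos rho by (auto simp: d_def)
    next
      fix M show "(\<Sum>j=k0..M. E * \<rho> ^ j) \<le> 1" "(\<Sum>j=k0..M. E * \<rho> ^ j) \<le> s"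
        using tail[of M] by auto
    qed (use q J hpos h C D rho m1 m2 m3 b0 N' in \<open>auto simp: eps_def d_def L_def less_imp_le intro!: mult_nonneg_nonneg\<close>)
    then obtain t where "0 \<le> t" "t \<le> s" "a t \<le> 4 * L k0" by blast
    then show "a s \<le> 4 * L k0" using mono by (meson order_trans)
  qed
qed

section \<open>Levy laws on path space and the Markov property\<close>

lemma space_path_space: "space (path_space :: (real \<Rightarrow> real) measure) = extensional {0..}"
  by (auto simp: path_space_def space_PiM PiE_def)

lemma measurable_path_coord [measurable]: "0 \<le> u \<Longrightarrow> (\<lambda>f. f u) \<in> path_space \<rightarrow>\<^sub>M borel"
  unfolding path_space_def by (rule measurable_component_singleton) auto

lemma measurable_path_of [measurable]:
  assumes "\<And>t. 0 \<le> t \<Longrightarrow> X t \<in> borel_measurable M"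
  shows "path_of X \<in> M \<rightarrow>\<^sub>M path_space"
  unfolding path_space_def path_of_def using assms by (intro measurable_restrict) auto

text \<open>The path that follows \<open>f\<close> up to time \<open>t\<close> and then moves by the increments of \<open>g\<close>.  Only
paths with \<open>g 0 = 0\<close> are of interest, for which the two clauses agree at \<open>u = t\<close>.\<close>

definition glue :: "real \<Rightarrow> (real \<Rightarrow> real) \<Rightarrow> (real \<Rightarrow> real) \<Rightarrow> real \<Rightarrow> real" where
  "glue t f g = (\<lambda>u\<in>{0..}. if u \<le> t then f u else f t + g (u - t))"

lemma measurable_glue [measurable]:
  assumes t: "0 \<le> t"
  shows "(\<lambda>(f, g). glue t f g) \<in> path_space \<Otimes>\<^sub>M path_space \<rightarrow>\<^sub>M path_space"
proof -
  have "(\<lambda>z. if u \<le> t then fst z u else fst z t + snd z (u - t) :: real) \<in> borel_measurable (path_space \<Otimes>\<^sub>M path_space)"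
    if "u \<in> {0..}" for u
  proof (cases "u \<le> t")
    case True
    then show ?thesis using that by simp
  next
    case False
    have "(\<lambda>z. fst z t + snd z (u - t) :: real) \<in> borel_measurable (path_space \<Otimes>\<^sub>M path_space)"
      using False t
      by (intro borel_measurable_add measurable_compose[OF measurable_fst measurable_path_coord[of t]]
          measurable_compose[OF measurable_snd measurable_path_coord[of "u - t"]]) auto
    then show ?thesis using False by simp
  qed
  then have "(\<lambda>z. \<lambda>u\<in>{0..}. if u \<le> t then fst z u else fst z t + snd z (u - t) :: real) \<in> path_space \<Otimes>\<^sub>M path_space \<rightarrow>\<^sub>M PiM {0..} (\<lambda>_. borel)"
    by (intro measurable_restrict) auto
  then show ?thesis
    by (simp add: glue_def case_prod_beta path_space_def)
qed

text \<open>The law of a Levy process started at 0, as far as it is determined by finite-dimensional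
distributions.  The last assumption combines independence and stationarity of the increments.\<close>

locale levy_law = prob_space W for W :: "(real \<Rightarrow> real) measure" +
  assumes sets_W [measurable_cong]: "sets W = sets path_space"
    and start0: "AE f in W. f 0 = 0"
    and increments: "\<And>s n B. mono s \<Longrightarrow> 0 \<le> s 0 \<Longrightarrow> (\<And>k. k < n \<Longrightarrow> B k \<in> sets borel) \<Longrightarrow>
      prob {f \<in> space W. \<forall>k<n. f (s (Suc k)) - f (s k) \<in> B k} =
      (\<Prod>k<n. prob {f \<in> space W. f (s (Suc k) - s k) \<in> B k})"
begin

lemma space_W: "space W = extensional {0..}"
  using sets_eq_imp_space_eq[OF sets_W] space_path_space by simp

lemma coord_measurable [measurable]: "0 \<le> u \<Longrightarrow> (\<lambda>f. f u) \<in> borel_measurable W"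
  by measurable

lemma pair_prob: "pair_prob_space W W"
  by (simp add: pair_prob_space_def pair_sigma_finite_def prob_space_axioms prob_space_imp_sigma_finite)

text \<open>Increments of a path along a sequence of times, and their law.\<close>

definition inc :: "(nat \<Rightarrow> real) \<Rightarrow> nat \<Rightarrow> (real \<Rightarrow> real) \<Rightarrow> nat \<Rightarrow> real" where
  "inc s n f = (\<lambda>k\<in>{..<n}. f (s (Suc k)) - f (s k))"

definition inc_law :: "(nat \<Rightarrow> real) \<Rightarrow> nat \<Rightarrow> (nat \<Rightarrow> real) measure" where
  "inc_law s n = PiM {..<n} (\<lambda>k. distr W borel (\<lambda>f. f (s (Suc k) - s k)))"

lemma monoD0: "mono s \<Longrightarrow> 0 \<le> s 0 \<Longrightarrow> 0 \<le> (s k :: real)" for k :: nat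
  by (meson le0 monoD order_trans)

text \<open>A process whose increments along \<open>s\<close> have the product probabilities has increments of law
\<open>inc_law s n\<close>.\<close>

lemma inc_law_eqI:
  assumes s: "mono s" "0 \<le> s 0" and M: "prob_space M"
    and Y: "Y \<in> M \<rightarrow>\<^sub>M PiM {..<n} (\<lambda>_. borel)"
    and eq: "\<And>B. (\<And>k. k < n \<Longrightarrow> B k \<in> sets borel) \<Longrightarrow>
      measure M {\<omega> \<in> space M. \<forall>k<n. Y \<omega> k \<in> B k} = (\<Prod>k<n. prob {f \<in> space W. f (s (Suc k) - s k) \<in> B k})"
  shows "distr M (PiM {..<n} (\<lambda>_. borel)) Y = inc_law s n"
proof -
  interpret M: prob_space M by fact
  let ?D = "\<lambda>k. distr W borel (\<lambda>f. f (s (Suc k) - s k))"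
  have pos: "0 \<le> s (Suc k) - s k" for k using s by (auto simp: mono_iff_le_Suc)
  have "product_prob_space ?D"
    using pos by (intro product_prob_spaceI prob_space_distr) auto
  then interpret D: product_prob_space ?D .
  show ?thesis unfolding inc_law_def
  proof (rule D.PiM_eqI)
    fix B assume B: "\<And>k. k \<in> {..<n} \<Longrightarrow> B k \<in> sets (?D k)"
    have Bs: "B k \<in> sets borel" if "k < n" for k using B[of k] that by simp
    have "emeasure (distr M (PiM {..<n} (\<lambda>_. borel)) Y) (Pi\<^sub>E {..<n} B) = emeasure M (Y -` Pi\<^sub>E {..<n} B \<inter> space M)"
      using Bs by (intro emeasure_distr Y sets_PiM_I_finite) auto
    also have "Y -` Pi\<^sub>E {..<n} B \<inter> space M = {\<omega> \<in> space M. \<forall>k<n. Y \<omega> k \<in> B k}"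
      using measurable_space[OF Y] by (auto simp: space_PiM PiE_iff)
    also have "emeasure M \<dots> = ennreal (\<Prod>k<n. prob {f \<in> space W. f (s (Suc k) - s k) \<in> B k})"
      using eq[of B] Bs by (simp add: M.emeasure_eq_measure)
    also have "\<dots> = (\<Prod>k<n. emeasure (?D k) (B k))"
      using Bs pos by (subst prod_ennreal[symmetric])
       (auto simp: emeasure_distr emeasure_eq_measure intro!: prod.cong arg_cong[where f = "measure W"])
    finally show "emeasure (distr M (PiM {..<n} (\<lambda>_. borel)) Y) (Pi\<^sub>E {..<n} B) = (\<Prod>k\<in>{..<n}. emeasure (?D k) (B k))" .
  qed (auto intro!: sets_PiM_cong)
qed

lemma inc_measurable:
  assumes "mono s" "0 \<le> s 0"
  shows "inc s n \<in> path_space \<rightarrow>\<^sub>M PiM {..<n} (\<lambda>_. borel)"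
  unfolding inc_def using monoD0[OF assms] by (intro measurable_restrict borel_measurable_diff measurable_path_coord)

lemma distr_inc:
  assumes s: "mono s" "0 \<le> s 0"
  shows "distr W (PiM {..<n} (\<lambda>_. borel)) (inc s n) = inc_law s n"
proof (rule inc_law_eqI[OF s prob_space_axioms])
  show "inc s n \<in> W \<rightarrow>\<^sub>M PiM {..<n} (\<lambda>_. borel)"
    using inc_measurable[OF s] sets_W by (simp cong: measurable_cong_sets)
qed (use increments[OF s] in \<open>simp add: inc_def\<close>)

lemma AE_snd_start0: "AE z in W \<Otimes>\<^sub>M W. snd z 0 = 0"
proof -
  interpret WW: pair_prob_space W W by (rule pair_prob)
  have [measurable]: "(\<lambda>z. snd z 0) \<in> borel_measurable (W \<Otimes>\<^sub>M W)"
    by (rule measurable_compose[OF measurable_snd coord_measurable]) simp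
  have "{z \<in> space (W \<Otimes>\<^sub>M W). snd z 0 = 0} \<in> sets (W \<Otimes>\<^sub>M W)"
    by measurable
  then show ?thesis
    using WW.AE_pair_iff[of "\<lambda>f g. g 0 = 0"] start0 by simp
qed

lemma distr_inc_glue:
  assumes s: "mono s" "0 \<le> s 0" and k0: "k0 \<le> n"
  shows "distr (W \<Otimes>\<^sub>M W) (PiM {..<n} (\<lambda>_. borel)) (\<lambda>(f, g). inc s n (glue (s k0) f g)) = inc_law s n"
proof (rule inc_law_eqI[OF s])
  interpret WW: pair_prob_space W W by (rule pair_prob)
  show "prob_space (W \<Otimes>\<^sub>M W)" by unfold_locales
  let ?t = "s k0"
  note spos = monoD0[OF s]
  have m: "(\<lambda>z. inc s n (case z of (f, g) \<Rightarrow> glue ?t f g)) \<in> path_space \<Otimes>\<^sub>M path_space \<rightarrow>\<^sub>M PiM {..<n} (\<lambda>_. borel)"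
    by (rule measurable_compose[OF measurable_glue inc_measurable[OF s]]) (rule spos)
  then show meas: "(\<lambda>(f, g). inc s n (glue ?t f g)) \<in> W \<Otimes>\<^sub>M W \<rightarrow>\<^sub>M PiM {..<n} (\<lambda>_. borel)"
    using sets_W by (simp add: case_prod_beta cong: measurable_cong_sets sets_pair_measure_cong)
  fix B :: "nat \<Rightarrow> real set" assume B: "\<And>k. k < n \<Longrightarrow> B k \<in> sets borel"
  define r where "r j = s (k0 + j) - ?t" for j
  have r: "mono r" "0 \<le> r 0" using s by (auto simp: r_def mono_def)
  let ?E = "{f \<in> space W. \<forall>k<k0. f (s (Suc k)) - f (s k) \<in> B k}"
  let ?F = "{g \<in> space W. \<forall>j<n - k0. g (r (Suc j)) - g (r j) \<in> B (k0 + j)}"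
  have mE: "?E \<in> sets W"
  proof -
    have [measurable]: "(\<lambda>f. f (s (Suc k)) - f (s k)) \<in> borel_measurable W" for k
      using spos by (intro borel_measurable_diff coord_measurable)
    have "{f \<in> space W. f (s (Suc k)) - f (s k) \<in> B k} \<in> sets W" if "k \<in> {..<k0}" for k
    proof -
      have [measurable]: "B k \<in> sets borel" using B that k0 by auto
      show ?thesis by measurable
    qed
    then have "{f \<in> space W. \<forall>k\<in>{..<k0}. f (s (Suc k)) - f (s k) \<in> B k} \<in> sets W"
      by (intro sets.sets_Collect_finite_All) auto
    then show ?thesis by (simp only: Ball_def lessThan_iff)
  qed
  have mF: "?F \<in> sets W"
  proof -
    have [measurable]: "(\<lambda>f. f (r (Suc k)) - f (r k)) \<in> borel_measurable W" for k
      using monoD0[OF r] by (intro borel_measurable_diff coord_measurable)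
    have "{f \<in> space W. f (r (Suc k)) - f (r k) \<in> B (k0 + k)} \<in> sets W" if "k \<in> {..<n - k0}" for k
    proof -
      have [measurable]: "B (k0 + k) \<in> sets borel" using B that k0 by auto
      show ?thesis by measurable
    qed
    then have "{f \<in> space W. \<forall>k\<in>{..<n - k0}. f (r (Suc k)) - f (r k) \<in> B (k0 + k)} \<in> sets W"
      by (intro sets.sets_Collect_finite_All) auto
    then show ?thesis by (simp only: Ball_def lessThan_iff)
  qed
  have incs: "k < n \<Longrightarrow> (if k < k0 then f (s (Suc k)) - f (s k) else g (r (Suc (k - k0))) - g (r (k - k0))) = inc s n (glue ?t f g) k"
    if "g 0 = 0" for f g k
  proof -
    assume kn: "k < n"
    have p: "0 \<le> s k" "0 \<le> s (Suc k)" using spos by auto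
    show ?thesis
    proof (cases "k < k0")
      case True
      then have "s k \<le> ?t" "s (Suc k) \<le> ?t" using s by (auto intro: monoD)
      then show ?thesis using kn True p by (simp add: inc_def glue_def)
    next
      case False
      then have "?t \<le> s k" "?t \<le> s (Suc k)" using s by (auto intro: monoD)
      moreover have "glue ?t f g u = f ?t + g (u - ?t)" if "?t \<le> u" for u
        using that spos[of k0] \<open>g 0 = 0\<close> by (auto simp: glue_def)
      ultimately show ?thesis using kn False by (simp add: inc_def r_def)
    qed
  qed
  have all_split: "(\<forall>k<n. if k < k0 then P k else Q (k - k0) k) \<longleftrightarrow> (\<forall>k<k0. P k) \<and> (\<forall>j<n-k0. Q j (k0 + j))" for P Q
  proof safe
    fix k assume H: "\<forall>k<n. if k < k0 then P k else Q (k - k0) k" and "k < k0"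
    then show "P k" using k0 by (metis order_less_le_trans)
  next
    fix j assume H: "\<forall>k<n. if k < k0 then P k else Q (k - k0) k" and "j < n - k0"
    then show "Q j (k0 + j)" using H[rule_format, of "k0 + j"] by simp
  next
    fix k assume H: "\<forall>k<k0. P k" "\<forall>j<n-k0. Q j (k0 + j)" and "k < n"
    then show "if k < k0 then P k else Q (k - k0) k"
      using H(2)[rule_format, of "k - k0"] H(1) by (cases "k < k0") (auto simp: not_less)
  qed
  have "measure (W \<Otimes>\<^sub>M W) {z \<in> space (W \<Otimes>\<^sub>M W). \<forall>k<n. (case z of (f, g) \<Rightarrow> inc s n (glue ?t f g)) k \<in> B k} =
     measure (W \<Otimes>\<^sub>M W) (?E \<times> ?F)"
  proof (rule measure_eq_AE)
    show "AE z in W \<Otimes>\<^sub>M W. (z \<in> {z \<in> space (W \<Otimes>\<^sub>M W). \<forall>k<n. (case z of (f, g) \<Rightarrow> inc s n (glue ?t f g)) k \<in> B k}) = (z \<in> ?E \<times> ?F)"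
      using AE_snd_start0 AE_space
    proof eventually_elim
      case (elim z)
      obtain f g where z: "z = (f, g)" by (cases z)
      have fg: "f \<in> space W" "g \<in> space W" using elim z by (auto simp: space_pair_measure)
      have "(\<forall>k<n. inc s n (glue ?t f g) k \<in> B k) \<longleftrightarrow>
         (\<forall>k<n. if k < k0 then f (s (Suc k)) - f (s k) \<in> B k else g (r (Suc (k - k0))) - g (r (k - k0)) \<in> B k)"
      proof (intro all_cong1 imp_cong refl)
        fix k assume "k < n"
        then have "inc s n (glue ?t f g) k = (if k < k0 then f (s (Suc k)) - f (s k) else g (r (Suc (k - k0))) - g (r (k - k0)))"
          using incs[of g k f] elim z by simp
        then show "(inc s n (glue ?t f g) k \<in> B k) = (if k < k0 then f (s (Suc k)) - f (s k) \<in> B k else g (r (Suc (k - k0))) - g (r (k - k0)) \<in> B k)"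
          by simp
      qed
      also have "\<dots> \<longleftrightarrow> (\<forall>k<k0. f (s (Suc k)) - f (s k) \<in> B k) \<and> (\<forall>j<n - k0. g (r (Suc j)) - g (r j) \<in> B (k0 + j))"
        by (rule all_split)
      finally show ?case using fg z by (auto simp: space_pair_measure)
    qed
    show "?E \<times> ?F \<in> sets (W \<Otimes>\<^sub>M W)" by (rule pair_measureI[OF mE mF])
    let ?Y = "\<lambda>z. (case z of (f, g) \<Rightarrow> inc s n (glue ?t f g))"
    have "{z \<in> space (W \<Otimes>\<^sub>M W). ?Y z k \<in> B k} \<in> sets (W \<Otimes>\<^sub>M W)" if "k \<in> {..<n}" for k
    proof -
      have kn: "k < n" using that by simp
      have [measurable]: "B k \<in> sets borel" by (rule B[OF kn])
      have "(\<lambda>d. d k) \<in> borel_measurable (PiM {..<n} (\<lambda>_. borel :: real measure))"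
        by (rule measurable_component_singleton) (rule that)
      then have [measurable]: "(\<lambda>z. ?Y z k) \<in> borel_measurable (W \<Otimes>\<^sub>M W)"
        by (rule measurable_compose[OF meas])
      show ?thesis by measurable
    qed
    then have "{z \<in> space (W \<Otimes>\<^sub>M W). \<forall>k\<in>{..<n}. ?Y z k \<in> B k} \<in> sets (W \<Otimes>\<^sub>M W)"
      by (intro sets.sets_Collect_finite_All) auto
    then show "{z \<in> space (W \<Otimes>\<^sub>M W). \<forall>k<n. ?Y z k \<in> B k} \<in> sets (W \<Otimes>\<^sub>M W)"
      by (simp only: Ball_def lessThan_iff)
  qed
  also have "\<dots> = prob ?E * prob ?F"
    using emeasure_pair_measure_Times[OF mE mF]
    by (simp add: emeasure_eq_measure WW.emeasure_eq_measure ennreal_mult[symmetric])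
  also have "prob ?E = (\<Prod>k<k0. prob {f \<in> space W. f (s (Suc k) - s k) \<in> B k})"
    using B k0 by (intro increments s) auto
  also have "prob ?F = (\<Prod>j<n-k0. prob {f \<in> space W. f (r (Suc j) - r j) \<in> B (k0 + j)})"
    using B k0 by (intro increments r) auto
  also have "\<dots> = (\<Prod>j<n-k0. prob {f \<in> space W. f (s (Suc (k0 + j)) - s (k0 + j)) \<in> B (k0 + j)})"
    by (simp add: r_def)
  also have "(\<Prod>k<k0. prob {f \<in> space W. f (s (Suc k) - s k) \<in> B k}) * \<dots> = (\<Prod>k<n. prob {f \<in> space W. f (s (Suc k) - s k) \<in> B k})"
    using prod.atLeastLessThan_concat[of 0 k0 n "\<lambda>k. prob {f \<in> space W. f (s (Suc k) - s k) \<in> B k}"]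
      prod.shift_bounds_nat_ivl[of "\<lambda>k. prob {f \<in> space W. f (s (Suc k) - s k) \<in> B k}" 0 k0 "n - k0"] k0
    by (simp add: atLeast0LessThan add.commute)
  finally show "measure (W \<Otimes>\<^sub>M W) {z \<in> space (W \<Otimes>\<^sub>M W). \<forall>k<n. (case z of (f, g) \<Rightarrow> inc s n (glue ?t f g)) k \<in> B k} =
     (\<Prod>k<n. prob {f \<in> space W. f (s (Suc k) - s k) \<in> B k})" .
qed

lemma inc_partial_sum:
  assumes "k \<le> n" shows "(\<Sum>l<k. inc s n f l) = f (s k) - f (s 0)"
proof -
  have "(\<Sum>l<k. inc s n f l) = (\<Sum>l<k. f (s (Suc l)) - f (s l))"
    using assms by (intro sum.cong) (auto simp: inc_def)
  also have "\<dots> = f (s k) - f (s 0)" by (rule sum_lessThan_telescope)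
  finally show ?thesis .
qed

lemma AE_fst_start0: "AE z in W \<Otimes>\<^sub>M W. fst z 0 = 0"
proof -
  interpret WW: pair_prob_space W W by (rule pair_prob)
  have [measurable]: "(\<lambda>z. fst z 0) \<in> borel_measurable (W \<Otimes>\<^sub>M W)"
    by (rule measurable_compose[OF measurable_fst coord_measurable]) simp
  have "{z \<in> space (W \<Otimes>\<^sub>M W). fst z 0 = 0} \<in> sets (W \<Otimes>\<^sub>M W)"
    by measurable
  then show ?thesis
    using WW.AE_pair_iff[of "\<lambda>f g. f 0 = 0"] start0 by (auto elim!: eventually_mono)
qed

lemma finite_times_enumeration:
  assumes "finite J" "J \<subseteq> {0..}" "0 \<le> t"
  obtains s :: "nat \<Rightarrow> real" and n k0 where "mono s" "s 0 = 0" "k0 \<le> n" "s k0 = t" "J \<subseteq> s ` {..n}"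
proof -
  define J' where "J' = insert 0 (insert t J)"
  have J': "finite J'" "J' \<noteq> {}" using assms by (auto simp: J'_def)
  define xs where "xs = sorted_list_of_set J'"
  have xs: "sorted xs" "set xs = J'" "xs \<noteq> []"
    using J' by (auto simp: xs_def)
  define n where "n = length xs - 1"
  define s where "s k = xs ! min k n" for k
  have len: "length xs = Suc n" using xs by (simp add: n_def)
  have m: "mono s"
    unfolding mono_def s_def using xs len by (auto intro!: sorted_nth_mono)
  have img: "s ` {..n} = J'"
  proof -
    have "s ` {..n} = (\<lambda>k. xs ! k) ` {0..<length xs}"
      using len by (intro image_cong) (auto simp: s_def)
    also have "\<dots> = set xs" by (auto simp: set_conv_nth)
    finally show ?thesis using xs(2) by simp
  qed
  have "s 0 \<in> J'" using img by auto
  then have "0 \<le> s 0" using assms by (auto simp: J'_def)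
  moreover have "0 \<in> s ` {..n}" unfolding img by (simp add: J'_def)
  then obtain k where "s k = 0" by auto
  then have "s 0 \<le> 0" using m by (metis le0 monoD)
  ultimately have s0: "s 0 = 0" by simp
  have "t \<in> s ` {..n}" unfolding img by (simp add: J'_def)
  then obtain k0 where k0: "k0 \<le> n" "s k0 = t" by auto
  have "J \<subseteq> s ` {..n}" unfolding img by (auto simp: J'_def)
  then show ?thesis by (rule that[OF m s0 k0])
qed

text \<open>The Markov property at the fixed time \<open>t\<close>: two independent paths glued at time \<open>t\<close> form a path
of the same law.  Both laws have the same increments along every finite set of times containing
\<open>0\<close> and \<open>t\<close>, hence the same finite-dimensional distributions.\<close>

lemma glue_law:
  assumes t: "0 \<le> t"
  shows "distr (W \<Otimes>\<^sub>M W) path_space (\<lambda>(f, g). glue t f g) = W"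
proof (rule sym, rule measure_eqI_PiM_infinite[where I = "{0..}" and M = "\<lambda>_. borel"])
  interpret WW: pair_prob_space W W by (rule pair_prob)
  show "sets W = sets (PiM {0..} (\<lambda>_. borel))"
    using sets_W by (simp add: path_space_def)
  show "sets (distr (W \<Otimes>\<^sub>M W) path_space (\<lambda>(f, g). glue t f g)) = sets (PiM {0..} (\<lambda>_. borel))"
    by (simp add: path_space_def)
  show "finite_measure W" by unfold_locales
  have sp [measurable]: "(\<lambda>(f, g). glue t f g) \<in> W \<Otimes>\<^sub>M W \<rightarrow>\<^sub>M path_space"
    using measurable_glue[OF t] sets_W by (simp cong: measurable_cong_sets sets_pair_measure_cong)
  fix A and J :: "real set" assume J: "finite J" "J \<subseteq> {0..}" and A: "\<And>i. i \<in> J \<Longrightarrow> A i \<in> sets (borel :: real measure)"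
  obtain s :: "nat \<Rightarrow> real" and n k0 where s: "mono s" "s 0 = 0" "k0 \<le> n" "s k0 = t" "J \<subseteq> s ` {..n}"
    using finite_times_enumeration[OF J t] .
  have s0: "0 \<le> s 0" using s by simp
  let ?P = "PiM {..<n} (\<lambda>_. borel :: real measure)"
  define S where "S = {d \<in> space ?P. \<forall>k\<in>{..n}. s k \<in> J \<longrightarrow> (\<Sum>l<k. d l) \<in> A (s k)}"
  have S: "S \<in> sets ?P"
  proof -
    have "{d \<in> space ?P. s k \<in> J \<longrightarrow> (\<Sum>l<k. d l) \<in> A (s k)} \<in> sets ?P" if "k \<in> {..n}" for k
    proof (cases "s k \<in> J")
      case True
      then have [measurable]: "A (s k) \<in> sets borel" using A by auto
      have "(\<lambda>d. \<Sum>l<k. d l) \<in> borel_measurable ?P"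
        using that by (intro borel_measurable_sum measurable_component_singleton) auto
      then show ?thesis using True by measurable
    qed auto
    then show ?thesis unfolding S_def by (intro sets.sets_Collect_finite_All') auto
  qed
  have iff: "(\<forall>u\<in>J. f u \<in> A u) \<longleftrightarrow> inc s n f \<in> S" if "f 0 = 0" for f
  proof -
    have "inc s n f \<in> space ?P" by (auto simp: space_PiM inc_def)
    moreover have "(\<Sum>l<k. inc s n f l) = f (s k)" if "k \<le> n" for k
      using inc_partial_sum[OF that, of s f] s \<open>f 0 = 0\<close> by simp
    ultimately show ?thesis using s(5) by (force simp: S_def)
  qed
  let ?emb = "prod_emb {0..} (\<lambda>_. borel) J (Pi\<^sub>E J A)"
  have emb: "f \<in> ?emb \<longleftrightarrow> (\<forall>u\<in>J. f u \<in> A u)" if "f \<in> extensional {0..}" for f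
    using J that by (auto simp: prod_emb_def space_PiM PiE_iff restrict_def extensional_def)
  have embs: "?emb \<in> sets path_space"
    unfolding path_space_def using J A by (intro sets_PiM_I) auto
  have "emeasure W ?emb = emeasure W (inc s n -` S \<inter> space W)"
  proof (rule emeasure_eq_AE)
    show "AE f in W. (f \<in> ?emb) = (f \<in> inc s n -` S \<inter> space W)"
      using start0 AE_space by eventually_elim (use emb iff space_W in auto)
    show "?emb \<in> sets W" using embs sets_W by simp
    show "inc s n -` S \<inter> space W \<in> sets W"
      using inc_measurable[OF s(1) s0, of n] S sets_W by (intro measurable_sets) (simp_all cong: measurable_cong_sets)
  qed
  also have "\<dots> = emeasure (distr W ?P (inc s n)) S"
    using inc_measurable[OF s(1) s0, of n] S sets_W
    by (subst emeasure_distr) (simp_all cong: measurable_cong_sets)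
  also have "distr W ?P (inc s n) = distr (W \<Otimes>\<^sub>M W) ?P (\<lambda>(f, g). inc s n (glue t f g))"
    using distr_inc[OF s(1) s0] distr_inc_glue[OF s(1) s0 s(3)] s(4) by simp
  also have "\<dots> = distr (distr (W \<Otimes>\<^sub>M W) path_space (\<lambda>(f, g). glue t f g)) ?P (inc s n)"
    using inc_measurable[OF s(1) s0, of n]
    by (subst distr_distr) (auto simp: o_def case_prod_beta')
  also have "emeasure \<dots> S = emeasure (distr (W \<Otimes>\<^sub>M W) path_space (\<lambda>(f, g). glue t f g)) (inc s n -` S \<inter> space path_space)"
    using inc_measurable[OF s(1) s0, of n] S by (subst emeasure_distr) auto
  also have "\<dots> = emeasure (distr (W \<Otimes>\<^sub>M W) path_space (\<lambda>(f, g). glue t f g)) ?emb"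
  proof (rule emeasure_eq_AE)
    have [measurable]: "(\<lambda>f. f 0) \<in> borel_measurable (path_space :: (real \<Rightarrow> real) measure)" by simp
    have "AE f in distr (W \<Otimes>\<^sub>M W) path_space (\<lambda>(f, g). glue t f g). f 0 = 0"
      using AE_fst_start0 t by (subst AE_distr_iff) (auto simp: glue_def case_prod_beta elim!: eventually_mono)
    then show "AE f in distr (W \<Otimes>\<^sub>M W) path_space (\<lambda>(f, g). glue t f g). (f \<in> inc s n -` S \<inter> space path_space) = (f \<in> ?emb)"
      using AE_space by eventually_elim (use emb iff space_path_space in auto)
    show "?emb \<in> sets (distr (W \<Otimes>\<^sub>M W) path_space (\<lambda>(f, g). glue t f g))" using embs by simp
    show "inc s n -` S \<inter> space path_space \<in> sets (distr (W \<Otimes>\<^sub>M W) path_space (\<lambda>(f, g). glue t f g))"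
      using inc_measurable[OF s(1) s0, of n] S by (simp add: measurable_sets)
  qed
  finally show "emeasure W ?emb = emeasure (distr (W \<Otimes>\<^sub>M W) path_space (\<lambda>(f, g). glue t f g)) ?emb" .
qed

text \<open>The system of \<open>n\<close> independent free paths started at 0, and the gluing of two such systems.\<close>

definition sys :: "nat \<Rightarrow> (nat \<Rightarrow> real \<Rightarrow> real) measure" where
  "sys n = PiM {..<n} (\<lambda>_. W)"

definition glues :: "nat \<Rightarrow> real \<Rightarrow> (nat \<Rightarrow> real \<Rightarrow> real) \<Rightarrow> (nat \<Rightarrow> real \<Rightarrow> real) \<Rightarrow> nat \<Rightarrow> real \<Rightarrow> real" where
  "glues n t F G = (\<lambda>i\<in>{..<n}. glue t (F i) (G i))"

lemma prob_space_sys: "prob_space (sys n)"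
  unfolding sys_def by (intro prob_space_PiM prob_space_axioms)

lemma measurable_sys_coord [measurable]:
  assumes i: "i < n" and u: "0 \<le> u"
  shows "(\<lambda>F. F i u) \<in> borel_measurable (sys n)"
proof -
  have "(\<lambda>F. F i) \<in> sys n \<rightarrow>\<^sub>M W"
    unfolding sys_def by (rule measurable_component_singleton) (simp add: i)
  from measurable_compose[OF this coord_measurable[OF u]] show ?thesis .
qed

lemma glue_measurable_W: "0 \<le> t \<Longrightarrow> (\<lambda>z. glue t (fst z) (snd z)) \<in> W \<Otimes>\<^sub>M W \<rightarrow>\<^sub>M W"
  using measurable_glue[of t] sets_W by (simp add: case_prod_beta cong: measurable_cong_sets sets_pair_measure_cong)

lemma measurable_glues:
  assumes t: "0 \<le> t"
  shows "(\<lambda>(F, G). glues n t F G) \<in> sys n \<Otimes>\<^sub>M sys n \<rightarrow>\<^sub>M sys n"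
proof -
  have "(\<lambda>z. glue t (fst z i) (snd z i)) \<in> PiM {..<n} (\<lambda>_. W) \<Otimes>\<^sub>M PiM {..<n} (\<lambda>_. W) \<rightarrow>\<^sub>M W" if "i \<in> {..<n}" for i
  proof -
    have "(\<lambda>z. (fst z i, snd z i)) \<in> PiM {..<n} (\<lambda>_. W) \<Otimes>\<^sub>M PiM {..<n} (\<lambda>_. W) \<rightarrow>\<^sub>M W \<Otimes>\<^sub>M W"
      by (intro measurable_Pair measurable_compose[OF measurable_fst] measurable_compose[OF measurable_snd] measurable_component_singleton that)
    from measurable_compose[OF this glue_measurable_W[OF t]] show ?thesis by simp
  qed
  then show ?thesis unfolding glues_def sys_def case_prod_beta
    by (intro measurable_restrict) auto
qed

lemma glues_law:
  assumes t: "0 \<le> t"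
  shows "distr (sys n \<Otimes>\<^sub>M sys n) (sys n) (\<lambda>(F, G). glues n t F G) = sys n"
proof -
  interpret P: product_prob_space "\<lambda>_::nat. W"
    by (rule product_prob_spaceI) (rule prob_space_axioms)
  interpret S: prob_space "sys n" by (rule prob_space_sys)
  have "distr (sys n \<Otimes>\<^sub>M sys n) (sys n) (\<lambda>(F, G). glues n t F G) = PiM {..<n} (\<lambda>_. W)"
  proof (rule P.PiM_eqI)
    fix A :: "nat \<Rightarrow> (real \<Rightarrow> real) set" assume A: "\<And>i. i \<in> {..<n} \<Longrightarrow> A i \<in> sets W"
    have Am [measurable]: "indicator (A i) \<in> borel_measurable W" if "i < n" for i
      using A that by simp
    let ?D = "distr (sys n \<Otimes>\<^sub>M sys n) (sys n) (\<lambda>(F, G). glues n t F G)"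
    let ?I = "\<lambda>i f g. indicator (A i) (glue t f g) :: ennreal"
    have Im: "(\<lambda>z. ?I i (fst z) (snd z)) \<in> borel_measurable (W \<Otimes>\<^sub>M W)" if "i < n" for i
      by (rule measurable_compose[OF glue_measurable_W[OF t] Am[OF that]])
    have Im2: "(\<lambda>g. ?I i f g) \<in> borel_measurable W" if "i < n" "f \<in> space W" for i f
      using measurable_compose[OF measurable_Pair1' Im] that by simp
    have Im3: "(\<lambda>f. \<integral>\<^sup>+ g. ?I i f g \<partial>W) \<in> borel_measurable W" if "i < n" for i
      using borel_measurable_nn_integral_fst[OF Im[OF that]] by simp
    have set: "Pi\<^sub>E {..<n} A \<in> sets (sys n)"
      unfolding sys_def using A by (intro sets_PiM_I_finite) auto
    have ind: "indicator (Pi\<^sub>E {..<n} A) (glues n t F G) = (\<Prod>i<n. ?I i (F i) (G i))" for F G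
      by (auto simp: glues_def indicator_def PiE_iff prod_zero_iff split: if_splits intro!: prod.neutral)
    have "emeasure ?D (Pi\<^sub>E {..<n} A) = (\<integral>\<^sup>+ z. indicator (Pi\<^sub>E {..<n} A) z \<partial>?D)"
      using set by simp
    also have "\<dots> = (\<integral>\<^sup>+ z. (\<Prod>i<n. ?I i (fst z i) (snd z i)) \<partial>(sys n \<Otimes>\<^sub>M sys n))"
      using set measurable_glues[OF t, of n] by (subst nn_integral_distr) (auto simp: case_prod_beta ind)
    also have "\<dots> = (\<integral>\<^sup>+ F. \<integral>\<^sup>+ G. (\<Prod>i<n. ?I i (F i) (G i)) \<partial>sys n \<partial>sys n)"
    proof -
      have "(\<lambda>z. indicator (Pi\<^sub>E {..<n} A) (case z of (F, G) \<Rightarrow> glues n t F G) :: ennreal) \<in> borel_measurable (sys n \<Otimes>\<^sub>M sys n)"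
        using set by (intro measurable_compose[OF measurable_glues[OF t]]) auto
      then have "(\<lambda>z. \<Prod>i<n. ?I i (fst z i) (snd z i)) \<in> borel_measurable (sys n \<Otimes>\<^sub>M sys n)"
        by (simp add: case_prod_beta ind)
      from S.nn_integral_fst[OF this] show ?thesis by simp
    qed
    also have "\<dots> = (\<integral>\<^sup>+ F. (\<Prod>i<n. \<integral>\<^sup>+ g. ?I i (F i) g \<partial>W) \<partial>sys n)"
      unfolding sys_def
      by (intro nn_integral_cong P.product_nn_integral_prod Im2) (auto simp: space_PiM)
    also have "\<dots> = (\<Prod>i<n. \<integral>\<^sup>+ f. \<integral>\<^sup>+ g. ?I i f g \<partial>W \<partial>W)"
      unfolding sys_def by (intro P.product_nn_integral_prod Im3) auto
    also have "\<dots> = (\<Prod>i<n. emeasure W (A i))"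
    proof (intro prod.cong refl)
      fix i assume i: "i \<in> {..<n}"
      have "(\<integral>\<^sup>+ f. \<integral>\<^sup>+ g. ?I i f g \<partial>W \<partial>W) = (\<integral>\<^sup>+ z. ?I i (fst z) (snd z) \<partial>(W \<Otimes>\<^sub>M W))"
        using i by (subst nn_integral_fst[symmetric, OF Im]) auto
      also have "\<dots> = (\<integral>\<^sup>+ f. indicator (A i) f \<partial>distr (W \<Otimes>\<^sub>M W) path_space (\<lambda>(f, g). glue t f g))"
        using glue_measurable_W[OF t] A[OF i] sets_W
        by (subst nn_integral_distr) (auto simp: case_prod_beta cong: measurable_cong_sets)
      also have "\<dots> = emeasure W (A i)" using A[OF i] by (simp add: glue_law[OF t])
      finally show "(\<integral>\<^sup>+ f. \<integral>\<^sup>+ g. ?I i f g \<partial>W \<partial>W) = emeasure W (A i)" .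
    qed
    finally show "emeasure ?D (Pi\<^sub>E {..<n} A) = (\<Prod>i<n. emeasure W (A i))" .
  qed (simp_all add: sys_def)
  then show ?thesis by (simp add: sys_def)
qed

end

section \<open>Gaussian smoothing of stable distributions\<close>

text \<open>The function \<open>exp (- y\<^sup>2 / 2)\<close> is the characteristic function of the standard normal distribution,
so Gaussian averages of a distribution are Gaussian averages of its characteristic function.\<close>

lemma gaussian_smoothing:
  fixes \<mu> :: "real measure"
  assumes "real_distribution \<mu>"
  shows "complex_of_real (\<integral>x. exp (- (\<sigma> * (x - b))\<^sup>2 / 2) \<partial>\<mu>) =
    (\<integral>v. iexp (- (b * \<sigma> * v)) * char \<mu> (\<sigma> * v) \<partial>std_normal_distribution)"
proof -
  interpret \<mu>: real_distribution \<mu> by fact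
  interpret G: real_distribution std_normal_distribution by (rule real_dist_normal_dist)
  interpret P: pair_prob_space \<mu> std_normal_distribution ..
  have int: "integrable (\<mu> \<Otimes>\<^sub>M std_normal_distribution) (\<lambda>(x, v). iexp (\<sigma> * (x - b) * v))"
    by (rule P.integrable_const_bound[where B = 1]) (auto simp: case_prod_beta)
  have "complex_of_real (\<integral>x. exp (- (\<sigma> * (x - b))\<^sup>2 / 2) \<partial>\<mu>) = (\<integral>x. char std_normal_distribution (\<sigma> * (x - b)) \<partial>\<mu>)"
    by (simp add: char_std_normal_distribution)
  also have "\<dots> = (\<integral>x. \<integral>v. iexp (\<sigma> * (x - b) * v) \<partial>std_normal_distribution \<partial>\<mu>)"
    by (simp add: char_def)
  also have "\<dots> = (\<integral>v. \<integral>x. iexp (\<sigma> * (x - b) * v) \<partial>\<mu> \<partial>std_normal_distribution)"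
    by (rule P.Fubini_integral[symmetric, OF int])
  also have "\<dots> = (\<integral>v. iexp (- (b * \<sigma> * v)) * char \<mu> (\<sigma> * v) \<partial>std_normal_distribution)"
  proof (intro Bochner_Integration.integral_cong refl)
    fix v
    have "(\<integral>x. iexp (\<sigma> * (x - b) * v) \<partial>\<mu>) = (\<integral>x. iexp (- (b * \<sigma> * v)) * iexp (\<sigma> * v * x) \<partial>\<mu>)"
      by (intro Bochner_Integration.integral_cong refl) (simp add: exp_add[symmetric] algebra_simps)
    then show "(\<integral>x. iexp (\<sigma> * (x - b) * v) \<partial>\<mu>) = iexp (- (b * \<sigma> * v)) * char \<mu> (\<sigma> * v)"
      by (simp add: char_def)
  qed
  finally show ?thesis .
qed

lemma integrable_power_exp_abs: "integrable lborel (\<lambda>w::real. \<bar>w\<bar> ^ p * exp (- \<bar>w\<bar>))"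
proof -
  define f where "f w = w ^ p * exp (- w) * indicator {0..} w" for w :: real
  have [measurable]: "f \<in> borel_measurable borel" unfolding f_def by measurable
  have f: "integrable lborel f"
  proof (rule integrableI_nonneg)
    have "(\<integral>\<^sup>+x. ennreal (f x) \<partial>lborel) = (\<integral>\<^sup>+x. ennreal (x^p * exp (-x)) * indicator {0 ..} x \<partial>lborel)"
      by (intro nn_integral_cong) (auto simp: f_def indicator_def)
    then show "(\<integral>\<^sup>+x. ennreal (f x) \<partial>lborel) < \<infinity>"
      by (simp add: nn_intergal_power_times_exp_Ici)
  qed (auto simp: f_def indicator_def)
  have "integrable lborel (\<lambda>w. f (0 + (-1) * w))"
    by (rule lborel_integrable_real_affine[OF f]) simp
  with f have "integrable lborel (\<lambda>w. f w + f (0 + (-1) * w))"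
    by (rule Bochner_Integration.integrable_add)
  then show ?thesis
    by (rule Bochner_Integration.integrable_bound) (auto simp: f_def indicator_def)
qed

text \<open>The integrals of \<open>\<bar>w\<bar> ^ p * exp (- \<bar>w\<bar> powr \<alpha>)\<close>; only \<open>p = 0\<close> and \<open>p = 2\<close> are used.\<close>

definition stable_moment :: "real \<Rightarrow> nat \<Rightarrow> real" where
  "stable_moment \<alpha> p = (\<integral>w. \<bar>w\<bar> ^ p * exp (- (\<bar>w\<bar> powr \<alpha>)) \<partial>lborel)"

lemma integrable_stable_moment:
  assumes "1 \<le> \<alpha>"
  shows "integrable lborel (\<lambda>w::real. \<bar>w\<bar> ^ p * exp (- (\<bar>w\<bar> powr \<alpha>)))"
proof (rule Bochner_Integration.integrable_bound)
  show "integrable lborel (\<lambda>w::real. exp 1 * (\<bar>w\<bar> ^ p * exp (- \<bar>w\<bar>)))"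
    using integrable_power_exp_abs by (rule integrable_mult_right)
  show "AE w in lborel. norm (\<bar>w\<bar> ^ p * exp (- (\<bar>w\<bar> powr \<alpha>))) \<le> norm (exp 1 * (\<bar>w\<bar> ^ p * exp (- \<bar>w\<bar>)))"
  proof (rule AE_I2)
    fix w :: real
    have "\<bar>w\<bar> \<le> 1 + \<bar>w\<bar> powr \<alpha>"
    proof (cases "\<bar>w\<bar> \<le> 1")
      case False
      then have "\<bar>w\<bar> powr 1 \<le> \<bar>w\<bar> powr \<alpha>" using assms by (intro powr_mono) auto
      then show ?thesis using False by simp
    qed (auto intro: add_increasing2)
    then have "exp (- (\<bar>w\<bar> powr \<alpha>)) \<le> exp (1 + - \<bar>w\<bar>)" by simp
    then have "\<bar>w\<bar> ^ p * exp (- (\<bar>w\<bar> powr \<alpha>)) \<le> \<bar>w\<bar> ^ p * (exp 1 * exp (- \<bar>w\<bar>))"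
      unfolding exp_add by (intro mult_left_mono) auto
    then show "norm (\<bar>w\<bar> ^ p * exp (- (\<bar>w\<bar> powr \<alpha>))) \<le> norm (exp 1 * (\<bar>w\<bar> ^ p * exp (- \<bar>w\<bar>)))"
      by (simp add: abs_mult mult_ac)
  qed
qed auto

lemma stable_moment_scaled:
  assumes "1 \<le> \<alpha>" and k: "0 < k"
  shows "integrable lborel (\<lambda>w::real. \<bar>w\<bar> ^ p * exp (- (k * \<bar>w\<bar> powr \<alpha>)))"
    and "(\<integral>w. \<bar>w\<bar> ^ p * exp (- (k * \<bar>w\<bar> powr \<alpha>)) \<partial>lborel) = k powr (- (real p + 1) / \<alpha>) * stable_moment \<alpha> p"
proof -
  define r where "r = k powr (1 / \<alpha>)"
  have r: "r > 0" "r powr \<alpha> = k" using assms by (auto simp: r_def powr_powr)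
  have eq: "\<bar>0 + r * w\<bar> ^ p * exp (- (\<bar>0 + r * w\<bar> powr \<alpha>)) = r ^ p * (\<bar>w\<bar> ^ p * exp (- (k * \<bar>w\<bar> powr \<alpha>)))" for w
    using r by (simp add: abs_mult power_mult_distrib powr_mult)
  have "integrable lborel (\<lambda>w. \<bar>0 + r * w\<bar> ^ p * exp (- (\<bar>0 + r * w\<bar> powr \<alpha>)))"
    by (rule lborel_integrable_real_affine[OF integrable_stable_moment]) (use assms r in auto)
  then have "integrable lborel (\<lambda>w. r ^ p * (\<bar>w\<bar> ^ p * exp (- (k * \<bar>w\<bar> powr \<alpha>))))"
    by (simp only: eq)
  then show "integrable lborel (\<lambda>w::real. \<bar>w\<bar> ^ p * exp (- (k * \<bar>w\<bar> powr \<alpha>)))"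
    using r by simp
  have "stable_moment \<alpha> p = \<bar>r\<bar> *\<^sub>R (\<integral>w. \<bar>0 + r * w\<bar> ^ p * exp (- (\<bar>0 + r * w\<bar> powr \<alpha>)) \<partial>lborel)"
    unfolding stable_moment_def using r by (intro lborel_integral_real_affine) auto
  also have "\<dots> = r * r ^ p * (\<integral>w. \<bar>w\<bar> ^ p * exp (- (k * \<bar>w\<bar> powr \<alpha>)) \<partial>lborel)"
    using r by (simp only: eq) simp
  also have "r * r ^ p = k powr ((real p + 1) / \<alpha>)"
    using k by (simp add: r_def powr_powr add_divide_distrib powr_add flip: powr_realpow)
  finally have "stable_moment \<alpha> p = k powr ((real p + 1) / \<alpha>) * (\<integral>w. \<bar>w\<bar> ^ p * exp (- (k * \<bar>w\<bar> powr \<alpha>)) \<partial>lborel)" .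
  moreover have "k powr (- (real p + 1) / \<alpha>) * k powr ((real p + 1) / \<alpha>) = 1"
    using k by (simp add: powr_add[symmetric] add_divide_distrib[symmetric])
  ultimately show "(\<integral>w. \<bar>w\<bar> ^ p * exp (- (k * \<bar>w\<bar> powr \<alpha>)) \<partial>lborel) = k powr (- (real p + 1) / \<alpha>) * stable_moment \<alpha> p"
    by simp
qed

lemma stable_moment_pos: assumes "1 \<le> \<alpha>" shows "0 < stable_moment \<alpha> 0"
proof -
  have "stable_moment \<alpha> 0 \<ge> 0" unfolding stable_moment_def by (intro integral_nonneg_AE) auto
  moreover have "stable_moment \<alpha> 0 \<noteq> 0"
  proof
    assume "stable_moment \<alpha> 0 = 0"
    then have "AE w in lborel. exp (- (\<bar>w::real\<bar> powr \<alpha>)) = 0"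
      unfolding stable_moment_def
      using integrable_stable_moment[OF assms, of 0] by (subst (asm) integral_nonneg_eq_0_iff_AE) auto
    then have "AE w::real in lborel. False" by simp
    then show False by (simp add: AE_iff_null null_sets_def)
  qed
  ultimately show ?thesis by simp
qed

lemma stable_moment_nonneg: "0 \<le> stable_moment \<alpha> p"
  unfolding stable_moment_def by (intro integral_nonneg_AE) auto

text \<open>A symmetric stable distribution with scale parameter \<open>k\<close>.\<close>

locale symmetric_stable_distribution = real_distribution \<mu> for \<mu> :: "real measure" +
  fixes \<alpha> k :: real
  assumes alpha: "1 \<le> \<alpha>" and k: "0 < k"
    and char_sym: "\<And>v. char \<mu> v = exp (- of_real (k * \<bar>v\<bar> powr \<alpha>))"
begin

lemma smoothed_eq:
  assumes "0 < \<sigma>"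
  shows "(\<integral>x. exp (- (\<sigma> * (x - b))\<^sup>2 / 2) \<partial>\<mu>) =
    (1 / (sqrt (2 * pi) * \<sigma>)) * (\<integral>w. cos (b * w) * exp (- (w / \<sigma>)\<^sup>2 / 2) * exp (- (k * \<bar>w\<bar> powr \<alpha>)) \<partial>lborel)"
    and "integrable lborel (\<lambda>w. cos (b * w) * exp (- (w / \<sigma>)\<^sup>2 / 2) * exp (- (k * \<bar>w\<bar> powr \<alpha>)))"
proof -
  interpret G: real_distribution std_normal_distribution by (rule real_dist_normal_dist)
  let ?g = "\<lambda>w. cos (b * w) * exp (- (w / \<sigma>)\<^sup>2 / 2) * exp (- (k * \<bar>w\<bar> powr \<alpha>))"
  have I0: "integrable lborel (\<lambda>w. exp (- (k * \<bar>w\<bar> powr \<alpha>)))"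
    using stable_moment_scaled(1)[OF alpha k, of 0] by simp
  show int: "integrable lborel ?g"
  proof (rule Bochner_Integration.integrable_bound[OF I0])
    show "AE w in lborel. norm (?g w) \<le> norm (exp (- (k * \<bar>w\<bar> powr \<alpha>)))"
    proof (rule AE_I2)
      fix w
      have "\<bar>cos (b * w) * exp (- (w / \<sigma>)\<^sup>2 / 2)\<bar> \<le> 1 * 1"
        unfolding abs_mult by (intro mult_mono) (auto simp: abs_cos_le_one)
      then have "\<bar>cos (b * w) * exp (- (w / \<sigma>)\<^sup>2 / 2)\<bar> * exp (- (k * \<bar>w\<bar> powr \<alpha>)) \<le> 1 * exp (- (k * \<bar>w\<bar> powr \<alpha>))"
        by (intro mult_right_mono) auto
      then show "norm (?g w) \<le> norm (exp (- (k * \<bar>w\<bar> powr \<alpha>)))" by (simp add: abs_mult)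
    qed
  qed auto
  have "(\<integral>x. exp (- (\<sigma> * (x - b))\<^sup>2 / 2) \<partial>\<mu>) = Re (\<integral>v. iexp (- (b * \<sigma> * v)) * char \<mu> (\<sigma> * v) \<partial>std_normal_distribution)"
    using gaussian_smoothing[OF real_distribution_axioms, of \<sigma> b] by (metis Re_complex_of_real)
  also have "\<dots> = (\<integral>v. Re (iexp (- (b * \<sigma> * v)) * char \<mu> (\<sigma> * v)) \<partial>std_normal_distribution)"
  proof (rule integral_Re[symmetric])
    have "norm (iexp (- (b * \<sigma> * v)) * char \<mu> (\<sigma> * v)) \<le> 1" for v
      using cmod_char_le_1[of "\<sigma> * v"] by (simp add: norm_mult)
    then show "integrable std_normal_distribution (\<lambda>v. iexp (- (b * \<sigma> * v)) * char \<mu> (\<sigma> * v))"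
      by (intro G.integrable_const_bound[where B = 1]) auto
  qed
  also have "\<dots> = (\<integral>v. cos (b * \<sigma> * v) * exp (- (k * \<bar>\<sigma> * v\<bar> powr \<alpha>)) \<partial>std_normal_distribution)"
    by (intro Bochner_Integration.integral_cong refl) (simp add: char_sym Re_exp Im_exp exp_of_real[symmetric] del: exp_of_real of_real_minus of_real_mult flip: of_real_minus)
  also have "\<dots> = (\<integral>v. std_normal_density v * (cos (b * \<sigma> * v) * exp (- (k * \<bar>\<sigma> * v\<bar> powr \<alpha>))) \<partial>lborel)"
    by (subst integral_density) auto
  also have "\<dots> = (\<integral>v. (1 / sqrt (2 * pi)) * ?g (0 + \<sigma> * v) \<partial>lborel)"
    using assms by (intro Bochner_Integration.integral_cong refl) (simp add: std_normal_density_def mult_ac)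
  also have "\<dots> = (1 / sqrt (2 * pi)) * (\<integral>v. ?g (0 + \<sigma> * v) \<partial>lborel)"
    by (rule integral_mult_right_zero)
  also have "(\<integral>v. ?g (0 + \<sigma> * v) \<partial>lborel) = (1 / \<sigma>) * (\<integral>v. ?g v \<partial>lborel)"
    using lborel_integral_real_affine[of \<sigma> ?g 0] assms by (simp add: field_simps)
  finally show "(\<integral>x. exp (- (\<sigma> * (x - b))\<^sup>2 / 2) \<partial>\<mu>) = (1 / (sqrt (2 * pi) * \<sigma>)) * (\<integral>w. ?g w \<partial>lborel)"
    by (simp add: mult_ac)
qed

lemma smoothed_upper:
  assumes s: "0 < \<sigma>"
  shows "(\<integral>x. exp (- (\<sigma> * (x - b))\<^sup>2 / 2) \<partial>\<mu>) \<le> (stable_moment \<alpha> 0 / sqrt (2 * pi)) / \<sigma> * k powr (- 1 / \<alpha>)"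
proof -
  have I0: "integrable lborel (\<lambda>w. exp (- (k * \<bar>w\<bar> powr \<alpha>)))"
    using stable_moment_scaled(1)[OF alpha k, of 0] by simp
  have "(\<integral>w. cos (b * w) * exp (- (w / \<sigma>)\<^sup>2 / 2) * exp (- (k * \<bar>w\<bar> powr \<alpha>)) \<partial>lborel) \<le> (\<integral>w. exp (- (k * \<bar>w\<bar> powr \<alpha>)) \<partial>lborel)"
  proof (rule integral_mono[OF smoothed_eq(2)[OF s] I0])
    fix w :: real
    have "cos (b * w) * exp (- (w / \<sigma>)\<^sup>2 / 2) \<le> 1 * exp (- (w / \<sigma>)\<^sup>2 / 2)"
      by (intro mult_right_mono) auto
    also have "\<dots> \<le> 1" by simp
    finally have "cos (b * w) * exp (- (w / \<sigma>)\<^sup>2 / 2) * exp (- (k * \<bar>w\<bar> powr \<alpha>)) \<le> 1 * exp (- (k * \<bar>w\<bar> powr \<alpha>))"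
      by (intro mult_right_mono) auto
    then show "cos (b * w) * exp (- (w / \<sigma>)\<^sup>2 / 2) * exp (- (k * \<bar>w\<bar> powr \<alpha>)) \<le> exp (- (k * \<bar>w\<bar> powr \<alpha>))" by simp
  qed
  also have "\<dots> = k powr (- 1 / \<alpha>) * stable_moment \<alpha> 0"
    using stable_moment_scaled(2)[OF alpha k, of 0] by simp
  finally have "(1 / (sqrt (2 * pi) * \<sigma>)) * (\<integral>w. cos (b * w) * exp (- (w / \<sigma>)\<^sup>2 / 2) * exp (- (k * \<bar>w\<bar> powr \<alpha>)) \<partial>lborel) \<le> (1 / (sqrt (2 * pi) * \<sigma>)) * (k powr (- 1 / \<alpha>) * stable_moment \<alpha> 0)"
    using s by (intro mult_left_mono) auto
  then show ?thesis unfolding smoothed_eq(1)[OF s] by (simp add: mult_ac)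
qed

text \<open>The condition says that \<open>b\<close> and the width \<open>1 / \<sigma>\<close> are small in comparison with the length scale
\<open>k powr (1 / \<alpha>)\<close> of the distribution.\<close>

lemma smoothed_lower:
  assumes s: "0 < \<sigma>"
    and small: "(b\<^sup>2 + 1 / \<sigma>\<^sup>2) * stable_moment \<alpha> 2 \<le> stable_moment \<alpha> 0 * k powr (2 / \<alpha>)"
  shows "(stable_moment \<alpha> 0 / (2 * sqrt (2 * pi))) / \<sigma> * k powr (- 1 / \<alpha>) \<le> (\<integral>x. exp (- (\<sigma> * (x - b))\<^sup>2 / 2) \<partial>\<mu>)"
proof -
  let ?e = "\<lambda>w. exp (- (k * \<bar>w\<bar> powr \<alpha>))"
  let ?B = "(b\<^sup>2 + 1 / \<sigma>\<^sup>2) / 2"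
  have I0: "integrable lborel ?e"
    using stable_moment_scaled(1)[OF alpha k, of 0] by simp
  have I2: "integrable lborel (\<lambda>w. ?B * (\<bar>w\<bar> ^ 2 * ?e w))"
    using stable_moment_scaled(1)[OF alpha k, of 2] by (rule integrable_mult_right)
  have "k powr (- 3 / \<alpha>) * k powr (2 / \<alpha>) = k powr (- 1 / \<alpha>)"
    using k by (simp add: powr_add[symmetric] add_divide_distrib[symmetric])
  then have *: "k powr (- 3 / \<alpha>) * (stable_moment \<alpha> 0 * k powr (2 / \<alpha>)) = k powr (- 1 / \<alpha>) * stable_moment \<alpha> 0"
    by (metis mult.commute mult.left_commute)
  have "k powr (- 3 / \<alpha>) * ((b\<^sup>2 + 1 / \<sigma>\<^sup>2) * stable_moment \<alpha> 2) \<le> k powr (- 3 / \<alpha>) * (stable_moment \<alpha> 0 * k powr (2 / \<alpha>))"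
    using small by (intro mult_left_mono) auto
  then have "k powr (- 1 / \<alpha>) * stable_moment \<alpha> 0 / 2 \<le> k powr (- 1 / \<alpha>) * stable_moment \<alpha> 0 - ?B * (k powr (- 3 / \<alpha>) * stable_moment \<alpha> 2)"
    unfolding * by (simp add: field_simps)
  also have "\<dots> = (\<integral>w. ?e w - ?B * (\<bar>w\<bar> ^ 2 * ?e w) \<partial>lborel)"
    using stable_moment_scaled(2)[OF alpha k, of 0] stable_moment_scaled(2)[OF alpha k, of 2]
    by (subst Bochner_Integration.integral_diff[OF I0 I2]) (simp del: power2_abs)
  also have "\<dots> \<le> (\<integral>w. cos (b * w) * exp (- (w / \<sigma>)\<^sup>2 / 2) * ?e w \<partial>lborel)"
  proof (rule integral_mono[OF Bochner_Integration.integrable_diff[OF I0 I2] smoothed_eq(2)[OF s]])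
    fix w :: real
    let ?y = "exp (- (w / \<sigma>)\<^sup>2 / 2)"
    have y: "1 + - (w / \<sigma>)\<^sup>2 / 2 \<le> ?y" by (rule exp_ge_add_one_self)
    have y1: "?y \<le> 1" by simp
    have c: "1 - (b * w)\<^sup>2 / 2 \<le> cos (b * w)"
    proof -
      have "\<bar>sin (b * w / 2)\<bar> \<le> \<bar>b * w / 2\<bar>" by (rule abs_sin_x_le_abs_x)
      then have "(sin (b * w / 2))\<^sup>2 \<le> (b * w / 2)\<^sup>2" by (rule abs_le_square_iff[THEN iffD1])
      moreover have "cos (b * w) = 1 - 2 * (sin (b * w / 2))\<^sup>2"
        using cos_double_sin[of "b * w / 2"] by simp
      ultimately show ?thesis by (simp add: power_divide)
    qed
    have "(1 - ?y) * cos (b * w) \<le> (1 - ?y) * 1" using y1 by (intro mult_left_mono) auto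
    then have "cos (b * w) - (1 - ?y) \<le> cos (b * w) * ?y" by (simp add: algebra_simps)
    then have "1 - ?B * \<bar>w\<bar>\<^sup>2 \<le> cos (b * w) * ?y"
      using y c by (simp add: power_mult_distrib power_divide algebra_simps add_divide_distrib)
    then have "(1 - ?B * \<bar>w\<bar>\<^sup>2) * ?e w \<le> cos (b * w) * ?y * ?e w" by (intro mult_right_mono) auto
    then show "?e w - ?B * (\<bar>w\<bar> ^ 2 * ?e w) \<le> cos (b * w) * ?y * ?e w" by (simp add: algebra_simps)
  qed
  finally have "(1 / (sqrt (2 * pi) * \<sigma>)) * (k powr (- 1 / \<alpha>) * stable_moment \<alpha> 0 / 2) \<le> (1 / (sqrt (2 * pi) * \<sigma>)) * (\<integral>w. cos (b * w) * exp (- (w / \<sigma>)\<^sup>2 / 2) * ?e w \<partial>lborel)"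
    using s by (intro mult_left_mono) auto
  then show ?thesis unfolding smoothed_eq(1)[OF s] by (simp add: mult_ac)
qed

lemma prob_near_le:
  assumes e: "0 < e"
  shows "prob {x. \<bar>x - b\<bar> < e} \<le> exp (1 / 2) * (stable_moment \<alpha> 0 / sqrt (2 * pi)) * k powr (- 1 / \<alpha>) * e"
proof -
  let ?g = "\<lambda>x. exp (- (1 / e * (x - b))\<^sup>2 / 2)"
  have int: "integrable \<mu> (\<lambda>x. exp (1 / 2) * ?g x)"
    by (intro integrable_mult_right integrable_const_bound[where B = 1]) auto
  have "prob {x. \<bar>x - b\<bar> < e} = (\<integral>x. indicator {x. \<bar>x - b\<bar> < e} x \<partial>\<mu>)" by simp
  also have "\<dots> \<le> (\<integral>x. exp (1 / 2) * ?g x \<partial>\<mu>)"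
  proof (rule integral_mono[OF _ int])
    show "integrable \<mu> (indicator {x. \<bar>x - b\<bar> < e} :: real \<Rightarrow> real)"
      by (intro integrable_const_bound[where B = 1]) (auto simp: indicator_def)
    fix x
    show "indicator {x. \<bar>x - b\<bar> < e} x \<le> exp (1 / 2) * ?g x"
    proof (cases "\<bar>x - b\<bar> < e")
      case True
      then have "\<bar>1 / e * (x - b)\<bar> \<le> 1" using e by (simp add: abs_mult field_simps)
      then have "(1 / e * (x - b))\<^sup>2 \<le> 1" by (metis abs_square_le_1)
      then have "1 / 2 + - (1 / e * (x - b))\<^sup>2 / 2 \<ge> 0" by simp
      then have "1 \<le> exp (1 / 2 + - (1 / e * (x - b))\<^sup>2 / 2)" by (simp only: one_le_exp_iff)
      then show ?thesis using True by (simp only: exp_add) simp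
    qed simp
  qed
  also have "\<dots> = exp (1 / 2) * (\<integral>x. ?g x \<partial>\<mu>)" by (rule integral_mult_right_zero)
  also have "\<dots> \<le> exp (1 / 2) * ((stable_moment \<alpha> 0 / sqrt (2 * pi)) / (1 / e) * k powr (- 1 / \<alpha>))"
    using e by (intro mult_left_mono smoothed_upper) auto
  finally show ?thesis by (simp add: mult_ac)
qed

end

text \<open>The constant 6 is \<open>2 / (1 / 3)\<close>: the second moment gives \<open>E (1 + v\<^sup>2) = 2\<close> for a standard normal
\<open>v\<close>, and \<open>1 - exp (- 1 / 2) \<ge> 1 / 3\<close>.\<close>

lemma tail_bound:
  assumes "real_distribution \<mu>" and al: "0 < \<alpha>" "\<alpha> \<le> 2" and C: "0 \<le> C"
    and char: "\<And>v. 1 - Re (char \<mu> v) \<le> C * \<bar>v\<bar> powr \<alpha>" and d: "0 < d"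
  shows "measure \<mu> {x. d \<le> \<bar>x\<bar>} \<le> 6 * C * d powr (-\<alpha>)"
proof -
  interpret \<mu>: real_distribution \<mu> by fact
  interpret G: real_distribution std_normal_distribution by (rule real_dist_normal_dist)
  let ?g = "\<lambda>x. exp (- (1 / d * (x - 0))\<^sup>2 / 2)"
  have int: "integrable \<mu> ?g" by (intro \<mu>.integrable_const_bound[where B = 1]) auto
  have I: "integrable std_normal_distribution (\<lambda>v. char \<mu> (1 / d * v))"
    using \<mu>.cmod_char_le_1 by (intro G.integrable_const_bound[where B = 1]) auto
  have "1 - (\<integral>x. ?g x \<partial>\<mu>) = 1 - Re (\<integral>v. char \<mu> (1 / d * v) \<partial>std_normal_distribution)"
    using gaussian_smoothing[OF assms(1), of "1 / d" 0] by (simp add: complex_eq_iff)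
  also have "\<dots> = 1 - (\<integral>v. Re (char \<mu> (1 / d * v)) \<partial>std_normal_distribution)"
    using I by (subst integral_Re) auto
  also have "\<dots> = (\<integral>v. 1 - Re (char \<mu> (1 / d * v)) \<partial>std_normal_distribution)"
    using integrable_Re[OF I] G.prob_space by (subst Bochner_Integration.integral_diff) (auto simp: space_density)
  also have "\<dots> \<le> (\<integral>v. C * d powr (-\<alpha>) * (1 + v ^ 2) \<partial>std_normal_distribution)"
  proof (rule integral_mono)
    show "integrable std_normal_distribution (\<lambda>v. 1 - Re (char \<mu> (1 / d * v)))"
      using integrable_Re[OF I] by (intro Bochner_Integration.integrable_diff) auto
    show "integrable std_normal_distribution (\<lambda>v. C * d powr (-\<alpha>) * (1 + v ^ 2))"
      by (intro integrable_mult_right Bochner_Integration.integrable_add integrable_std_normal_distribution_moment) auto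
    fix v :: real
    have "\<bar>v\<bar> powr \<alpha> \<le> 1 + v ^ 2"
    proof (cases "\<bar>v\<bar> \<le> 1")
      case True
      then have "\<bar>v\<bar> powr \<alpha> \<le> 1 powr \<alpha>" using al by (intro powr_mono2) auto
      then show ?thesis by (simp add: add_increasing2)
    next
      case False
      then have "\<bar>v\<bar> powr \<alpha> \<le> \<bar>v\<bar> powr 2" using al by (intro powr_mono) auto
      then show ?thesis using False by (simp add: powr_numeral)
    qed
    then have "d powr (-\<alpha>) * \<bar>v\<bar> powr \<alpha> \<le> d powr (-\<alpha>) * (1 + v ^ 2)" by (intro mult_left_mono) auto
    moreover have "\<bar>1 / d * v\<bar> powr \<alpha> = d powr (-\<alpha>) * \<bar>v\<bar> powr \<alpha>"
      using d by (simp add: powr_divide powr_minus_divide)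
    ultimately have "C * \<bar>1 / d * v\<bar> powr \<alpha> \<le> C * (d powr (-\<alpha>) * (1 + v ^ 2))"
      using C by (simp only:) (rule mult_left_mono)
    then show "1 - Re (char \<mu> (1 / d * v)) \<le> C * d powr (-\<alpha>) * (1 + v ^ 2)"
      using char[of "1 / d * v"] by (simp add: mult_ac)
  qed
  also have "\<dots> = C * d powr (-\<alpha>) * 2"
  proof -
    have "(\<integral>v. 1 + v ^ 2 \<partial>std_normal_distribution) = 2"
      using std_normal_distribution_even_moments[of 1] G.prob_space by (subst Bochner_Integration.integral_add) (auto simp: space_density)
    then show ?thesis by (simp only: integral_mult_right_zero)
  qed
  finally have A: "1 - (\<integral>x. ?g x \<partial>\<mu>) \<le> C * d powr (-\<alpha>) * 2" .
  have e: "exp (- 1 / 2 :: real) \<le> 2 / 3"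
  proof -
    have "1 + 1 / 2 \<le> exp (1 / 2 :: real)" by (rule exp_ge_add_one_self)
    then have "1 / exp (1 / 2) \<le> 1 / (3 / 2 :: real)" by (intro divide_left_mono) auto
    moreover have "exp (- 1 / 2 :: real) = 1 / exp (1 / 2)" by (simp add: exp_minus inverse_eq_divide)
    ultimately show ?thesis by simp
  qed
  have "1 / 3 * measure \<mu> {x. d \<le> \<bar>x\<bar>} = (\<integral>x. 1 / 3 * indicator {x. d \<le> \<bar>x\<bar>} x \<partial>\<mu>)" by simp
  also have "\<dots> \<le> (\<integral>x. 1 - ?g x \<partial>\<mu>)"
  proof (rule integral_mono)
    show "integrable \<mu> (\<lambda>x. (1 / 3 :: real) * indicator {x. d \<le> \<bar>x\<bar>} x)"
      by (intro integrable_mult_right \<mu>.integrable_const_bound[where B = 1]) (auto simp: indicator_def)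
    show "integrable \<mu> (\<lambda>x. 1 - ?g x)" using int by (intro Bochner_Integration.integrable_diff) auto
    fix x
    show "1 / 3 * indicator {x. d \<le> \<bar>x\<bar>} x \<le> 1 - ?g x"
    proof (cases "d \<le> \<bar>x\<bar>")
      case True
      then have "1 \<le> \<bar>1 / d * x\<bar>" using d by (simp add: abs_mult field_simps)
      then have "1 \<le> (1 / d * x)\<^sup>2" by (metis abs_ge_zero one_le_power power2_abs)
      then have "?g x \<le> exp (- 1 / 2)" by simp
      then have "?g x \<le> 2 / 3" using e by (rule order_trans)
      then have "1 / 3 \<le> 1 - ?g x" by linarith
      then show ?thesis using True by (simp only: indicator_simps mem_Collect_eq mult_1_right if_True)
    qed simp
  qed
  also have "\<dots> = 1 - (\<integral>x. ?g x \<partial>\<mu>)"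
    using int \<mu>.prob_space by (subst Bochner_Integration.integral_diff) auto
  finally show ?thesis using A by simp
qed

section \<open>Systems of independent stable paths\<close>

context levy_law begin

lemma glues_nth:
  "i < n \<Longrightarrow> 0 \<le> u \<Longrightarrow> glues n t F G i u = (if u \<le> t then F i u else F i t + G i (u - t))"
  by (simp add: glues_def glue_def)

text \<open>The Markov property of the system in the form in which it is used: integrate first over the future
\<open>G\<close> with the past \<open>F\<close> fixed.\<close>

lemma sys_markov:
  fixes f :: "(nat \<Rightarrow> real \<Rightarrow> real) \<Rightarrow> real"
  assumes t: "0 \<le> t" and f: "integrable (sys n) f"
  shows "(\<integral>F. f F \<partial>sys n) = (\<integral>F. \<integral>G. f (glues n t F G) \<partial>sys n \<partial>sys n)"
    and "integrable (sys n) (\<lambda>F. \<integral>G. f (glues n t F G) \<partial>sys n)"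
proof -
  interpret S: prob_space "sys n" by (rule prob_space_sys)
  interpret P: pair_prob_space "sys n" "sys n" ..
  note m = measurable_glues[OF t, of n]
  have m': "(\<lambda>z. glues n t (fst z) (snd z)) \<in> sys n \<Otimes>\<^sub>M sys n \<rightarrow>\<^sub>M sys n"
    using m by (simp add: case_prod_beta')
  have law: "distr (sys n \<Otimes>\<^sub>M sys n) (sys n) (\<lambda>z. glues n t (fst z) (snd z)) = sys n"
    using glues_law[OF t, of n] by (simp add: case_prod_beta')
  have fb: "f \<in> borel_measurable (sys n)" using f by simp
  have "integrable (distr (sys n \<Otimes>\<^sub>M sys n) (sys n) (\<lambda>z. glues n t (fst z) (snd z))) f"
    unfolding law by (rule f)
  then have int: "integrable (sys n \<Otimes>\<^sub>M sys n) (\<lambda>z. f (glues n t (fst z) (snd z)))"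
    by (subst (asm) integrable_distr_eq[OF m' fb])
  have "(\<integral>F. f F \<partial>sys n) = (\<integral>F. f F \<partial>distr (sys n \<Otimes>\<^sub>M sys n) (sys n) (\<lambda>z. glues n t (fst z) (snd z)))"
    unfolding law ..
  also have "\<dots> = (\<integral>z. f (glues n t (fst z) (snd z)) \<partial>(sys n \<Otimes>\<^sub>M sys n))"
    by (rule integral_distr[OF m' fb])
  also have "\<dots> = (\<integral>F. \<integral>G. f (glues n t F G) \<partial>sys n \<partial>sys n)"
    using P.integral_fst'[OF int] by simp
  finally show "(\<integral>F. f F \<partial>sys n) = (\<integral>F. \<integral>G. f (glues n t F G) \<partial>sys n \<partial>sys n)" .
  show "integrable (sys n) (\<lambda>F. \<integral>G. f (glues n t F G) \<partial>sys n)"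
    using P.integrable_fst'[OF int] by simp
qed

lemma glues_measurable_snd:
  assumes t: "0 \<le> t" and F: "F \<in> space (sys n)"
  shows "glues n t F \<in> sys n \<rightarrow>\<^sub>M sys n"
  using measurable_compose[OF measurable_Pair1'[OF F] measurable_glues[OF t, of n]] by simp

lemma sys_markov_prob:
  assumes t: "0 \<le> t" and S: "S \<in> sets (sys n)"
  shows "measure (sys n) S = (\<integral>F. measure (sys n) {G \<in> space (sys n). glues n t F G \<in> S} \<partial>sys n)"
    and "integrable (sys n) (\<lambda>F. measure (sys n) {G \<in> space (sys n). glues n t F G \<in> S})"
proof -
  interpret S: prob_space "sys n" by (rule prob_space_sys)
  have int: "integrable (sys n) (indicator S :: _ \<Rightarrow> real)"
    using S by (intro S.integrable_const_bound[where B = 1]) (auto simp: indicator_def)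
  have eq: "(\<integral>G. indicator S (glues n t F G) \<partial>sys n) = measure (sys n) {G \<in> space (sys n). glues n t F G \<in> S}"
    if "F \<in> space (sys n)" for F
  proof -
    have "(\<integral>G. indicator S (glues n t F G) \<partial>sys n) = (\<integral>G. indicator {G \<in> space (sys n). glues n t F G \<in> S} G \<partial>sys n)"
      by (intro Bochner_Integration.integral_cong refl) (simp add: indicator_def)
    also have "\<dots> = measure (sys n) ({G \<in> space (sys n). glues n t F G \<in> S} \<inter> space (sys n))" by simp
    finally show ?thesis by (simp add: Int_absorb2)
  qed
  have "measure (sys n) S = (\<integral>F. indicator S F \<partial>sys n)"
    using S sets.sets_into_space by (auto simp: Int_absorb2)
  also have "\<dots> = (\<integral>F. measure (sys n) {G \<in> space (sys n). glues n t F G \<in> S} \<partial>sys n)"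
    unfolding sys_markov(1)[OF t int] by (intro Bochner_Integration.integral_cong refl eq)
  finally show "measure (sys n) S = (\<integral>F. measure (sys n) {G \<in> space (sys n). glues n t F G \<in> S} \<partial>sys n)" .
  show "integrable (sys n) (\<lambda>F. measure (sys n) {G \<in> space (sys n). glues n t F G \<in> S})"
    using sys_markov(2)[OF t int] by (subst (asm) Bochner_Integration.integrable_cong[OF refl eq]) auto
qed

lemma distr_sys_component: "i < n \<Longrightarrow> distr (sys n) W (\<lambda>F. F i) = W"
proof -
  interpret P: product_prob_space "\<lambda>_::nat. W" "{..<n}"
    by (rule product_prob_spaceI) (rule prob_space_axioms)
  show "i < n \<Longrightarrow> distr (sys n) W (\<lambda>F. F i) = W"
    unfolding sys_def by (rule P.PiM_component) auto
qed

lemma sys_component_prob: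
  assumes i: "i < n" and u: "0 \<le> u" and A: "A \<in> sets borel"
  shows "measure (sys n) {F \<in> space (sys n). F i u \<in> A} = measure (distr W borel (\<lambda>f. f u)) A"
proof -
  have m: "(\<lambda>F. F i) \<in> sys n \<rightarrow>\<^sub>M W"
    unfolding sys_def by (rule measurable_component_singleton) (simp add: i)
  have "distr W borel (\<lambda>f. f u) = distr (distr (sys n) W (\<lambda>F. F i)) borel (\<lambda>f. f u)"
    by (simp add: distr_sys_component[OF i])
  also have "\<dots> = distr (sys n) borel (\<lambda>F. F i u)"
    using m u by (subst distr_distr) (auto simp: o_def)
  finally show ?thesis
    using i u A by (simp add: measure_distr vimage_def Int_def conj_commute)
qed

lemma char_sys_diff:
  assumes ij: "i < n" "j < n" "i \<noteq> j" and u: "0 \<le> u"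
  shows "char (distr (sys n) borel (\<lambda>F. F i u - F j u)) v =
    char (distr W borel (\<lambda>f. f u)) v * char (distr W borel (\<lambda>f. f u)) (- v)"
proof -
  interpret P: product_prob_space "\<lambda>_::nat. W" "{..<n}"
    by (rule product_prob_spaceI) (rule prob_space_axioms)
  define g where "g l f = (if l = i then iexp (v * f u) else if l = j then iexp (- v * f u) else 1)" for l and f :: "real \<Rightarrow> real"
  have um: "(\<lambda>f. f u) \<in> borel_measurable W" by (rule coord_measurable[OF u])
  have gm: "g l \<in> borel_measurable W" for l
    unfolding g_def using um by (cases "l = i"; cases "l = j") auto
  have gi: "integrable W (g l)" for l
    using gm by (intro integrable_const_bound[where B = 1]) (auto simp: g_def)
  have "char (distr (sys n) borel (\<lambda>F. F i u - F j u)) v = (\<integral>F. iexp (v * (F i u - F j u)) \<partial>sys n)"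
    unfolding char_def using ij u by (subst integral_distr) auto
  also have "\<dots> = (\<integral>F. (\<Prod>l<n. g l (F l)) \<partial>sys n)"
  proof (intro Bochner_Integration.integral_cong refl)
    fix F :: "nat \<Rightarrow> real \<Rightarrow> real"
    have "(\<Prod>l<n. g l (F l)) = g i (F i) * (\<Prod>l\<in>{..<n} - {i}. g l (F l))"
      using ij by (intro prod.remove) auto
    also have "(\<Prod>l\<in>{..<n} - {i}. g l (F l)) = g j (F j) * (\<Prod>l\<in>{..<n} - {i} - {j}. g l (F l))"
      using ij by (intro prod.remove) auto
    also have "(\<Prod>l\<in>{..<n} - {i} - {j}. g l (F l)) = 1"
      by (intro prod.neutral) (auto simp: g_def)
    finally show "iexp (v * (F i u - F j u)) = (\<Prod>l<n. g l (F l))"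
      using ij by (simp add: g_def exp_add[symmetric] algebra_simps)
  qed
  also have "\<dots> = (\<Prod>l<n. \<integral>f. g l f \<partial>W)"
    unfolding sys_def by (intro P.product_integral_prod gi) auto
  also have "\<dots> = (\<integral>f. g i f \<partial>W) * (\<Prod>l\<in>{..<n} - {i}. \<integral>f. g l f \<partial>W)"
    using ij by (intro prod.remove) auto
  also have "(\<Prod>l\<in>{..<n} - {i}. \<integral>f. g l f \<partial>W) = (\<integral>f. g j f \<partial>W) * (\<Prod>l\<in>{..<n} - {i} - {j}. \<integral>f. g l f \<partial>W)"
    using ij by (intro prod.remove) auto
  also have "(\<Prod>l\<in>{..<n} - {i} - {j}. \<integral>f. g l f \<partial>W) = 1"
    by (intro prod.neutral) (auto simp: g_def prob_space)
  also have "(\<integral>f. g i f \<partial>W) = char (distr W borel (\<lambda>f. f u)) v"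
    unfolding char_def g_def using um by (subst integral_distr) auto
  also have "(\<integral>f. g j f \<partial>W) = char (distr W borel (\<lambda>f. f u)) (- v)"
    unfolding char_def g_def using um ij by (subst integral_distr) auto
  finally show ?thesis by simp
qed

end

text \<open>The law on path space of a stable process of index \<open>\<alpha> > 1\<close> started at 0.\<close>

locale stable_law = levy_law W for W +
  fixes \<alpha> c \<upsilon> :: real
  assumes alpha: "1 < \<alpha>" "\<alpha> \<le> 2" and c: "0 < c"
    and char_W: "\<And>t u. 0 \<le> t \<Longrightarrow> char (distr W borel (\<lambda>f. f t)) u = exp (- of_real t * stable_exponent \<alpha> c \<upsilon> u)"
begin

text \<open>The imaginary parts of the exponents cancel in the difference of two independent copies.\<close>

lemma symmetric_diff:
  assumes "i < n" "j < n" "i \<noteq> j" and u: "0 < u"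
  shows "symmetric_stable_distribution (distr (sys n) borel (\<lambda>F. F i u - F j u)) \<alpha> (2 * c * u)"
proof -
  interpret S: prob_space "sys n" by (rule prob_space_sys)
  have "real_distribution (distr (sys n) borel (\<lambda>F. F i u - F j u))"
    using assms by (intro S.real_distribution_distr) auto
  moreover have "char (distr (sys n) borel (\<lambda>F. F i u - F j u)) v = exp (- of_real (2 * c * u * \<bar>v\<bar> powr \<alpha>))" for v
    unfolding char_sys_diff[OF assms(1-3) less_imp_le[OF u]] char_W[OF less_imp_le[OF u]] exp_add[symmetric] stable_exponent_def
    by (simp add: algebra_simps sgn_minus)
  ultimately show ?thesis
    using alpha c u by (intro symmetric_stable_distribution.intro) (auto simp: symmetric_stable_distribution_axioms_def)
qed

text \<open>The constant in the tail bound \<open>stable_tail\<close>.\<close>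

definition tail_const :: real where "tail_const = 6 * (c * (1 + \<bar>\<upsilon> * tan (pi * \<alpha> / 2)\<bar>))"

lemma tail_const_nonneg: "0 \<le> tail_const"
  using c by (simp add: tail_const_def)

lemma one_minus_exp_cos:
  assumes "0 \<le> (a::real)" shows "1 - exp (- a) * cos b \<le> a + \<bar>b\<bar>"
proof -
  have e: "exp (- a) \<le> 1" "1 - a \<le> exp (- a)" using assms exp_ge_add_one_self[of "- a"] by auto
  have cb: "1 - cos b \<le> \<bar>b\<bar>"
  proof (cases "2 \<le> \<bar>b\<bar>")
    case False
    have "\<bar>sin (b / 2)\<bar> \<le> \<bar>b / 2\<bar>" by (rule abs_sin_x_le_abs_x)
    then have "(sin (b / 2))\<^sup>2 \<le> (b / 2)\<^sup>2" by (rule abs_le_square_iff[THEN iffD1])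
    moreover have "cos b = 1 - 2 * (sin (b / 2))\<^sup>2"
      using cos_double_sin[of "b / 2"] by simp
    moreover have "\<bar>b\<bar> * \<bar>b\<bar> \<le> 2 * \<bar>b\<bar>" using False by (intro mult_right_mono) auto
    ultimately show ?thesis by (simp add: power2_eq_square)
  qed (use cos_ge_minus_one[of b] in linarith)
  have "exp (- a) * (1 - cos b) \<le> 1 * (1 - cos b)" using e by (intro mult_right_mono) auto
  then show ?thesis using e cb by (simp add: algebra_simps)
qed

lemma stable_tail:
  assumes t: "0 \<le> t" and d: "0 < d"
  shows "measure (distr W borel (\<lambda>f. f t)) {x. d \<le> \<bar>x\<bar>} \<le> tail_const * t * d powr (-\<alpha>)"
proof -
  have rd: "real_distribution (distr W borel (\<lambda>f. f t))" using t by (intro real_distribution_distr) auto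
  have "1 - Re (char (distr W borel (\<lambda>f. f t)) v) \<le> (t * (c * (1 + \<bar>\<upsilon> * tan (pi * \<alpha> / 2)\<bar>))) * \<bar>v\<bar> powr \<alpha>" for v
  proof -
    let ?a = "t * (c * \<bar>v\<bar> powr \<alpha>)" and ?b = "t * (c * \<bar>v\<bar> powr \<alpha>) * (\<upsilon> * sgn v * tan (pi * \<alpha> / 2))"
    have "1 - Re (char (distr W borel (\<lambda>f. f t)) v) = 1 - exp (- ?a) * cos ?b"
      unfolding char_W[OF t] by (simp add: Re_exp stable_exponent_def algebra_simps)
    also have "\<dots> \<le> ?a + \<bar>?b\<bar>" using t c by (intro one_minus_exp_cos) auto
    also have "\<bar>?b\<bar> \<le> ?a * \<bar>\<upsilon> * tan (pi * \<alpha> / 2)\<bar>"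
      unfolding abs_mult[of "t * (c * \<bar>v\<bar> powr \<alpha>)"] using t c
      by (intro mult_mono) (auto simp: abs_mult sgn_real_def)
    finally show ?thesis by (simp add: algebra_simps)
  qed
  from tail_bound[OF rd _ alpha(2) _ this d] show ?thesis
    using alpha c t by (simp add: tail_const_def mult_ac)
qed

lemma sys_tail:
  assumes "i < n" "0 \<le> t" "0 < d"
  shows "measure (sys n) {F \<in> space (sys n). d \<le> \<bar>F i t\<bar>} \<le> tail_const * t * d powr (-\<alpha>)"
  using sys_component_prob[of i n t "{x. d \<le> \<bar>x\<bar>}"] stable_tail[of t d] assms by simp

end

section \<open>Hitting probabilities\<close>

lemma sum_powr_neg_le:
  assumes "0 < s" "s < 1"
  shows "(\<Sum>k=1..m. real k powr (- s)) \<le> 1 / (1 - s) * real m powr (1 - s)"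
proof (induction m)
  case (Suc m)
  have "real (Suc m) powr (- s) + 1 / (1 - s) * real m powr (1 - s) \<le> 1 / (1 - s) * real (Suc m) powr (1 - s)"
  proof (cases "m = 0")
    case True
    then show ?thesis using assms by (simp add: field_simps)
  next
    case False
    let ?r = "1 - s" and ?x = "real m" and ?y = "real (Suc m)"
    have "?x powr ?r * ?y powr s \<le> ?r * ?x + s * ?y"
      using False assms by (intro Youngs_inequality_0) auto
    also have "\<dots> = ?y - ?r" by (simp add: algebra_simps)
    finally have "?x powr ?r * ?y powr s * ?y powr (- s) \<le> (?y - ?r) * ?y powr (- s)"
      by (intro mult_right_mono) auto
    also have "?x powr ?r * ?y powr s * ?y powr (- s) = ?x powr ?r"
      by (simp add: mult.assoc powr_add[symmetric])
    also have "(?y - ?r) * ?y powr (- s) = ?y powr ?r - ?r * ?y powr (- s)"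
      using powr_mult_base[of ?y "- s"] by (simp only: left_diff_distrib) simp
    finally have "(?x powr ?r + ?r * ?y powr (- s)) / ?r \<le> ?y powr ?r / ?r"
      using assms by (intro divide_right_mono) auto
    then show ?thesis using assms by (simp add: add_divide_distrib)
  qed
  then show ?case using Suc by simp
qed simp

text \<open>A Paley-Zygmund inequality: if \<open>S\<close> is small off \<open>A\<close>, then a bound on its second moment by a
multiple of the square of its mean forces \<open>A\<close> to have substantial probability.\<close>

lemma (in prob_space) second_moment_bound:
  fixes S :: "'a \<Rightarrow> real"
  assumes A: "A \<in> events" and S: "integrable M S" "integrable M (\<lambda>\<omega>. (S \<omega>)\<^sup>2)"
    and mu: "0 < \<mu>" "0 < B"
    and ES: "\<mu> / 4 \<le> expectation S" and far: "\<And>\<omega>. \<omega> \<in> space M - A \<Longrightarrow> S \<omega> \<le> \<mu> / 8"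
    and ES2: "expectation (\<lambda>\<omega>. (S \<omega>)\<^sup>2) \<le> 3 * B\<^sup>2 * \<mu>\<^sup>2"
  shows "1 / (192 * B\<^sup>2) \<le> prob A"
proof -
  \<comment> \<open>On \<open>A\<close>, \<open>S\<close> is bounded by \<open>(l * S\<^sup>2 + 1 / l) / 2\<close>; this \<open>l\<close> makes the square term contribute \<open>\<mu> / 16\<close>.\<close>
  define l where "l = 1 / (24 * B\<^sup>2 * \<mu>)"
  have l: "l > 0" using mu by (simp add: l_def)
  have iA: "integrable M (\<lambda>\<omega>. indicator A \<omega> / (2 * l))"
    using A by (intro integrable_const_bound[where B = "1 / (2 * l)"]) (use l in \<open>auto simp: indicator_def\<close>)
  have "\<mu> / 4 \<le> expectation (\<lambda>\<omega>. \<mu> / 8 + l / 2 * (S \<omega>)\<^sup>2 + indicator A \<omega> / (2 * l))"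
  proof (rule order_trans[OF ES integral_mono[OF S(1)]])
    show "integrable M (\<lambda>\<omega>. \<mu> / 8 + l / 2 * (S \<omega>)\<^sup>2 + indicator A \<omega> / (2 * l))"
      using S iA by (intro Bochner_Integration.integrable_add) auto
    fix \<omega> assume w: "\<omega> \<in> space M"
    show "S \<omega> \<le> \<mu> / 8 + l / 2 * (S \<omega>)\<^sup>2 + indicator A \<omega> / (2 * l)"
    proof (cases "\<omega> \<in> A")
      case True
      have "0 \<le> (l * S \<omega> - 1)\<^sup>2" by simp
      then have "l * (2 * S \<omega>) \<le> l * (l * (S \<omega>)\<^sup>2 + 1 / l)"
        using l by (simp add: power2_eq_square algebra_simps)
      then have "2 * S \<omega> \<le> l * (S \<omega>)\<^sup>2 + 1 / l" using l by (simp only: mult_le_cancel_left_pos)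
      then show ?thesis using True mu by (simp add: field_simps)
    next
      case False
      then show ?thesis using far[of \<omega>] w l by (auto intro: order_trans add_increasing2)
    qed
  qed
  also have "\<dots> = \<mu> / 8 + l / 2 * expectation (\<lambda>\<omega>. (S \<omega>)\<^sup>2) + prob A / (2 * l)"
    using S iA A prob_space
    by (subst Bochner_Integration.integral_add) (auto intro!: Bochner_Integration.integrable_add simp: Int_absorb1 sets.sets_into_space)
  also have "\<dots> \<le> \<mu> / 8 + l / 2 * (3 * B\<^sup>2 * \<mu>\<^sup>2) + prob A / (2 * l)"
    using ES2 l by (intro add_mono mult_left_mono) auto
  also have "l / 2 * (3 * B\<^sup>2 * \<mu>\<^sup>2) = \<mu> / 16" using mu by (simp add: l_def power2_eq_square)
  also have "prob A / (2 * l) = prob A * (12 * B\<^sup>2 * \<mu>)" using mu by (simp add: l_def)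
  finally have "\<mu> * (1 / 16) \<le> \<mu> * (prob A * (12 * B\<^sup>2))" by (simp add: algebra_simps)
  then have "1 / 16 \<le> prob A * (12 * B\<^sup>2)" using mu by (simp only: mult_le_cancel_left_pos)
  then show ?thesis using mu by (simp add: field_simps)
qed

lemma sum_square_bound:
  fixes x :: "nat \<Rightarrow> real" and a :: "nat \<Rightarrow> nat \<Rightarrow> real"
  assumes x: "\<And>k. 0 \<le> x k"
    and diag: "\<And>k. k \<in> {1..m} \<Longrightarrow> a k k \<le> x k"
    and off: "\<And>k l. k \<in> {1..m} \<Longrightarrow> l \<in> {1..m} \<Longrightarrow> k < l \<Longrightarrow> a k l \<le> x k * x (l - k)"
    and sym: "\<And>k l. a k l = a l k"
  shows "(\<Sum>k=1..m. \<Sum>l=1..m. a k l) \<le> (\<Sum>k=1..m. x k) + 2 * (\<Sum>k=1..m. x k)\<^sup>2"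
proof -
  let ?X = "\<Sum>k=1..m. x k"
  define y where "y k l = (if k < l then x k * x (l - k) else 0)" for k l
  have le: "a k l \<le> (if k = l then x k else 0) + y k l + y l k" if "k \<in> {1..m}" "l \<in> {1..m}" for k l
  proof (cases k l rule: linorder_cases)
    case less
    then show ?thesis using off[OF that] x by (simp add: y_def)
  next
    case equal
    then show ?thesis using diag[OF that(1)] by (simp add: y_def)
  next
    case greater
    then show ?thesis using off[OF that(2,1)] x sym[of k l] by (simp add: y_def)
  qed
  have Y: "(\<Sum>k=1..m. \<Sum>l=1..m. y k l) \<le> ?X\<^sup>2"
  proof -
    have "(\<Sum>l=1..m. y k l) \<le> x k * ?X" if k: "k \<in> {1..m}" for k
    proof -
      have "(\<Sum>l=1..m. y k l) = (\<Sum>l\<in>{k<..m}. x k * x (l - k))"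
        unfolding y_def using k by (intro sum.mono_neutral_cong_right) auto
      also have "\<dots> = (\<Sum>d\<in>{1..m-k}. x k * x d)"
        using k by (intro sum.reindex_bij_witness[where i = "\<lambda>d. d + k" and j = "\<lambda>l. l - k"]) auto
      also have "\<dots> \<le> (\<Sum>d\<in>{1..m}. x k * x d)"
        using x by (intro sum_mono2) auto
      finally show ?thesis by (simp add: sum_distrib_left)
    qed
    then have "(\<Sum>k=1..m. \<Sum>l=1..m. y k l) \<le> (\<Sum>k=1..m. x k * ?X)" by (rule sum_mono)
    then show ?thesis by (simp add: power2_eq_square sum_distrib_right)
  qed
  have Y': "(\<Sum>k=1..m. \<Sum>l=1..m. y l k) \<le> ?X\<^sup>2"
    using Y by (subst sum.swap)
  have "(\<Sum>k=1..m. \<Sum>l=1..m. a k l) \<le> (\<Sum>k=1..m. \<Sum>l=1..m. (if k = l then x k else 0) + y k l + y l k)"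
    by (intro sum_mono le)
  also have "\<dots> = ?X + (\<Sum>k=1..m. \<Sum>l=1..m. y k l) + (\<Sum>k=1..m. \<Sum>l=1..m. y l k)"
    by (simp add: sum.distrib)
  finally show ?thesis using Y Y' by linarith
qed

context stable_law begin

text \<open>The difference of two of the free paths at time \<open>u\<close>.\<close>

abbreviation diff :: "nat \<Rightarrow> nat \<Rightarrow> real \<Rightarrow> (nat \<Rightarrow> real \<Rightarrow> real) \<Rightarrow> real" where
  "diff i j u F \<equiv> F i u - F j u"

text \<open>The density of a difference at time \<open>u\<close>, smoothed at any scale, is at most a multiple of
\<open>density_const * u powr (- 1 / \<alpha>)\<close>; \<open>time_const\<close> comes from integrating \<open>u powr (- 1 / \<alpha>)\<close>
near 0.\<close>

definition density_const :: real where "density_const = (2 * c) powr (- 1 / \<alpha>) * (stable_moment \<alpha> 0 / sqrt (2 * pi))"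

lemma density_const_pos: "0 < density_const"
  using c stable_moment_pos[of \<alpha>] alpha by (simp add: density_const_def)

definition time_const :: real where "time_const = 1 / (1 - 1 / \<alpha>)"

lemma time_const_pos: "0 < time_const" using alpha by (simp add: time_const_def)

text \<open>Distances up to \<open>l\<close> are small in comparison with the displacement of a difference within the
time \<open>h\<close>.\<close>

definition small_scale :: "real \<Rightarrow> real \<Rightarrow> bool" where
  "small_scale l h \<longleftrightarrow> 2 * l\<^sup>2 * stable_moment \<alpha> 2 \<le> stable_moment \<alpha> 0 * (c * h) powr (2 / \<alpha>)"

lemma powr_time:
  assumes "0 < u" shows "(2 * c * u) powr (- 1 / \<alpha>) = (2 * c) powr (- 1 / \<alpha>) * u powr (- 1 / \<alpha>)"
  using c assms by (subst powr_mult) auto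

context
  fixes n i j :: nat
  assumes ij: "i < n" "j < n" "i \<noteq> j"
begin

lemma diff_measurable [measurable]: "0 \<le> u \<Longrightarrow> diff i j u \<in> borel_measurable (sys n)"
  using ij by (intro borel_measurable_diff measurable_sys_coord) auto

text \<open>A Gaussian weight of width \<open>1 / \<sigma>\<close> that measures how close the difference is to \<open>b\<close>.\<close>

definition bump :: "real \<Rightarrow> real \<Rightarrow> real \<Rightarrow> (nat \<Rightarrow> real \<Rightarrow> real) \<Rightarrow> real" where
  "bump \<sigma> b u F = exp (- (\<sigma> * (diff i j u F - b))\<^sup>2 / 2)"

lemma bump_bounds: "0 \<le> bump \<sigma> b u F" "bump \<sigma> b u F \<le> 1"
  by (auto simp: bump_def)

lemma bump_measurable [measurable]: "0 \<le> u \<Longrightarrow> bump \<sigma> b u \<in> borel_measurable (sys n)"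
  unfolding bump_def by measurable

lemma bump_integral:
  assumes "0 \<le> u"
  shows "(\<integral>F. bump \<sigma> b u F \<partial>sys n) = (\<integral>x. exp (- (\<sigma> * (x - b))\<^sup>2 / 2) \<partial>distr (sys n) borel (diff i j u))"
  unfolding bump_def using assms by (subst integral_distr) auto

lemma bump_upper:
  assumes "0 < u" "0 < \<sigma>"
  shows "(\<integral>F. bump \<sigma> b u F \<partial>sys n) \<le> density_const / \<sigma> * u powr (- 1 / \<alpha>)"
proof -
  interpret D: symmetric_stable_distribution "distr (sys n) borel (diff i j u)" \<alpha> "2 * c * u"
    by (rule symmetric_diff[OF ij assms(1)])
  show ?thesis using D.smoothed_upper[OF assms(2), of b] assms(1)
    unfolding bump_integral[OF less_imp_le[OF assms(1)]] powr_time[OF assms(1)] density_const_def by (simp add: mult_ac)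
qed

lemma bump_lower:
  assumes u: "0 < u" and s: "0 < \<sigma>"
    and small: "(b\<^sup>2 + 1 / \<sigma>\<^sup>2) * stable_moment \<alpha> 2 \<le> stable_moment \<alpha> 0 * (2 * c * u) powr (2 / \<alpha>)"
  shows "density_const / (2 * \<sigma>) * u powr (- 1 / \<alpha>) \<le> (\<integral>F. bump \<sigma> b u F \<partial>sys n)"
proof -
  interpret D: symmetric_stable_distribution "distr (sys n) borel (diff i j u)" \<alpha> "2 * c * u"
    by (rule symmetric_diff[OF ij u])
  show ?thesis using D.smoothed_lower[OF s small]
    unfolding bump_integral[OF less_imp_le[OF u]] powr_time[OF u] density_const_def by (simp add: mult_ac)
qed

lemma bump_integrable: "0 \<le> u \<Longrightarrow> integrable (sys n) (bump \<sigma> b u)"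
proof -
  interpret S: prob_space "sys n" by (rule prob_space_sys)
  show "0 \<le> u \<Longrightarrow> integrable (sys n) (bump \<sigma> b u)"
    by (intro S.integrable_const_bound[where B = 1]) (use bump_bounds in auto)
qed

lemma bump_prod_integrable:
  assumes "0 \<le> u" "0 \<le> v" shows "integrable (sys n) (\<lambda>F. bump \<sigma> b u F * bump \<sigma> b v F)"
proof -
  interpret S: prob_space "sys n" by (rule prob_space_sys)
  have "norm (bump \<sigma> b u F * bump \<sigma> b v F) \<le> 1 * 1" for F
    unfolding norm_mult using bump_bounds by (intro mult_mono) auto
  then show ?thesis using assms
    by (intro S.integrable_const_bound[where B = 1]) auto
qed

lemma bump_two_times:
  assumes u: "0 < u" "u < v" and s: "0 < \<sigma>"
  shows "(\<integral>F. bump \<sigma> b u F * bump \<sigma> b v F \<partial>sys n) \<le> (density_const / \<sigma> * u powr (- 1 / \<alpha>)) * (density_const / \<sigma> * (v - u) powr (- 1 / \<alpha>))"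
proof -
  interpret S: prob_space "sys n" by (rule prob_space_sys)
  let ?C = "density_const / \<sigma> * (v - u) powr (- 1 / \<alpha>)"
  have int: "integrable (sys n) (\<lambda>F. bump \<sigma> b u F * bump \<sigma> b v F)"
    using u by (intro bump_prod_integrable) auto
  have u0: "0 \<le> u" using u by simp
  have "(\<integral>F. bump \<sigma> b u F * bump \<sigma> b v F \<partial>sys n) =
     (\<integral>F. \<integral>G. bump \<sigma> b u (glues n u F G) * bump \<sigma> b v (glues n u F G) \<partial>sys n \<partial>sys n)"
    by (rule sys_markov(1)[OF u0 int])
  also have "\<dots> \<le> (\<integral>F. bump \<sigma> b u F * ?C \<partial>sys n)"
  proof (rule integral_mono[OF sys_markov(2)[OF u0 int]])
    show "integrable (sys n) (\<lambda>F. bump \<sigma> b u F * ?C)"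
      using u0 by (intro integrable_mult_left bump_integrable)
    fix F
    have "bump \<sigma> b u (glues n u F G) * bump \<sigma> b v (glues n u F G) = bump \<sigma> b u F * bump \<sigma> (b - diff i j u F) (v - u) G" for G
      using ij u by (simp add: bump_def glues_nth algebra_simps)
    then have "(\<integral>G. bump \<sigma> b u (glues n u F G) * bump \<sigma> b v (glues n u F G) \<partial>sys n) =
      bump \<sigma> b u F * (\<integral>G. bump \<sigma> (b - diff i j u F) (v - u) G \<partial>sys n)" by simp
    also have "\<dots> \<le> bump \<sigma> b u F * ?C"
      using u s bump_bounds by (intro mult_left_mono bump_upper) auto
    finally show "(\<integral>G. bump \<sigma> b u (glues n u F G) * bump \<sigma> b v (glues n u F G) \<partial>sys n) \<le> bump \<sigma> b u F * ?C" .
  qed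
  also have "\<dots> = (\<integral>F. bump \<sigma> b u F \<partial>sys n) * ?C" by (rule integral_mult_left_zero)
  also have "\<dots> \<le> (density_const / \<sigma> * u powr (- 1 / \<alpha>)) * ?C"
    using u s density_const_pos by (intro mult_right_mono bump_upper) auto
  finally show ?thesis .
qed

text \<open>The second moment method for the sum of the weights at the times \<open>k * h / m\<close> with
\<open>1 \<le> k \<le> m\<close>.  The times are rational because \<open>h\<close> is.\<close>

lemma approach_prob:
  assumes l: "0 < l" and h: "0 < h" "h \<in> \<rat>" and sc: "small_scale l h" and b: "\<bar>b\<bar> \<le> l" and r: "0 < r"
  shows "1 / (192 * time_const\<^sup>2) \<le> measure (sys n) {F \<in> space (sys n). \<exists>u\<in>\<rat>. 0 < u \<and> u \<le> h \<and> \<bar>diff i j u F - b\<bar> < r}" (is "_ \<le> measure _ ?A")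
proof -
  interpret S: prob_space "sys n" by (rule prob_space_sys)
  let ?s = "1 / \<alpha>"
  have s01: "0 < ?s" "?s < 1" using alpha by auto
  \<comment> \<open>The second term makes the weights of positions at distance at least \<open>r\<close> from \<open>b\<close> negligible.\<close>
  define \<sigma> where "\<sigma> = max (1 / l) (16 * h powr ?s / (r\<^sup>2 * density_const))"
  have sig: "0 < \<sigma>" using l by (simp add: \<sigma>_def less_max_iff_disj)
  have sig1: "1 / \<sigma>\<^sup>2 \<le> l\<^sup>2"
  proof -
    have "1 / l \<le> \<sigma>" by (simp add: \<sigma>_def)
    then have "1 / \<sigma> \<le> l" using sig l by (simp add: field_simps)
    then have "(1 / \<sigma>)\<^sup>2 \<le> l\<^sup>2" using sig by (intro power_mono) auto
    then show ?thesis by (simp add: power_divide)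
  qed
  \<comment> \<open>With this many times the diagonal terms of the second moment do not dominate.\<close>
  obtain M :: nat where M: "M > 0" "1 / (time_const * (density_const * h powr (- ?s) / \<sigma>)) \<le> real M"
  proof -
    obtain M :: nat where "max 1 (1 / (time_const * (density_const * h powr (- ?s) / \<sigma>))) \<le> real M" using real_arch_simple by blast
    then show ?thesis using that[of M] by auto
  qed
  define m where "m = 2 * M"
  have m: "m > 0" using M by (simp add: m_def)
  define T where "T k = real k * h / real m" for k :: nat
  have T: "0 < T k" if "k \<in> {1..m}" for k using that h m by (auto simp: T_def)
  have T0: "0 \<le> T k" for k using h by (simp add: T_def)
  define \<mu> where "\<mu> = density_const * real m * h powr (- ?s) / \<sigma>"
  have mu: "0 < \<mu>" using density_const_pos m h sig by (simp add: \<mu>_def)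
  have muB: "1 \<le> time_const * \<mu>"
  proof -
    have "0 < time_const * (density_const * h powr (- ?s) / \<sigma>)" using time_const_pos density_const_pos h sig by simp
    from M(2)[unfolded pos_divide_le_eq[OF this]]
    have "1 \<le> real M * (time_const * (density_const * h powr (- ?s) / \<sigma>))" .
    also have "\<dots> \<le> real m * (time_const * (density_const * h powr (- ?s) / \<sigma>))"
      using time_const_pos density_const_pos h sig by (intro mult_right_mono) (auto simp: m_def)
    finally show ?thesis by (simp add: \<mu>_def mult_ac)
  qed
  define x where "x k = density_const / \<sigma> * T k powr (- ?s)" for k
  have x0: "0 \<le> x k" for k using density_const_pos sig by (simp add: x_def)
  have X: "(\<Sum>k=1..m. x k) \<le> time_const * \<mu>"
  proof -
    have "(\<Sum>k=1..m. x k) = (\<Sum>k=1..m. density_const / \<sigma> * (h / m) powr (- ?s) * real k powr (- ?s))"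
    proof (intro sum.cong refl)
      fix k assume "k \<in> {1..m}"
      have "T k = h / m * real k" by (simp add: T_def)
      then have "T k powr (- ?s) = (h / m) powr (- ?s) * real k powr (- ?s)" using h by (simp only: powr_mult)
      then show "x k = density_const / \<sigma> * (h / m) powr (- ?s) * real k powr (- ?s)" by (simp add: x_def)
    qed
    also have "\<dots> = density_const / \<sigma> * (h / m) powr (- ?s) * (\<Sum>k=1..m. real k powr (- ?s))" by (simp add: sum_distrib_left)
    also have "\<dots> \<le> density_const / \<sigma> * (h / m) powr (- ?s) * (1 / (1 - ?s) * real m powr (1 - ?s))"
      using density_const_pos sig by (intro mult_left_mono sum_powr_neg_le s01) auto
    also have "(h / m) powr (- ?s) = h powr (- ?s) * real m powr ?s"
      using h m by (simp add: powr_divide powr_minus_divide)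
    also have "density_const / \<sigma> * (h powr (- ?s) * real m powr ?s) * (1 / (1 - ?s) * real m powr (1 - ?s))
      = density_const / \<sigma> * h powr (- ?s) * time_const * (real m powr ?s * real m powr (1 - ?s))" by (simp add: time_const_def)
    also have "real m powr ?s * real m powr (1 - ?s) = real m"
      using m by (simp only: powr_add[symmetric]) simp
    finally show ?thesis by (simp add: \<mu>_def mult_ac)
  qed
  define Sm where "Sm F = (\<Sum>k=1..m. bump \<sigma> b (T k) F)" for F
  have iS: "integrable (sys n) Sm"
    unfolding Sm_def using T0 by (intro Bochner_Integration.integrable_sum bump_integrable)
  have S2: "(Sm F)\<^sup>2 = (\<Sum>k=1..m. \<Sum>l=1..m. bump \<sigma> b (T k) F * bump \<sigma> b (T l) F)" for F
    by (simp add: Sm_def power2_eq_square sum_product)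
  have iS2: "integrable (sys n) (\<lambda>F. (Sm F)\<^sup>2)"
    unfolding S2 using T0 by (intro Bochner_Integration.integrable_sum bump_prod_integrable)
  have ES2: "(\<integral>F. (Sm F)\<^sup>2 \<partial>sys n) \<le> 3 * time_const\<^sup>2 * \<mu>\<^sup>2"
  proof -
    have "(\<integral>F. (Sm F)\<^sup>2 \<partial>sys n) = (\<Sum>k=1..m. \<Sum>l=1..m. \<integral>F. bump \<sigma> b (T k) F * bump \<sigma> b (T l) F \<partial>sys n)"
      unfolding S2 using T0 by (simp add: Bochner_Integration.integral_sum Bochner_Integration.integrable_sum bump_prod_integrable)
    also have "\<dots> \<le> (\<Sum>k=1..m. x k) + 2 * (\<Sum>k=1..m. x k)\<^sup>2"
    proof (rule sum_square_bound[OF x0])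
      fix k assume k: "k \<in> {1..m}"
      have "(\<integral>F. bump \<sigma> b (T k) F * bump \<sigma> b (T k) F \<partial>sys n) \<le> (\<integral>F. bump \<sigma> b (T k) F * 1 \<partial>sys n)"
        using T0 bump_bounds
        by (intro integral_mono bump_prod_integrable integrable_mult_left bump_integrable mult_left_mono) auto
      also have "\<dots> \<le> x k" using bump_upper[OF T[OF k] sig, of b] by (simp add: x_def)
      finally show "(\<integral>F. bump \<sigma> b (T k) F * bump \<sigma> b (T k) F \<partial>sys n) \<le> x k" .
    next
      fix k l assume kl: "k \<in> {1..m}" "l \<in> {1..m}" "k < l"
      have "T k < T l" using kl h m by (simp add: T_def divide_strict_right_mono)
      moreover have "T l - T k = T (l - k)" using kl by (simp add: T_def diff_divide_distrib[symmetric] left_diff_distrib of_nat_diff)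
      ultimately show "(\<integral>F. bump \<sigma> b (T k) F * bump \<sigma> b (T l) F \<partial>sys n) \<le> x k * x (l - k)"
        using bump_two_times[OF T[OF kl(1)] _ sig, of "T l" b] by (simp add: x_def)
    qed (simp add: mult.commute)
    also have "\<dots> \<le> time_const * \<mu> + 2 * (time_const * \<mu>)\<^sup>2"
      using X x0 by (intro add_mono mult_left_mono power_mono sum_nonneg) auto
    also have "time_const * \<mu> * 1 \<le> (time_const * \<mu>) * (time_const * \<mu>)" using muB by (intro mult_left_mono) auto
    then have "time_const * \<mu> + 2 * (time_const * \<mu>)\<^sup>2 \<le> 3 * time_const\<^sup>2 * \<mu>\<^sup>2" by (simp add: power2_eq_square mult_ac)
    finally show ?thesis by simp
  qed
  have ES: "\<mu> / 4 \<le> (\<integral>F. Sm F \<partial>sys n)"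
  proof -
    have low: "density_const / (2 * \<sigma>) * h powr (- ?s) \<le> (\<integral>F. bump \<sigma> b (T k) F \<partial>sys n)" if k: "k \<in> {M..m}" for k
    proof -
      have k1: "k \<in> {1..m}" using k M by auto
      have Tk: "h / 2 \<le> T k" "T k \<le> h"
      proof -
        have "real m \<le> 2 * real k" "real k \<le> real m" using k by (auto simp: m_def)
        then have "real m * h \<le> 2 * real k * h" "real k * h \<le> real m * h" using h by (auto intro: mult_right_mono)
        then show "h / 2 \<le> T k" "T k \<le> h" using m by (auto simp: T_def field_simps)
      qed
      have "(b\<^sup>2 + 1 / \<sigma>\<^sup>2) * stable_moment \<alpha> 2 \<le> (l\<^sup>2 + l\<^sup>2) * stable_moment \<alpha> 2"
        using sig1 b stable_moment_nonneg by (intro mult_right_mono add_mono) (auto simp: abs_le_square_iff[symmetric])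
      also have "\<dots> \<le> stable_moment \<alpha> 0 * (c * h) powr (2 / \<alpha>)" using sc by (simp add: small_scale_def)
      also have "\<dots> \<le> stable_moment \<alpha> 0 * (2 * c * T k) powr (2 / \<alpha>)"
        using Tk c h alpha stable_moment_nonneg by (intro mult_left_mono powr_mono2) (auto simp: field_simps)
      finally have "density_const / (2 * \<sigma>) * T k powr (- ?s) \<le> (\<integral>F. bump \<sigma> b (T k) F \<partial>sys n)"
        using bump_lower[OF T[OF k1] sig] by simp
      moreover have "density_const / (2 * \<sigma>) * h powr (- ?s) \<le> density_const / (2 * \<sigma>) * T k powr (- ?s)"
        using Tk T[OF k1] s01 density_const_pos sig by (intro mult_left_mono powr_mono2') auto
      ultimately show ?thesis by linarith
    qed
    have "\<mu> / 4 = real M * (density_const / (2 * \<sigma>) * h powr (- ?s))" by (simp add: \<mu>_def m_def)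
    also have "\<dots> \<le> real (card {M..m}) * (density_const / (2 * \<sigma>) * h powr (- ?s))"
      using density_const_pos sig by (intro mult_right_mono) (auto simp: m_def)
    also have "\<dots> = (\<Sum>k\<in>{M..m}. density_const / (2 * \<sigma>) * h powr (- ?s))" by simp
    also have "\<dots> \<le> (\<Sum>k\<in>{M..m}. \<integral>F. bump \<sigma> b (T k) F \<partial>sys n)" by (rule sum_mono[OF low])
    also have "\<dots> \<le> (\<Sum>k=1..m. \<integral>F. bump \<sigma> b (T k) F \<partial>sys n)"
      using M bump_bounds by (intro sum_mono2 integral_nonneg_AE) auto
    also have "\<dots> = (\<integral>F. Sm F \<partial>sys n)"
      unfolding Sm_def using T0 by (simp add: Bochner_Integration.integral_sum bump_integrable)
    finally show ?thesis .
  qed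
  let ?A' = "{F \<in> space (sys n). \<exists>k\<in>{1..m}. \<bar>diff i j (T k) F - b\<bar> < r}"
  have A': "?A' \<in> sets (sys n)"
    using T0 by measurable
  have far: "Sm F \<le> \<mu> / 8" if F: "F \<in> space (sys n) - ?A'" for F
  proof -
    have "bump \<sigma> b (T k) F \<le> density_const * h powr (- ?s) / (8 * \<sigma>)" if k: "k \<in> {1..m}" for k
    proof -
      let ?y = "\<sigma> * (diff i j (T k) F - b)"
      have "r \<le> \<bar>diff i j (T k) F - b\<bar>" using F k by force
      then have "\<sigma> * r \<le> \<bar>?y\<bar>" using sig by (simp add: abs_mult)
      then have "(\<sigma> * r)\<^sup>2 \<le> ?y\<^sup>2" using sig r by (metis abs_le_square_iff abs_of_nonneg less_imp_le mult_nonneg_nonneg)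
      then have y: "(\<sigma> * r)\<^sup>2 / 2 \<le> ?y\<^sup>2 / 2" by simp
      have "0 < (\<sigma> * r)\<^sup>2 / 2" using sig r by simp
      moreover have "?y\<^sup>2 / 2 \<le> exp (?y\<^sup>2 / 2)" using exp_ge_add_one_self[of "?y\<^sup>2 / 2"] by linarith
      ultimately have "1 / exp (?y\<^sup>2 / 2) \<le> 1 / ((\<sigma> * r)\<^sup>2 / 2)" using y by (intro divide_left_mono mult_pos_pos) auto
      moreover have "bump \<sigma> b (T k) F = 1 / exp (?y\<^sup>2 / 2)" by (simp add: bump_def exp_minus inverse_eq_divide)
      ultimately have "bump \<sigma> b (T k) F \<le> 2 / (\<sigma> * r)\<^sup>2" by simp
      also have "\<dots> = (2 / (\<sigma> * r\<^sup>2)) / \<sigma>" by (simp add: power2_eq_square)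
      also have "\<dots> \<le> (density_const * h powr (- ?s) / 8) / \<sigma>"
      proof (rule divide_right_mono)
        have "16 * h powr ?s / (r\<^sup>2 * density_const) \<le> \<sigma>" by (simp add: \<sigma>_def)
        then have "16 * h powr ?s \<le> \<sigma> * (r\<^sup>2 * density_const)" using r density_const_pos by (simp add: field_simps)
        then have "16 \<le> \<sigma> * r\<^sup>2 * (density_const * h powr (- ?s))" using h by (simp add: powr_minus_divide field_simps)
        then show "2 / (\<sigma> * r\<^sup>2) \<le> density_const * h powr (- ?s) / 8" using sig r by (simp add: field_simps)
      qed (use sig in simp)
      finally show ?thesis by (simp add: mult_ac)
    qed
    then have "Sm F \<le> (\<Sum>k=1..m. density_const * h powr (- ?s) / (8 * \<sigma>))"
      unfolding Sm_def by (rule sum_mono)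
    then show ?thesis by (simp add: \<mu>_def mult_ac)
  qed
  have "1 / (192 * time_const\<^sup>2) \<le> measure (sys n) ?A'"
    by (rule S.second_moment_bound[OF A' iS iS2 mu time_const_pos ES far ES2])
  also have "\<dots> \<le> measure (sys n) ?A"
  proof (rule S.finite_measure_mono)
    show "?A' \<subseteq> ?A"
    proof
      fix F assume F: "F \<in> ?A'"
      then obtain k where k: "k \<in> {1..m}" and d: "\<bar>diff i j (T k) F - b\<bar> < r" by blast
      have "T k \<in> \<rat>" using h by (simp add: T_def)
      moreover have "T k \<le> h" using k h m by (auto simp: T_def field_simps)
      ultimately show "F \<in> ?A" using T[OF k] d F by blast
    qed
    have "?A = (\<Union>u\<in>{u\<in>\<rat>. 0 < u \<and> u \<le> h}. {F \<in> space (sys n). \<bar>diff i j u F - b\<bar> < r})" by auto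
    also have "\<dots> \<in> sets (sys n)"
    proof (rule sets.countable_UN'')
      show "countable {u\<in>\<rat>. 0 < u \<and> u \<le> h}" by (rule countable_subset[OF _ countable_rat]) auto
      fix u assume "u \<in> {u\<in>\<rat>. 0 < u \<and> u \<le> h}"
      then have [measurable]: "diff i j u \<in> borel_measurable (sys n)" by (intro diff_measurable) auto
      show "{F \<in> space (sys n). \<bar>diff i j u F - b\<bar> < r} \<in> sets (sys n)" by measurable
    qed
    finally show "?A \<in> sets (sys n)" .
  qed
  finally show ?thesis .
qed

text \<open>The bound does not depend on the distance \<open>r\<close>, so \<open>r\<close> may tend to 0.\<close>

lemma collision_prob:
  assumes l: "0 < l" and h: "0 < h" "h \<in> \<rat>" and sc: "small_scale l h" and b: "\<bar>b\<bar> \<le> l"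
  shows "1 / (192 * time_const\<^sup>2) \<le> measure (sys n) {F \<in> space (sys n). \<forall>e::nat. \<exists>u\<in>\<rat>. 0 < u \<and> u \<le> h \<and> \<bar>diff i j u F - b\<bar> < 1 / Suc e}"
    and "{F \<in> space (sys n). \<forall>e::nat. \<exists>u\<in>\<rat>. 0 < u \<and> u \<le> h \<and> \<bar>diff i j u F - b\<bar> < 1 / Suc e} \<in> sets (sys n)"
proof -
  interpret S: prob_space "sys n" by (rule prob_space_sys)
  define A where "A e = {F \<in> space (sys n). \<exists>u\<in>\<rat>. 0 < u \<and> u \<le> h \<and> \<bar>diff i j u F - b\<bar> < 1 / Suc e}" for e :: nat
  have A: "A e \<in> sets (sys n)" for e
  proof -
    have "A e = (\<Union>u\<in>{u\<in>\<rat>. 0 < u \<and> u \<le> h}. {F \<in> space (sys n). \<bar>diff i j u F - b\<bar> < 1 / Suc e})"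
      by (auto simp: A_def)
    also have "\<dots> \<in> sets (sys n)"
    proof (rule sets.countable_UN'')
      show "countable {u\<in>\<rat>. 0 < u \<and> u \<le> h}" by (rule countable_subset[OF _ countable_rat]) auto
      fix u assume "u \<in> {u\<in>\<rat>. 0 < u \<and> u \<le> h}"
      then have [measurable]: "diff i j u \<in> borel_measurable (sys n)" by (intro diff_measurable) auto
      show "{F \<in> space (sys n). \<bar>diff i j u F - b\<bar> < 1 / Suc e} \<in> sets (sys n)" by measurable
    qed
    finally show ?thesis .
  qed
  have eq: "{F \<in> space (sys n). \<forall>e::nat. \<exists>u\<in>\<rat>. 0 < u \<and> u \<le> h \<and> \<bar>diff i j u F - b\<bar> < 1 / Suc e} = (\<Inter>e. A e)"
    by (auto simp: A_def)
  show "{F \<in> space (sys n). \<forall>e::nat. \<exists>u\<in>\<rat>. 0 < u \<and> u \<le> h \<and> \<bar>diff i j u F - b\<bar> < 1 / Suc e} \<in> sets (sys n)"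
    unfolding eq using A by auto
  have "decseq A"
  proof (rule antimonoI)
    fix e e' :: nat assume "e \<le> e'"
    then have "1 / real (Suc e') \<le> 1 / real (Suc e)" by (intro divide_left_mono) auto
    then show "A e' \<subseteq> A e" unfolding A_def by (blast intro: less_le_trans)
  qed
  then have "(\<lambda>e. measure (sys n) (A e)) \<longlonglongrightarrow> measure (sys n) (\<Inter>e. A e)"
    using A by (intro S.finite_Lim_measure_decseq) auto
  moreover have "1 / (192 * time_const\<^sup>2) \<le> measure (sys n) (A e)" for e
    unfolding A_def by (rule approach_prob[OF l h sc b]) simp
  ultimately show "1 / (192 * time_const\<^sup>2) \<le> measure (sys n) {F \<in> space (sys n). \<forall>e::nat. \<exists>u\<in>\<rat>. 0 < u \<and> u \<le> h \<and> \<bar>diff i j u F - b\<bar> < 1 / Suc e}"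
    unfolding eq by (intro LIMSEQ_le_const) auto
qed

text \<open>On the circle two particles are close if the difference of their lifts is close to some integer.
Integers beyond \<open>L\<close> are handled by the tail bound, those up to \<open>L\<close> by the density bound.\<close>

lemma diff_near_integer_prob:
  assumes u: "0 < u" and e: "0 < e" "e \<le> 1" and L: "0 < L"
  shows "measure (sys n) {F \<in> space (sys n). \<exists>k::int. \<bar>diff i j u F - b - k\<bar> < e} \<le>
    2 * (tail_const * u * (L / 2) powr (-\<alpha>)) + (2 * L + 4) * (exp (1 / 2) * density_const * u powr (- 1 / \<alpha>) * e)"
proof -
  interpret S: prob_space "sys n" by (rule prob_space_sys)
  interpret D: symmetric_stable_distribution "distr (sys n) borel (diff i j u)" \<alpha> "2 * c * u"
    by (rule symmetric_diff[OF ij u])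
  have u0: "0 \<le> u" using u by simp
  have [measurable]: "(\<lambda>F. F i u) \<in> borel_measurable (sys n)" "(\<lambda>F. F j u) \<in> borel_measurable (sys n)"
    using ij u0 by auto
  define I where "I = {\<lceil>- L - b - 1\<rceil>..\<lfloor>L - b + 1\<rfloor>}"
  let ?Ti = "\<lambda>i. {F \<in> space (sys n). L / 2 \<le> \<bar>F i u\<bar>}"
  let ?N = "\<lambda>k::int. {F \<in> space (sys n). \<bar>diff i j u F - (b + k)\<bar> < e}"
  have N: "measure (sys n) (?N k) \<le> exp (1 / 2) * density_const * u powr (- 1 / \<alpha>) * e" for k
  proof -
    have "measure (sys n) (?N k) = measure (distr (sys n) borel (diff i j u)) {x. \<bar>x - (b + k)\<bar> < e}"
      using u0 by (subst measure_distr) (auto intro!: arg_cong[where f = "measure (sys n)"])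
    also have "\<dots> \<le> exp (1 / 2) * (stable_moment \<alpha> 0 / sqrt (2 * pi)) * (2 * c * u) powr (- 1 / \<alpha>) * e"
      by (rule D.prob_near_le[OF e(1)])
    finally show ?thesis unfolding powr_time[OF u] density_const_def by (simp add: mult_ac)
  qed
  have sub: "{F \<in> space (sys n). \<exists>k::int. \<bar>diff i j u F - b - k\<bar> < e} \<subseteq> (?Ti i \<union> ?Ti j) \<union> (\<Union>k\<in>I. ?N k)"
  proof safe
    fix F k assume F: "F \<in> space (sys n)" "\<bar>diff i j u F - b - real_of_int k\<bar> < e"
      and no: "F \<notin> (\<Union>k\<in>I. ?N k)" and nj: "\<not> L / 2 \<le> \<bar>F j u\<bar>"
    have "k \<notin> I" using F no by (auto simp: algebra_simps)
    then have "real_of_int k < - L - b - 1 \<or> L - b + 1 < real_of_int k"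
      unfolding I_def by (simp only: atLeastAtMost_iff ceiling_le_iff le_floor_iff) linarith
    then have "L < \<bar>diff i j u F\<bar>" using F e by linarith
    then show "L / 2 \<le> \<bar>F i u\<bar>" using nj by linarith
  qed
  have meas: "?Ti i \<in> sets (sys n)" "?Ti j \<in> sets (sys n)" "\<And>k. ?N k \<in> sets (sys n)" by measurable
  have fin: "finite I" by (simp add: I_def)
  have cardI: "real (card I) \<le> 2 * L + 4"
  proof -
    have "real (card I) \<le> max 0 (real_of_int (\<lfloor>L - b + 1\<rfloor> - \<lceil>- L - b - 1\<rceil> + 1))"
      by (simp add: I_def)
    also have "\<dots> \<le> 2 * L + 4" using L by linarith
    finally show ?thesis .
  qed
  have "measure (sys n) {F \<in> space (sys n). \<exists>k::int. \<bar>diff i j u F - b - k\<bar> < e} \<le> measure (sys n) ((?Ti i \<union> ?Ti j) \<union> (\<Union>k\<in>I. ?N k))"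
    using meas fin by (intro S.finite_measure_mono[OF sub]) auto
  also have "\<dots> \<le> measure (sys n) (?Ti i \<union> ?Ti j) + measure (sys n) (\<Union>k\<in>I. ?N k)"
    using meas fin by (intro measure_Un_le) auto
  also have "measure (sys n) (?Ti i \<union> ?Ti j) \<le> measure (sys n) (?Ti i) + measure (sys n) (?Ti j)"
    using meas by (intro measure_Un_le) auto
  also have "\<dots> \<le> tail_const * u * (L / 2) powr (-\<alpha>) + tail_const * u * (L / 2) powr (-\<alpha>)"
    using ij u0 L by (intro add_mono sys_tail) auto
  also have "measure (sys n) (\<Union>k\<in>I. ?N k) \<le> (\<Sum>k\<in>I. measure (sys n) (?N k))"
    using meas fin by (intro S.finite_measure_subadditive_finite) auto
  also have "\<dots> \<le> (\<Sum>k\<in>I. exp (1 / 2) * density_const * u powr (- 1 / \<alpha>) * e)" by (rule sum_mono[OF N])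
  also have "\<dots> \<le> (2 * L + 4) * (exp (1 / 2) * density_const * u powr (- 1 / \<alpha>) * e)"
    using density_const_pos e by (simp, intro mult_right_mono cardI) auto
  finally show ?thesis by (simp add: mult_ac)
qed

end

end

section \<open>Coincidences of left limits\<close>

text \<open>The distance \<open>D\<close> of two paths is small at some point of the grid of mesh \<open>1 / m\<close> and large at the
next one, among the grid points up to \<open>T\<close>.\<close>

definition separates_on_grid :: "(real \<Rightarrow> real) \<Rightarrow> nat \<Rightarrow> nat \<Rightarrow> nat \<Rightarrow> nat \<Rightarrow> bool" where
  "separates_on_grid D T d e m \<longleftrightarrow> (\<exists>k\<in>{..<T * m}. D (real k / m) < 1 / Suc e \<and> D (real (Suc k) / m) > 1 / Suc d)"

text \<open>The paths separate on all fine grids, for a fixed meaning of large and every meaning of small.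
This is the measurable trace of a time at which their left limits agree and their values differ.\<close>

definition jumps_off_coincidence :: "(real \<Rightarrow> real) \<Rightarrow> nat \<Rightarrow> bool" where
  "jumps_off_coincidence D T \<longleftrightarrow> (\<exists>d::nat. \<forall>e::nat. \<exists>m0. \<forall>m\<in>{m0..}. separates_on_grid D T d e m)"

text \<open>The state space is the image of the line under \<open>\<pi>\<close>, which identifies two points only if
their difference is an integer, and \<open>r\<close> picks representatives.  The bound on \<open>r\<close> says that representatives
leave a window of radius at least 1 only through large displacements.\<close>

locale projection =
  fixes \<pi> :: "real \<Rightarrow> 'e::{second_countable_topology, metric_space}" and r :: "real \<Rightarrow> real"
  assumes lipschitz: "dist (\<pi> x) (\<pi> y) \<le> 7 * \<bar>x - y\<bar>"
    and near_int: "0 < e \<Longrightarrow> dist (\<pi> x) (\<pi> y) < e \<Longrightarrow> \<exists>k::int. \<bar>x - y - k\<bar> < e"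
    and rep: "\<pi> (r x + u) = \<pi> (x + u)"
    and r_measurable [measurable]: "r \<in> borel_measurable borel"
    and r_bound: "\<bar>r (x + d)\<bar> \<le> max 1 (\<bar>r x\<bar> + \<bar>d\<bar>)"
begin

lemma pi_measurable [measurable]: "\<pi> \<in> borel_measurable borel"
proof (rule borel_measurable_continuous_onI)
  have "7-lipschitz_on UNIV \<pi>"
    by (intro lipschitz_onI) (use lipschitz in \<open>auto simp: dist_real_def\<close>)
  then show "continuous_on UNIV \<pi>" by (rule lipschitz_on_continuous_on)
qed

end

locale projected_stable_law = stable_law W \<alpha> c \<upsilon> + projection \<pi> r
  for W \<alpha> c \<upsilon> and \<pi> :: "real \<Rightarrow> 'e::{second_countable_topology, metric_space}" and r
begin

text \<open>The system of free particles in the state space, started at the points \<open>\<pi> (x i)\<close>.\<close>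

definition proj :: "(nat \<Rightarrow> real) \<Rightarrow> (nat \<Rightarrow> real \<Rightarrow> real) \<Rightarrow> nat \<Rightarrow> real \<Rightarrow> 'e" where
  "proj x F i u = \<pi> (x i + F i u)"

lemma proj_measurable [measurable]: "i < n \<Longrightarrow> 0 \<le> u \<Longrightarrow> (\<lambda>F. proj x F i u) \<in> borel_measurable (sys n)"
  unfolding proj_def by (rule measurable_compose[OF _ pi_measurable]) measurable

text \<open>The number 28 arises as \<open>2 * 7 * 2\<close>: the distance grows by at least \<open>d / 2\<close>, the map \<open>\<pi>\<close> has
Lipschitz constant 7, and one of two increments carries half of the growth.\<close>

lemma separation_step_prob:
  assumes ij: "i < n" "j < n" "i \<noteq> j" and u: "0 \<le> u" and h: "0 < h" and d: "0 < d"
  fixes x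
  defines "D \<equiv> \<lambda>F u. dist (proj x F i u) (proj x F j u)"
  shows "measure (sys n) {F \<in> space (sys n). D F u < d / 2 \<and> D F u < e \<and> D F (u + h) > d} \<le>
    measure (sys n) {F \<in> space (sys n). D F u < e} * (2 * (tail_const * h * (d / 28) powr (-\<alpha>)))"
proof -
  interpret S: prob_space "sys n" by (rule prob_space_sys)
  have [measurable]: "(\<lambda>F. D F u) \<in> borel_measurable (sys n)" if "0 \<le> u" for u
    unfolding D_def using ij that by measurable
  have Dm [measurable]: "(\<lambda>F. D F u) \<in> borel_measurable (sys n)" "(\<lambda>F. D F (u + h)) \<in> borel_measurable (sys n)"
    using u h by auto
  let ?B = "{F \<in> space (sys n). D F u < d / 2 \<and> D F u < e \<and> D F (u + h) > d}"
  let ?N = "{F \<in> space (sys n). D F u < e}"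
  let ?C = "2 * (tail_const * h * (d / 28) powr (-\<alpha>))"
  have B: "?B \<in> sets (sys n)" and N: "?N \<in> sets (sys n)" by measurable
  have iN: "integrable (sys n) (\<lambda>F. indicator ?N F * ?C)"
    using N by (intro integrable_mult_left S.integrable_const_bound[where B = 1]) (auto simp: indicator_def)
  have "measure (sys n) ?B = (\<integral>F. measure (sys n) {G \<in> space (sys n). glues n u F G \<in> ?B} \<partial>sys n)"
    by (rule sys_markov_prob(1)[OF u B])
  also have "\<dots> \<le> (\<integral>F. indicator ?N F * ?C \<partial>sys n)"
  proof (rule integral_mono[OF sys_markov_prob(2)[OF u B] iN])
    fix F assume F: "F \<in> space (sys n)"
    let ?R = "{G \<in> space (sys n). glues n u F G \<in> ?B}"
    show "measure (sys n) ?R \<le> indicator ?N F * ?C"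
    proof (cases "D F u < e \<and> D F u < d / 2")
      case True
      let ?Ti = "\<lambda>i. {G \<in> space (sys n). d / 28 \<le> \<bar>G i h\<bar>}"
      have meas: "?Ti i \<in> sets (sys n)" "?Ti j \<in> sets (sys n)"
      proof -
        have [measurable]: "(\<lambda>G. G i h) \<in> borel_measurable (sys n)" "(\<lambda>G. G j h) \<in> borel_measurable (sys n)"
          using ij h by auto
        show "?Ti i \<in> sets (sys n)" "?Ti j \<in> sets (sys n)" by measurable
      qed
      have "?R \<subseteq> ?Ti i \<union> ?Ti j"
      proof safe
        fix G assume G: "G \<in> space (sys n)" and "D (glues n u F G) (u + h) > d" and nj: "\<not> d / 28 \<le> \<bar>G j h\<bar>"
        then have "d < dist (\<pi> (x i + (F i u + G i h))) (\<pi> (x j + (F j u + G j h)))"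
          using ij u h by (simp add: D_def proj_def glues_nth)
        also have "\<dots> \<le> dist (\<pi> (x i + (F i u + G i h))) (\<pi> (x i + F i u)) + D F u + dist (\<pi> (x j + F j u)) (\<pi> (x j + (F j u + G j h)))"
          unfolding D_def proj_def by (smt (verit) dist_triangle)
        also have "\<dots> \<le> 7 * \<bar>G i h\<bar> + D F u + 7 * \<bar>G j h\<bar>"
          using lipschitz[of "x i + (F i u + G i h)" "x i + F i u"] lipschitz[of "x j + F j u" "x j + (F j u + G j h)"] by simp
        finally show "d / 28 \<le> \<bar>G i h\<bar>" using nj True by linarith
      qed
      then have "measure (sys n) ?R \<le> measure (sys n) (?Ti i \<union> ?Ti j)"
        using meas by (intro S.finite_measure_mono) auto
      also have "\<dots> \<le> measure (sys n) (?Ti i) + measure (sys n) (?Ti j)"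
        using meas by (rule measure_Un_le)
      also have "\<dots> \<le> tail_const * h * (d / 28) powr (-\<alpha>) + tail_const * h * (d / 28) powr (-\<alpha>)"
        using ij h d by (intro add_mono sys_tail) auto
      finally show ?thesis using True F by (simp add: mult_ac)
    next
      case False
      have "?R = {}" using False ij u by (auto simp: D_def proj_def glues_nth)
      then have "measure (sys n) ?R = 0" by (simp only: measure_empty)
      moreover have "0 \<le> indicator ?N F * ?C" using tail_const_nonneg h by (intro mult_nonneg_nonneg) auto
      ultimately show ?thesis by linarith
    qed
  qed
  also have "\<dots> = measure (sys n) ?N * ?C"
    using N by (simp add: Int_absorb2 sets.sets_into_space)
  finally show ?thesis .
qed

lemma separates_on_grid_measurable:
  assumes ij: "i < n" "j < n"
  fixes x and T :: nat
  defines "D \<equiv> \<lambda>F u. dist (proj x F i u) (proj x F j u)"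
  shows "{F \<in> space (sys n). D F (real k / m) < a \<and> D F (real (Suc k) / m) > b} \<in> sets (sys n)"
    and "{F \<in> space (sys n). separates_on_grid (D F) T d e m} \<in> sets (sys n)"
proof -
  have Dm: "(\<lambda>F. D F u) \<in> borel_measurable (sys n)" if "0 \<le> u" for u
    unfolding D_def using ij that by measurable
  have J: "{F \<in> space (sys n). D F (real k / m) < a \<and> D F (real (Suc k) / m) > b} \<in> sets (sys n)" for k a b
  proof -
    have [measurable]: "(\<lambda>F. D F (real k / m)) \<in> borel_measurable (sys n)" "(\<lambda>F. D F (real (Suc k) / m)) \<in> borel_measurable (sys n)"
      by (auto intro!: Dm)
    show ?thesis by measurable
  qed
  then show "{F \<in> space (sys n). D F (real k / m) < a \<and> D F (real (Suc k) / m) > b} \<in> sets (sys n)" .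
  have "{F \<in> space (sys n). separates_on_grid (D F) T d e m} =
    (\<Union>k\<in>{..<T * m}. {F \<in> space (sys n). D F (real k / m) < 1 / Suc e \<and> D F (real (Suc k) / m) > 1 / Suc d})"
    by (auto simp: separates_on_grid_def)
  then show "{F \<in> space (sys n). separates_on_grid (D F) T d e m} \<in> sets (sys n)"
    using J by auto
qed

text \<open>The bound tends to 0 if first \<open>m\<close>, then \<open>e\<close> and finally \<open>L\<close> tend to infinity.\<close>

lemma separates_on_grid_prob:
  assumes ij: "i < n" "j < n" "i \<noteq> j" and de: "2 / Suc e \<le> 1 / Suc d" and L: "0 < L" and m: "0 < m"
  fixes x and T :: nat
  defines "D \<equiv> \<lambda>F u. dist (proj x F i u) (proj x F j u)"
  shows "measure (sys n) {F \<in> space (sys n). separates_on_grid (D F) T d e m} \<le>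
    2 * (tail_const * (1 / Suc d / 28) powr (-\<alpha>)) * (1 / real m + 2 * tail_const * (real T)\<^sup>2 * (L / 2) powr (-\<alpha>)
      + (2 * L + 4) * (exp (1 / 2) * density_const * time_const * real T powr (1 - 1 / \<alpha>)) / Suc e)"
proof -
  interpret S: prob_space "sys n" by (rule prob_space_sys)
  have Dm: "(\<lambda>F. D F u) \<in> borel_measurable (sys n)" if "0 \<le> u" for u
    unfolding D_def using ij that by measurable
  let ?J = "\<lambda>k. {F \<in> space (sys n). D F (real k / m) < 1 / Suc e \<and> D F (real (Suc k) / m) > 1 / Suc d}"
  let ?N = "\<lambda>k. {F \<in> space (sys n). D F (real k / m) < 1 / Suc e}"
  have J: "?J k \<in> sets (sys n)" for k
    unfolding D_def by (rule separates_on_grid_measurable(1)[OF ij(1,2)])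
  have N: "?N k \<in> sets (sys n)" for k
  proof -
    have [measurable]: "(\<lambda>F. D F (real k / m)) \<in> borel_measurable (sys n)" by (auto intro!: Dm)
    show ?thesis by measurable
  qed
  have eq: "{F \<in> space (sys n). separates_on_grid (D F) T d e m} = (\<Union>k\<in>{..<T * m}. ?J k)"
    by (auto simp: separates_on_grid_def)
  let ?C = "2 * (tail_const * (1 / Suc d / 28) powr (-\<alpha>))"
  have C0: "0 \<le> ?C" using tail_const_nonneg by simp
  let ?s = "1 / \<alpha>"
  have s01: "0 < ?s" "?s < 1" using alpha by auto
  have step: "measure (sys n) (?J k) \<le> measure (sys n) (?N k) * (?C / m)" for k
  proof -
    have "(2 / real (Suc e)) / 2 \<le> (1 / real (Suc d)) / 2" using de by (rule divide_right_mono) simp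
    moreover have "(2 / real (Suc e)) / 2 = 1 / Suc e" by (simp add: field_simps)
    ultimately have "1 / real (Suc e) \<le> 1 / real (Suc d) / 2" by simp
    then have "?J k \<subseteq> {F \<in> space (sys n). D F (real k / m) < 1 / Suc d / 2 \<and> D F (real k / m) < 1 / Suc e \<and> D F (real k / m + 1 / m) > 1 / Suc d}"
      by (auto simp: add_divide_distrib add.commute)
    moreover have "{F \<in> space (sys n). D F (real k / m) < 1 / Suc d / 2 \<and> D F (real k / m) < 1 / Suc e \<and> D F (real k / m + 1 / m) > 1 / Suc d} \<in> sets (sys n)"
    proof -
      have [measurable]: "(\<lambda>F. D F (real k / m)) \<in> borel_measurable (sys n)" "(\<lambda>F. D F (real k / m + 1 / m)) \<in> borel_measurable (sys n)"
        by (auto intro!: Dm)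
      show ?thesis by measurable
    qed
    ultimately have "measure (sys n) (?J k) \<le> measure (sys n) {F \<in> space (sys n). D F (real k / m) < 1 / Suc d / 2 \<and> D F (real k / m) < 1 / Suc e \<and> D F (real k / m + 1 / m) > 1 / Suc d}"
      by (intro S.finite_measure_mono)
    also have "\<dots> \<le> measure (sys n) (?N k) * (2 * (tail_const * (1 / m) * (1 / Suc d / 28) powr (-\<alpha>)))"
      unfolding D_def using m by (intro separation_step_prob[OF ij]) auto
    finally show ?thesis by (simp add: mult_ac)
  qed
  define b where "b = x j - x i"
  have near: "measure (sys n) (?N k) \<le> 2 * tail_const * T * (L / 2) powr (-\<alpha>) + ((2 * L + 4) * (exp (1 / 2) * density_const) / Suc e) * (real k / m) powr (- ?s)"
    if k: "0 < k" "k < T * m" for k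
  proof -
    have u: "0 < real k / m" using k m by simp
    have "?N k \<subseteq> {F \<in> space (sys n). \<exists>l::int. \<bar>diff i j (real k / m) F - b - l\<bar> < 1 / Suc e}"
      using near_int[of "1 / Suc e"] by (fastforce simp: D_def proj_def b_def algebra_simps)
    moreover have "{F \<in> space (sys n). \<exists>l::int. \<bar>diff i j (real k / m) F - b - l\<bar> < 1 / Suc e} \<in> sets (sys n)"
    proof -
      have [measurable]: "diff i j (real k / m) \<in> borel_measurable (sys n)"
        by (intro diff_measurable[OF ij]) auto
      show ?thesis by measurable
    qed
    ultimately have "measure (sys n) (?N k) \<le> measure (sys n) {F \<in> space (sys n). \<exists>l::int. \<bar>diff i j (real k / m) F - b - l\<bar> < 1 / Suc e}"
      by (intro S.finite_measure_mono)
    also have "\<dots> \<le> 2 * (tail_const * (real k / m) * (L / 2) powr (-\<alpha>)) + (2 * L + 4) * (exp (1 / 2) * density_const * (real k / m) powr (- 1 / \<alpha>) * (1 / Suc e))"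
      using u L by (intro diff_near_integer_prob[OF ij]) auto
    also have "\<dots> \<le> 2 * (tail_const * T * (L / 2) powr (-\<alpha>)) + (2 * L + 4) * (exp (1 / 2) * density_const * (real k / m) powr (- 1 / \<alpha>) * (1 / Suc e))"
    proof -
      have "real k \<le> real (T * m)" using k by linarith
      then have "real k / m \<le> T" using m by (simp add: field_simps)
      then show ?thesis using tail_const_nonneg by (intro add_right_mono mult_left_mono mult_right_mono) auto
    qed
    finally show ?thesis by (simp add: mult_ac)
  qed
  define x1 where "x1 = 2 * tail_const * T * (L / 2) powr (-\<alpha>)"
  define x2 where "x2 = (2 * L + 4) * (exp (1 / 2) * density_const) / Suc e"
  have x12: "0 \<le> x1" "0 \<le> x2" using tail_const_nonneg L density_const_pos by (auto simp: x1_def x2_def)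
  have "(\<Sum>k<T * m. measure (sys n) (?N k)) \<le> (\<Sum>k<T * m. (if k = 0 then 1 else 0) + x1 + x2 * (real k / m) powr (- ?s))"
  proof (rule sum_mono)
    fix k assume k: "k \<in> {..<T * m}"
    show "measure (sys n) (?N k) \<le> (if k = 0 then 1 else 0) + x1 + x2 * (real k / m) powr (- ?s)"
    proof (cases "k = 0")
      case True
      then have "1 \<le> (if k = 0 then 1 else 0) + x1 + x2 * (real k / m) powr (- ?s)" using x12 by simp
      then show ?thesis using S.prob_le_1[of "?N k"] by linarith
    next
      case False
      then show ?thesis using near[of k] k by (simp add: x1_def x2_def)
    qed
  qed
  also have "\<dots> \<le> 1 + real (T * m) * x1 + x2 * (\<Sum>k<T * m. (real k / m) powr (- ?s))"
    by (simp add: sum.distrib sum_distrib_left)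
  also have "(\<Sum>k<T * m. (real k / m) powr (- ?s)) \<le> m * (time_const * real T powr (1 - ?s))"
  proof -
    have "(\<Sum>k<T * m. (real k / m) powr (- ?s)) = (\<Sum>k<T * m. m powr ?s * real k powr (- ?s))"
      using m by (intro sum.cong refl) (simp add: powr_divide powr_minus_divide)
    also have "\<dots> = m powr ?s * (\<Sum>k<T * m. real k powr (- ?s))" by (simp add: sum_distrib_left)
    also have "(\<Sum>k<T * m. real k powr (- ?s)) = (\<Sum>k\<in>{1..<T * m}. real k powr (- ?s))"
      by (intro sum.mono_neutral_right) auto
    also have "m powr ?s * \<dots> \<le> m powr ?s * (\<Sum>k=1..T * m. real k powr (- ?s))"
      by (intro mult_left_mono sum_mono2) auto
    also have "\<dots> \<le> m powr ?s * (1 / (1 - ?s) * real (T * m) powr (1 - ?s))"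
      by (intro mult_left_mono sum_powr_neg_le s01) auto
    also have "real (T * m) powr (1 - ?s) = T powr (1 - ?s) * m powr (1 - ?s)"
      by (simp add: powr_mult)
    also have "m powr ?s * (1 / (1 - ?s) * (T powr (1 - ?s) * m powr (1 - ?s))) = (m powr ?s * m powr (1 - ?s)) * (time_const * real T powr (1 - ?s))"
      by (simp add: time_const_def mult_ac)
    also have "m powr ?s * m powr (1 - ?s) = m" using m by (simp only: powr_add[symmetric]) simp
    finally show ?thesis .
  qed
  finally have sumN: "(\<Sum>k<T * m. measure (sys n) (?N k)) \<le> 1 + real (T * m) * x1 + x2 * (m * (time_const * real T powr (1 - ?s)))"
    using x12 by (simp add: mult_left_mono)
  have "measure (sys n) {F \<in> space (sys n). separates_on_grid (D F) T d e m} \<le> (\<Sum>k<T * m. measure (sys n) (?J k))"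
    unfolding eq using J by (intro S.finite_measure_subadditive_finite) auto
  also have "\<dots> \<le> (\<Sum>k<T * m. measure (sys n) (?N k) * (?C / m))" by (rule sum_mono[OF step])
  also have "\<dots> = (\<Sum>k<T * m. measure (sys n) (?N k)) * (?C / m)" by (simp only: sum_distrib_right)
  also have "\<dots> \<le> (1 + real (T * m) * x1 + x2 * (m * (time_const * real T powr (1 - ?s)))) * (?C / m)"
    using sumN C0 by (intro mult_right_mono) auto
  also have "\<dots> = ?C * (1 / m + T * x1 + x2 * (time_const * real T powr (1 - ?s)))"
    using m by (simp add: field_simps)
  finally show "measure (sys n) {F \<in> space (sys n). separates_on_grid (D F) T d e m} \<le>
    ?C * (1 / real m + 2 * tail_const * (real T)\<^sup>2 * (L / 2) powr (-\<alpha>) + (2 * L + 4) * (exp (1 / 2) * density_const * time_const * real T powr (1 - 1 / \<alpha>)) / Suc e)"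
    by (simp add: x1_def x2_def power2_eq_square mult_ac)
qed

lemma AE_no_jumps_off_coincidence:
  assumes ij: "i < n" "j < n" "i \<noteq> j"
  fixes x and T :: nat
  defines "D \<equiv> \<lambda>F u. dist (proj x F i u) (proj x F j u)"
  shows "AE F in sys n. \<not> jumps_off_coincidence (D F) T"
proof -
  interpret S: prob_space "sys n" by (rule prob_space_sys)
  let ?J = "\<lambda>d e m. {F \<in> space (sys n). separates_on_grid (D F) T d e m}"
  have J: "?J d e m \<in> sets (sys n)" for d e m
    unfolding D_def by (rule separates_on_grid_measurable(2)[OF ij(1,2)])
  define Bd where "Bd d = {F \<in> space (sys n). \<forall>e. \<exists>m0. \<forall>m\<in>{m0..}. separates_on_grid (D F) T d e m}" for d
  have Bd: "Bd d \<in> sets (sys n)" for d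
  proof -
    have "Bd d = (\<Inter>e. \<Union>m0. \<Inter>m\<in>{m0..}. ?J d e m)" by (auto simp: Bd_def) meson
    also have "\<dots> \<in> sets (sys n)" using J by (intro sets.countable_INT'' sets.countable_UN sets.countable_INT') auto
    finally show ?thesis .
  qed
  have "measure (sys n) (Bd d) = 0" for d
  proof (rule antisym[OF field_le_epsilon])
    fix \<epsilon> :: real assume eps: "0 < \<epsilon>"
    let ?C = "2 * (tail_const * (1 / Suc d / 28) powr (-\<alpha>))"
    define p1 where "p1 L = ?C * (2 * tail_const * (real T)\<^sup>2 * (L / 2) powr (-\<alpha>))" for L
    define c3 where "c3 = ?C * (exp (1 / 2) * density_const * time_const * real T powr (1 - 1 / \<alpha>))"
    have "filterlim (\<lambda>L::real. 1 / 2 * L) at_top at_top"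
      by (rule filterlim_tendsto_pos_mult_at_top[OF tendsto_const _ filterlim_ident]) simp
    then have half: "filterlim (\<lambda>L::real. L / 2) at_top at_top" by simp
    have "(p1 \<longlongrightarrow> ?C * (2 * tail_const * (real T)\<^sup>2 * 0)) at_top"
      unfolding p1_def using alpha
      by (intro tendsto_intros tendsto_neg_powr half) auto
    then have "eventually (\<lambda>L. p1 L < \<epsilon> / 3) at_top" using eps by (intro order_tendstoD(2)) auto
    then obtain L where L: "0 < L" "p1 L < \<epsilon> / 3"
      using eventually_conj[OF _ eventually_gt_at_top[of 0], of "\<lambda>L. p1 L < \<epsilon> / 3"] by (auto dest!: eventually_happens)
    have "(\<lambda>e. c3 * (2 * L + 4) * inverse (real (Suc e))) \<longlonglongrightarrow> c3 * (2 * L + 4) * 0"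
      by (intro tendsto_intros LIMSEQ_inverse_real_of_nat)
    then have "eventually (\<lambda>e. c3 * (2 * L + 4) * inverse (real (Suc e)) < \<epsilon> / 3) sequentially"
      using eps by (intro order_tendstoD(2)) auto
    then obtain e0 where e0: "\<And>e. e \<ge> e0 \<Longrightarrow> c3 * (2 * L + 4) * inverse (real (Suc e)) < \<epsilon> / 3"
      by (auto simp: eventually_sequentially)
    define e where "e = max e0 (2 * d + 1)"
    have ee: "e0 \<le> e" "2 * d + 1 \<le> e" by (auto simp: e_def)
    have e: "c3 * (2 * L + 4) / Suc e < \<epsilon> / 3" using e0[OF ee(1)] by (simp only: divide_inverse)
    have de: "2 / Suc e \<le> 1 / Suc d"
    proof -
      have "2 * Suc d \<le> Suc e" using ee(2) by simp
      then have "real (2 * Suc d) \<le> real (Suc e)" by (rule of_nat_mono)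
      then have "2 * real (Suc d) \<le> real (Suc e)" by simp
      then show ?thesis by (simp add: field_simps)
    qed
    have "(\<lambda>m. ?C * inverse (real (Suc m))) \<longlonglongrightarrow> ?C * 0"
      by (intro tendsto_intros LIMSEQ_inverse_real_of_nat)
    then have "eventually (\<lambda>m. ?C * inverse (real (Suc m)) < \<epsilon> / 3) sequentially"
      using eps by (intro order_tendstoD(2)) auto
    then obtain M where M: "\<And>m. m \<ge> M \<Longrightarrow> ?C * inverse (real (Suc m)) < \<epsilon> / 3"
      by (auto simp: eventually_sequentially)
    have Jm: "measure (sys n) (?J d e m) \<le> \<epsilon>" if "Suc M \<le> m" for m
    proof -
      have m0: "0 < m" using that by simp
      have "measure (sys n) (?J d e m) \<le> ?C * (1 / real m + 2 * tail_const * (real T)\<^sup>2 * (L / 2) powr (-\<alpha>)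
        + (2 * L + 4) * (exp (1 / 2) * density_const * time_const * real T powr (1 - 1 / \<alpha>)) / Suc e)"
        unfolding D_def by (rule separates_on_grid_prob[OF ij de L(1) m0])
      also have "\<dots> = ?C * inverse (real (Suc (m - 1))) + p1 L + c3 * (2 * L + 4) / Suc e"
      proof -
        have "C * (1 / M + b + w * g / S) = C * inverse M + C * b + (C * g) * w / S" for C M b w g S :: real
          by (simp add: distrib_left divide_inverse mult_ac)
        moreover have "Suc (m - 1) = m" using m0 by simp
        ultimately show ?thesis unfolding p1_def c3_def by (simp only:)
      qed
      also have "\<dots> \<le> \<epsilon>" using M[of "m - 1"] that L e by linarith
      finally show ?thesis .
    qed
    define I where "I k = (\<Inter>m\<in>{Suc M + k..}. ?J d e m)" for k
    have I: "I k \<in> sets (sys n)" for k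
      unfolding I_def using J by (intro sets.countable_INT') auto
    have "incseq I" by (auto simp: incseq_def I_def)
    then have lim: "(\<lambda>k. measure (sys n) (I k)) \<longlonglongrightarrow> measure (sys n) (\<Union>k. I k)"
      using I by (intro S.finite_Lim_measure_incseq) auto
    have "measure (sys n) (I k) \<le> \<epsilon>" for k
    proof -
      have "measure (sys n) (I k) \<le> measure (sys n) (?J d e (Suc M + k))"
        using J by (intro S.finite_measure_mono) (auto simp: I_def)
      also have "\<dots> \<le> \<epsilon>" by (rule Jm) simp
      finally show ?thesis .
    qed
    then have le: "measure (sys n) (\<Union>k. I k) \<le> \<epsilon>"
      by (intro LIMSEQ_le_const2[OF lim]) auto
    have "Bd d \<subseteq> (\<Union>k. I k)"
    proof
      fix F assume F: "F \<in> Bd d"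
      then obtain m0 where m0: "\<forall>m\<in>{m0..}. separates_on_grid (D F) T d e m" by (auto simp: Bd_def)
      then have "F \<in> I m0" using F by (auto simp: I_def Bd_def)
      then show "F \<in> (\<Union>k. I k)" by blast
    qed
    then have "measure (sys n) (Bd d) \<le> measure (sys n) (\<Union>k. I k)"
      using I by (intro S.finite_measure_mono) auto
    then show "measure (sys n) (Bd d) \<le> 0 + \<epsilon>" using le by simp
  qed simp
  then have "AE F in sys n. F \<notin> Bd d" for d
    using Bd S.prob_eq_0 by blast
  then have "AE F in sys n. \<forall>d. F \<notin> Bd d" by (simp add: AE_all_countable)
  then show ?thesis using AE_space
  proof eventually_elim
    case (elim F)
    then show ?case by (auto simp: jumps_off_coincidence_def Bd_def)
  qed
qed

end

section \<open>One step of the coalescing system\<close>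

lemma near_measurable:
  fixes f :: "'w \<Rightarrow> nat \<Rightarrow> real \<Rightarrow> 'e::{second_countable_topology, metric_space}"
  assumes f: "\<And>u. 0 \<le> u \<Longrightarrow> (\<lambda>\<omega>. f \<omega> i u) \<in> borel_measurable M" "\<And>u. 0 \<le> u \<Longrightarrow> (\<lambda>\<omega>. f \<omega> j u) \<in> borel_measurable M"
  shows "{\<omega> \<in> space M. near (f \<omega>) i j q} \<in> sets M"
proof -
  have "{\<omega> \<in> space M. near (f \<omega>) i j q} = (\<Inter>e::nat. \<Union>u\<in>{u\<in>\<rat>. 0 \<le> u \<and> u \<le> q}. {\<omega> \<in> space M. dist (f \<omega> i u) (f \<omega> j u) < 1 / Suc e})"
    by (auto simp: near_def)
  also have "\<dots> \<in> sets M"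
  proof (intro sets.countable_INT image_subsetI)
    fix e :: nat
    show "(\<Union>u\<in>{u\<in>\<rat>. 0 \<le> u \<and> u \<le> q}. {\<omega> \<in> space M. dist (f \<omega> i u) (f \<omega> j u) < 1 / Suc e}) \<in> sets M"
    proof (rule sets.countable_UN'')
      show "countable {u\<in>\<rat>. 0 \<le> u \<and> u \<le> q}" by (rule countable_subset[OF _ countable_rat]) auto
      fix u assume "u \<in> {u\<in>\<rat>. 0 \<le> u \<and> u \<le> q}"
      then have [measurable]: "(\<lambda>\<omega>. f \<omega> i u) \<in> borel_measurable M" "(\<lambda>\<omega>. f \<omega> j u) \<in> borel_measurable M"
        using f by auto
      show "{\<omega> \<in> space M. dist (f \<omega> i u) (f \<omega> j u) < 1 / Suc e} \<in> sets M" by measurable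
    qed
  qed auto
  finally show ?thesis .
qed

lemma dead_measurable:
  fixes f :: "'w \<Rightarrow> nat \<Rightarrow> real \<Rightarrow> 'e::{second_countable_topology, metric_space}"
  assumes f: "\<And>j u. j \<le> i \<Longrightarrow> 0 \<le> u \<Longrightarrow> (\<lambda>\<omega>. f \<omega> j u) \<in> borel_measurable M"
  shows "{\<omega> \<in> space M. dead (f \<omega>) i t} \<in> sets M"
  using f
proof (induction i arbitrary: t rule: less_induct)
  case (less i)
  have "{\<omega> \<in> space M. dead (f \<omega>) i t} = (\<Union>j\<in>{..<i}. \<Union>q\<in>{q\<in>\<rat>. 0 \<le> q \<and> q \<le> t}.
      {\<omega> \<in> space M. near (f \<omega>) i j q} - {\<omega> \<in> space M. dead (f \<omega>) j q})"
    by (auto simp: dead.simps[of _ i])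
  also have "\<dots> \<in> sets M"
  proof (intro sets.countable_UN'' sets.Diff)
    show "countable {q\<in>\<rat>. 0 \<le> q \<and> q \<le> t}" by (rule countable_subset[OF _ countable_rat]) auto
    fix j q assume "j \<in> {..<i}"
    then show "{\<omega> \<in> space M. near (f \<omega>) i j q} \<in> sets M"
      by (intro near_measurable less.prems) auto
    show "{\<omega> \<in> space M. dead (f \<omega>) j q} \<in> sets M"
      using \<open>j \<in> {..<i}\<close> by (intro less.IH less.prems) auto
  qed auto
  finally show ?case .
qed

context projected_stable_law begin

text \<open>The events that particle \<open>i\<close> is alive at time \<open>t\<close>, and that it is alive and outside the window
of radius \<open>K\<close>.\<close>

definition alive :: "nat \<Rightarrow> (nat \<Rightarrow> real) \<Rightarrow> nat \<Rightarrow> real \<Rightarrow> (nat \<Rightarrow> real \<Rightarrow> real) set" where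
  "alive n x i t = {F \<in> space (sys n). \<not> dead (proj x F) i t}"

definition outside :: "nat \<Rightarrow> (nat \<Rightarrow> real) \<Rightarrow> real \<Rightarrow> nat \<Rightarrow> real \<Rightarrow> (nat \<Rightarrow> real \<Rightarrow> real) set" where
  "outside n x K i t = {F \<in> alive n x i t. K < \<bar>r (x i + F i t)\<bar>}"

lemma alive_sets: assumes "i < n" shows "alive n x i t \<in> sets (sys n)"
proof -
  have "{F \<in> space (sys n). dead (proj x F) i t} \<in> sets (sys n)"
    using assms by (intro dead_measurable proj_measurable) auto
  then have "space (sys n) - {F \<in> space (sys n). dead (proj x F) i t} \<in> sets (sys n)" by auto
  also have "space (sys n) - {F \<in> space (sys n). dead (proj x F) i t} = alive n x i t" by (auto simp: alive_def)
  finally show ?thesis .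
qed

lemma outside_sets: assumes "i < n" "0 \<le> t" shows "outside n x K i t \<in> sets (sys n)"
proof -
  have [measurable]: "(\<lambda>F. F i t) \<in> borel_measurable (sys n)" using assms by auto
  have "{F \<in> space (sys n). K < \<bar>r (x i + F i t)\<bar>} \<in> sets (sys n)" by measurable
  then have "alive n x i t \<inter> {F \<in> space (sys n). K < \<bar>r (x i + F i t)\<bar>} \<in> sets (sys n)"
    using alive_sets assms by auto
  also have "alive n x i t \<inter> {F \<in> space (sys n). K < \<bar>r (x i + F i t)\<bar>} = outside n x K i t"
    by (auto simp: outside_def alive_def)
  finally show ?thesis .
qed

text \<open>The conditional probability of an event, given the paths \<open>F\<close> up to time \<open>t\<close>.\<close>

definition section_prob :: "nat \<Rightarrow> real \<Rightarrow> (nat \<Rightarrow> real \<Rightarrow> real) set \<Rightarrow> (nat \<Rightarrow> real \<Rightarrow> real) \<Rightarrow> real" where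
  "section_prob n t S F = measure (sys n) {G \<in> space (sys n). glues n t F G \<in> S}"

lemma section_sets:
  assumes "0 \<le> t" "F \<in> space (sys n)" "S \<in> sets (sys n)"
  shows "{G \<in> space (sys n). glues n t F G \<in> S} \<in> sets (sys n)"
  using measurable_sets[OF glues_measurable_snd[OF assms(1,2)] assms(3)] by (simp add: vimage_def Int_def conj_commute)

lemma section_prob_le_1: "section_prob n t S F \<le> 1"
proof -
  interpret S: prob_space "sys n" by (rule prob_space_sys)
  show ?thesis by (simp add: section_prob_def)
qed

lemma dead_glues:
  assumes "i < n" "0 \<le> t"
  shows "dead (proj x (glues n t F G)) i t \<longleftrightarrow> dead (proj x F) i t"
  using assms by (intro dead_cong) (auto simp: proj_def glues_nth)

lemma section_alive_0:
  assumes "i < n" "0 \<le> t" "0 \<le> h" "dead (proj x F) i t" "S \<subseteq> alive n x i (t + h)"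
  shows "section_prob n t S F = 0"
proof -
  have "{G \<in> space (sys n). glues n t F G \<in> S} = {}"
    using assms dead_glues[OF assms(1,2), of x F] dead_mono[of _ i t "t + h"] by (fastforce simp: alive_def)
  then show ?thesis unfolding section_prob_def by (simp only: measure_empty)
qed

text \<open>The probability in \<open>collision_prob\<close>.\<close>

definition hit_prob :: real where "hit_prob = 1 / (192 * time_const\<^sup>2)"

lemma hit_prob_bounds: "0 < hit_prob" "hit_prob \<le> 1"
proof -
  have "1 \<le> time_const" using alpha by (simp add: time_const_def field_simps)
  then have "1 \<le> time_const\<^sup>2" by (rule one_le_power)
  then have "1 \<le> 192 * time_const\<^sup>2" by simp
  then have pos: "0 < 192 * time_const\<^sup>2" by linarith
  then show "0 < hit_prob" by (simp add: hit_prob_def)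
  show "hit_prob \<le> 1" unfolding hit_prob_def using \<open>1 \<le> 192 * time_const\<^sup>2\<close> by (simp only: divide_le_eq_1_pos[OF pos])
qed

text \<open>Of two particles whose positions at time \<open>t\<close> are within distance \<open>l\<close>, at least one is dead at
time \<open>t + h\<close> with conditional probability at least \<open>hit_prob\<close>.\<close>

lemma section_pair:
  assumes ij: "i < n" "j < n" "i \<noteq> j" and t: "0 \<le> t" "t \<in> \<rat>" and h: "0 < h" "h \<in> \<rat>"
    and l: "0 < l" and sc: "small_scale l h" and F: "F \<in> space (sys n)"
    and close: "\<bar>r (x i + F i t) - r (x j + F j t)\<bar> \<le> l"
  shows "section_prob n t (alive n x i (t + h)) F + section_prob n t (alive n x j (t + h)) F \<le> 2 - hit_prob"
proof -
  interpret S: prob_space "sys n" by (rule prob_space_sys)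
  let ?S = "\<lambda>i. {G \<in> space (sys n). glues n t F G \<in> alive n x i (t + h)}"
  define b where "b = r (x j + F j t) - r (x i + F i t)"
  have b: "\<bar>b\<bar> \<le> l" using close by (simp add: b_def)
  let ?E = "{G \<in> space (sys n). \<forall>e::nat. \<exists>u\<in>\<rat>. 0 < u \<and> u \<le> h \<and> \<bar>diff i j u G - b\<bar> < 1 / Suc e}"
  have S: "?S i \<in> sets (sys n)" "?S j \<in> sets (sys n)"
    using ij alive_sets by (auto intro!: section_sets t F)
  note E = collision_prob[OF ij l h sc b]
  have "?S i \<inter> ?S j \<subseteq> space (sys n) - ?E"
  proof
    fix G assume G: "G \<in> ?S i \<inter> ?S j"
    then have al: "\<not> dead (proj x (glues n t F G)) i (t + h)" "\<not> dead (proj x (glues n t F G)) j (t + h)"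
      by (auto simp: alive_def)
    have "\<not> near (proj x (glues n t F G)) i j (t + h)"
      using al ij t h by (intro two_alive_not_near) auto
    moreover have "near (proj x (glues n t F G)) i j (t + h)" if "G \<in> ?E"
      unfolding near_def
    proof
      fix e :: nat
      \<comment> \<open>\<open>Suc (7 * e + 6) = 7 * Suc e\<close> makes up for the Lipschitz constant of \<open>\<pi>\<close>.\<close>
      have "\<exists>u\<in>\<rat>. 0 < u \<and> u \<le> h \<and> \<bar>diff i j u G - b\<bar> < 1 / Suc (7 * e + 6)" using that by blast
      then obtain u where u: "u \<in> \<rat>" "0 < u" "u \<le> h" "\<bar>diff i j u G - b\<bar> < 1 / Suc (7 * e + 6)" by blast
      have eqs: "proj x (glues n t F G) k (t + u) = \<pi> (r (x k + F k t) + G k u)" if "k < n" for k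
        using that t u by (simp add: proj_def glues_nth rep add.assoc)
      have "dist (proj x (glues n t F G) i (t + u)) (proj x (glues n t F G) j (t + u)) \<le>
         7 * \<bar>(r (x i + F i t) + G i u) - (r (x j + F j t) + G j u)\<bar>"
        unfolding eqs[OF ij(1)] eqs[OF ij(2)] by (rule lipschitz)
      also have "(r (x i + F i t) + G i u) - (r (x j + F j t) + G j u) = diff i j u G - b" by (simp add: b_def)
      also have "7 * \<bar>diff i j u G - b\<bar> < 7 * (1 / Suc (7 * e + 6))" using u by simp
      also have "\<dots> = 1 / Suc e" by (simp add: field_simps)
      finally show "\<exists>u\<in>\<rat>. 0 \<le> u \<and> u \<le> t + h \<and> dist (proj x (glues n t F G) i u) (proj x (glues n t F G) j u) < 1 / Suc e"
        using u t by (intro bexI[of _ "t + u"]) auto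
    qed
    ultimately show "G \<in> space (sys n) - ?E" using G by blast
  qed
  then have "measure (sys n) (?S i \<inter> ?S j) \<le> measure (sys n) (space (sys n) - ?E)"
    using E(2) by (intro S.finite_measure_mono) auto
  also have "\<dots> = 1 - measure (sys n) ?E" by (rule S.prob_compl[OF E(2)])
  also have "\<dots> \<le> 1 - hit_prob" using E(1) by (simp add: hit_prob_def)
  finally have I: "measure (sys n) (?S i \<inter> ?S j) \<le> 1 - hit_prob" .
  have "measure (sys n) (?S i \<union> ?S j) = measure (sys n) (?S i) + measure (sys n) (?S j - ?S i)"
    using S by (intro S.finite_measure_Union') auto
  moreover have "measure (sys n) (?S j - ?S i) = measure (sys n) (?S j) - measure (sys n) (?S j \<inter> ?S i)"
    using S by (intro S.finite_measure_Diff') auto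
  ultimately have "measure (sys n) (?S i) + measure (sys n) (?S j) = measure (sys n) (?S i \<union> ?S j) + measure (sys n) (?S i \<inter> ?S j)"
    by (simp add: Int_commute)
  also have "\<dots> \<le> 1 + (1 - hit_prob)" using I by (intro add_mono) auto
  finally show ?thesis by (simp add: section_prob_def)
qed

text \<open>The expected number of particles that are alive at time \<open>t\<close>, and of those that are moreover
outside the window of radius \<open>K\<close>.\<close>

definition expected_alive :: "nat \<Rightarrow> (nat \<Rightarrow> real) \<Rightarrow> real \<Rightarrow> real" where
  "expected_alive n x t = (\<Sum>i<n. measure (sys n) (alive n x i t))"

definition expected_outside :: "nat \<Rightarrow> (nat \<Rightarrow> real) \<Rightarrow> real \<Rightarrow> real \<Rightarrow> real" where
  "expected_outside n x K t = (\<Sum>i<n. measure (sys n) (outside n x K i t))"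

text \<open>Given the past, pair off the survivors in the window that share a cell of width \<open>l\<close>; survivors
outside the window count as unpaired.\<close>

lemma section_alive_sum:
  assumes t: "0 \<le> t" "t \<in> \<rat>" and h: "0 < h" "h \<in> \<rat>" and K: "0 \<le> K"
    and l: "0 < l" and sc: "small_scale l h" and F: "F \<in> space (sys n)"
  shows "(\<Sum>i<n. section_prob n t (alive n x i (t + h)) F) \<le>
    (\<Sum>i<n. (1 - hit_prob / 2) * indicator (alive n x i t) F + hit_prob / 2 * indicator (outside n x K i t) F) + hit_prob / 2 * (2 * K / l + 2)"
proof -
  let ?w = "\<lambda>i. section_prob n t (alive n x i (t + h)) F"
  let ?y = "\<lambda>i. r (x i + F i t)"
  define A where "A = {i. i < n \<and> F \<in> alive n x i t}"
  define U where "U = {i. i < n \<and> F \<in> outside n x K i t}"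
  define C where "C = {\<lfloor>- (K / l)\<rfloor>..\<lfloor>K / l\<rfloor>}"
  have UA: "U \<subseteq> A" by (auto simp: A_def U_def outside_def)
  have fin: "finite A" "finite U" by (auto simp: A_def U_def)
  have inA: "\<bar>?y i\<bar> \<le> K" if "i \<in> A - U" for i
    using that by (auto simp: A_def U_def outside_def)
  have cell: "(\<Sum>i\<in>A - U. ?w i) \<le> (1 - hit_prob / 2) * card (A - U) + hit_prob / 2 * card C"
  proof (rule sum_pairing_bound[where c = "\<lambda>i. \<lfloor>?y i / l\<rfloor>"])
    show "(\<lambda>i. \<lfloor>?y i / l\<rfloor>) ` (A - U) \<subseteq> C"
    proof
      fix k assume "k \<in> (\<lambda>i. \<lfloor>?y i / l\<rfloor>) ` (A - U)"
      then obtain i where i: "i \<in> A - U" "k = \<lfloor>?y i / l\<rfloor>" by blast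
      have y: "- K \<le> ?y i" "?y i \<le> K" using inA[OF i(1)] by auto
      have "- K / l \<le> ?y i / l" using l by (intro divide_right_mono y) simp
      moreover have "?y i / l \<le> K / l" using l by (intro divide_right_mono y) simp
      ultimately show "k \<in> C" using i(2) by (simp add: C_def floor_mono)
    qed
    fix i j assume ij: "i \<in> A - U" "j \<in> A - U" "i \<noteq> j" "\<lfloor>?y i / l\<rfloor> = \<lfloor>?y j / l\<rfloor>"
    have "\<bar>?y i / l - ?y j / l\<bar> \<le> 1" using ij(4) by linarith
    then have "\<bar>(?y i - ?y j) / l\<bar> \<le> 1" by (simp add: diff_divide_distrib)
    then have "\<bar>?y i - ?y j\<bar> \<le> l" using l by (simp add: abs_divide)
    then show "?w i + ?w j \<le> 2 - hit_prob"
      using ij t h l sc F by (intro section_pair) (auto simp: A_def)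
  qed (use fin hit_prob_bounds section_prob_le_1 in \<open>auto simp: C_def\<close>)
  have cardC: "real (card C) \<le> 2 * K / l + 2"
  proof -
    have "real (card C) \<le> max 0 (real_of_int (\<lfloor>K / l\<rfloor> - \<lfloor>- (K / l)\<rfloor> + 1))" by (simp add: C_def)
    moreover have "0 \<le> K / l" using K l by simp
    ultimately have "real (card C) \<le> 2 * (K / l) + 2" by linarith
    then show ?thesis by simp
  qed
  have "(\<Sum>i<n. ?w i) = (\<Sum>i\<in>A. ?w i)"
  proof (intro sum.mono_neutral_right ballI)
    fix i assume "i \<in> {..<n} - A"
    then show "?w i = 0" using t h F by (intro section_alive_0[where i = i and x = x and h = h]) (auto simp: A_def alive_def)
  qed (auto simp: A_def)
  also have "\<dots> = (\<Sum>i\<in>A - U. ?w i) + (\<Sum>i\<in>U. ?w i)" using fin UA by (metis sum.subset_diff)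
  also have "(\<Sum>i\<in>U. ?w i) \<le> (\<Sum>i\<in>U. 1)" by (intro sum_mono section_prob_le_1)
  also have "(\<Sum>i\<in>A - U. ?w i) \<le> (1 - hit_prob / 2) * card (A - U) + hit_prob / 2 * (2 * K / l + 2)"
    using cell cardC hit_prob_bounds by (smt (verit) mult_left_mono divide_nonneg_nonneg)
  also have "real (card (A - U)) = real (card A) - real (card U)"
    using fin UA by (simp add: card_Diff_subset card_mono of_nat_diff)
  finally have "(\<Sum>i<n. ?w i) \<le> (1 - hit_prob / 2) * card A + hit_prob / 2 * card U + hit_prob / 2 * (2 * K / l + 2)"
    by (simp add: algebra_simps)
  moreover have "(\<Sum>i<n. indicator (alive n x i t) F) = real (card A)"
    by (simp add: A_def indicator_def sum.If_cases Collect_conj_eq lessThan_def)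
  moreover have "(\<Sum>i<n. indicator (outside n x K i t) F) = real (card U)"
    by (simp add: U_def indicator_def sum.If_cases Collect_conj_eq lessThan_def)
  ultimately show ?thesis by (simp only: sum.distrib sum_distrib_left[symmetric])
qed

lemma expected_alive_step:
  assumes t: "0 \<le> t" "t \<in> \<rat>" and h: "0 < h" "h \<in> \<rat>" and K: "0 \<le> K"
    and l: "0 < l" and sc: "small_scale l h"
  shows "expected_alive n x (t + h) \<le> (1 - hit_prob / 2) * expected_alive n x t + hit_prob / 2 * (2 * K / l + 2 + expected_outside n x K t)"
proof -
  interpret S: prob_space "sys n" by (rule prob_space_sys)
  have th: "0 \<le> t + h" using t h by simp
  have iA: "integrable (sys n) (indicator (alive n x i t) :: _ \<Rightarrow> real)" if "i < n" for i
    using alive_sets[OF that] by (intro S.integrable_const_bound[where B = 1]) (auto simp: indicator_def)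
  have iO: "integrable (sys n) (indicator (outside n x K i t) :: _ \<Rightarrow> real)" if "i < n" for i
    using outside_sets[OF that t(1)] by (intro S.integrable_const_bound[where B = 1]) (auto simp: indicator_def)
  have sp: "integrable (sys n) (section_prob n t (alive n x i (t + h)))" if "i < n" for i
    unfolding section_prob_def by (rule sys_markov_prob(2)[OF t(1) alive_sets[OF that]])
  have iR: "integrable (sys n) (\<lambda>F. \<Sum>i<n. (1 - hit_prob / 2) * indicator (alive n x i t) F + hit_prob / 2 * indicator (outside n x K i t) F)"
    using iA iO by (intro Bochner_Integration.integrable_sum Bochner_Integration.integrable_add integrable_mult_right) auto
  have "expected_alive n x (t + h) = (\<Sum>i<n. \<integral>F. section_prob n t (alive n x i (t + h)) F \<partial>sys n)"
    unfolding expected_alive_def section_prob_def by (intro sum.cong refl sys_markov_prob(1)[OF t(1)] alive_sets) auto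
  also have "\<dots> = (\<integral>F. (\<Sum>i<n. section_prob n t (alive n x i (t + h)) F) \<partial>sys n)"
    using sp by (subst Bochner_Integration.integral_sum) auto
  also have "\<dots> \<le> (\<integral>F. (\<Sum>i<n. (1 - hit_prob / 2) * indicator (alive n x i t) F + hit_prob / 2 * indicator (outside n x K i t) F) + hit_prob / 2 * (2 * K / l + 2) \<partial>sys n)"
  proof (rule integral_mono)
    show "integrable (sys n) (\<lambda>F. \<Sum>i<n. section_prob n t (alive n x i (t + h)) F)"
      using sp by (intro Bochner_Integration.integrable_sum) auto
    show "integrable (sys n) (\<lambda>F. (\<Sum>i<n. (1 - hit_prob / 2) * indicator (alive n x i t) F + hit_prob / 2 * indicator (outside n x K i t) F) + hit_prob / 2 * (2 * K / l + 2))"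
      by (rule Bochner_Integration.integrable_add[OF iR]) simp
  qed (rule section_alive_sum[OF t h K l sc])
  also have "\<dots> = (\<integral>F. (\<Sum>i<n. (1 - hit_prob / 2) * indicator (alive n x i t) F + hit_prob / 2 * indicator (outside n x K i t) F) \<partial>sys n) + hit_prob / 2 * (2 * K / l + 2)"
    using iR S.prob_space by (subst Bochner_Integration.integral_add) auto
  also have "(\<integral>F. (\<Sum>i<n. (1 - hit_prob / 2) * indicator (alive n x i t) F + hit_prob / 2 * indicator (outside n x K i t) F) \<partial>sys n)
    = (\<Sum>i<n. (1 - hit_prob / 2) * measure (sys n) (alive n x i t) + hit_prob / 2 * measure (sys n) (outside n x K i t))"
  proof -
    have "(\<integral>F. (1 - hit_prob / 2) * indicator (alive n x i t) F + hit_prob / 2 * indicator (outside n x K i t) F \<partial>sys n) =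
      (1 - hit_prob / 2) * measure (sys n) (alive n x i t) + hit_prob / 2 * measure (sys n) (outside n x K i t)" if "i < n" for i
      using iA[OF that] iO[OF that] alive_sets[OF that, of x t] outside_sets[OF that t(1), of x K]
      by (subst Bochner_Integration.integral_add) (auto simp: Int_absorb2 sets.sets_into_space)
    then show ?thesis
      using iA iO by (subst Bochner_Integration.integral_sum) (auto intro!: Bochner_Integration.integrable_add)
  qed
  also have "\<dots> = (1 - hit_prob / 2) * expected_alive n x t + hit_prob / 2 * expected_outside n x K t"
    unfolding expected_alive_def expected_outside_def by (simp only: sum.distrib sum_distrib_left)
  finally show ?thesis by (simp only: distrib_left add.assoc add.commute add.left_commute)
qed

lemma expected_outside_step:
  assumes t: "0 \<le> t" and h: "0 < h" and d: "0 < d" and K: "1 \<le> K"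
  shows "expected_outside n x (K + d) (t + h) \<le> expected_outside n x K t + tail_const * h * d powr (-\<alpha>) * expected_alive n x t"
proof -
  interpret S: prob_space "sys n" by (rule prob_space_sys)
  have th: "0 \<le> t + h" using t h by simp
  let ?C = "tail_const * h * d powr (-\<alpha>)"
  have C: "0 \<le> ?C" using tail_const_nonneg h by simp
  have "measure (sys n) (outside n x (K + d) i (t + h)) \<le> measure (sys n) (outside n x K i t) + ?C * measure (sys n) (alive n x i t)"
    if i: "i < n" for i
  proof -
    have iA: "integrable (sys n) (indicator (alive n x i t) :: _ \<Rightarrow> real)"
      using alive_sets[OF i] by (intro S.integrable_const_bound[where B = 1]) (auto simp: indicator_def)
    have iO: "integrable (sys n) (indicator (outside n x K i t) :: _ \<Rightarrow> real)"
      using outside_sets[OF i t(1)] by (intro S.integrable_const_bound[where B = 1]) (auto simp: indicator_def)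
    have iR: "integrable (sys n) (\<lambda>F. indicator (outside n x K i t) F + ?C * indicator (alive n x i t) F)"
      using iA iO by (intro Bochner_Integration.integrable_add integrable_mult_right)
    note S = outside_sets[OF i th, of x "K + d"]
    have "measure (sys n) (outside n x (K + d) i (t + h)) = (\<integral>F. section_prob n t (outside n x (K + d) i (t + h)) F \<partial>sys n)"
      unfolding section_prob_def by (rule sys_markov_prob(1)[OF t S])
    also have "\<dots> \<le> (\<integral>F. indicator (outside n x K i t) F + ?C * indicator (alive n x i t) F \<partial>sys n)"
    proof (rule integral_mono[OF _ iR])
      show "integrable (sys n) (section_prob n t (outside n x (K + d) i (t + h)))"
        unfolding section_prob_def by (rule sys_markov_prob(2)[OF t S])
      fix F assume F: "F \<in> space (sys n)"
      show "section_prob n t (outside n x (K + d) i (t + h)) F \<le> indicator (outside n x K i t) F + ?C * indicator (alive n x i t) F"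
      proof (cases "F \<in> alive n x i t")
        case False
        then have "section_prob n t (outside n x (K + d) i (t + h)) F = 0"
          using i t h F by (intro section_alive_0[where i = i and x = x and h = h]) (auto simp: alive_def outside_def)
        then show ?thesis using C by simp
      next
        case True
        show ?thesis
        proof (cases "F \<in> outside n x K i t")
          case True
          then show ?thesis using section_prob_le_1[of n t "outside n x (K + d) i (t + h)" F] C
            by (simp add: indicator_def)
        next
          case False
          then have y: "\<bar>r (x i + F i t)\<bar> \<le> K" using True by (auto simp: outside_def)
          have [measurable]: "(\<lambda>G. G i h) \<in> borel_measurable (sys n)" using i h by auto
          have "{G \<in> space (sys n). glues n t F G \<in> outside n x (K + d) i (t + h)} \<subseteq> {G \<in> space (sys n). d \<le> \<bar>G i h\<bar>}"
          proof safe
            fix G assume "glues n t F G \<in> outside n x (K + d) i (t + h)"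
            then have "K + d < \<bar>r ((x i + F i t) + G i h)\<bar>"
              using i t h by (simp add: outside_def glues_nth add.assoc)
            also have "\<dots> \<le> max 1 (\<bar>r (x i + F i t)\<bar> + \<bar>G i h\<bar>)" by (rule r_bound)
            finally show "d \<le> \<bar>G i h\<bar>" using y K d by linarith
          qed
          then have "section_prob n t (outside n x (K + d) i (t + h)) F \<le> measure (sys n) {G \<in> space (sys n). d \<le> \<bar>G i h\<bar>}"
            unfolding section_prob_def by (intro S.finite_measure_mono) auto
          also have "\<dots> \<le> ?C" using i h d by (intro sys_tail) auto
          finally show ?thesis using True False by simp
        qed
      qed
    qed
    also have "\<dots> = measure (sys n) (outside n x K i t) + ?C * measure (sys n) (alive n x i t)"
      using iA iO alive_sets[OF i, of x t] outside_sets[OF i t, of x K]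
      by (subst Bochner_Integration.integral_add) (auto simp: Int_absorb2 sets.sets_into_space)
    finally show ?thesis .
  qed
  then have "expected_outside n x (K + d) (t + h) \<le> (\<Sum>i<n. measure (sys n) (outside n x K i t) + ?C * measure (sys n) (alive n x i t))"
    unfolding expected_outside_def by (intro sum_mono) auto
  then show ?thesis by (simp add: expected_outside_def expected_alive_def sum.distrib sum_distrib_left)
qed

lemma expected_alive_antimono: "t \<le> t' \<Longrightarrow> expected_alive n x t' \<le> expected_alive n x t"
proof -
  interpret S: prob_space "sys n" by (rule prob_space_sys)
  show "t \<le> t' \<Longrightarrow> expected_alive n x t' \<le> expected_alive n x t"
    unfolding expected_alive_def using dead_mono alive_sets
    by (intro sum_mono S.finite_measure_mono) (auto simp: alive_def)
qed

lemma expected_outside_start: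
  assumes x: "\<And>i. i < n \<Longrightarrow> \<bar>r (x i)\<bar> \<le> K"
  shows "expected_outside n x K 0 = 0"
proof -
  interpret S: prob_space "sys n" by (rule prob_space_sys)
  have "measure (sys n) (outside n x K i 0) = 0" if i: "i < n" for i
  proof -
    have "measure (sys n) {F \<in> space (sys n). F i 0 \<in> - {0}} = measure (distr W borel (\<lambda>f. f 0)) (- {0})"
      using i by (intro sys_component_prob) auto
    also have "\<dots> = prob ((\<lambda>f. f 0) -` (- {0}) \<inter> space W)"
      by (subst measure_distr) auto
    also have "\<dots> = 0"
    proof -
      have "AE f in W. f \<notin> (\<lambda>f. f 0) -` (- {0}) \<inter> space W" using start0 by auto
      then show ?thesis by (subst prob_eq_0) auto
    qed
    finally have z: "measure (sys n) {F \<in> space (sys n). F i 0 \<in> - {0}} = 0" .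
    have [measurable]: "(\<lambda>F. F i 0) \<in> borel_measurable (sys n)" using i by auto
    have "measure (sys n) (outside n x K i 0) \<le> measure (sys n) {F \<in> space (sys n). F i 0 \<in> - {0}}"
      using x[OF i] by (intro S.finite_measure_mono) (auto simp: outside_def alive_def)
    then show ?thesis using z by (simp add: measure_le_0_iff)
  qed
  then show ?thesis by (simp add: expected_outside_def)
qed

text \<open>The bound \<open>B\<close> depends on the window that contains the starting points, but neither on their
number nor on their positions.\<close>

lemma expected_alive_bounded:
  assumes K0: "1 \<le> K" and s: "0 < s"
  shows "\<exists>B. \<forall>n x. (\<forall>i<n. \<bar>r (x i)\<bar> \<le> K) \<longrightarrow> expected_alive n x s \<le> B"
proof -
  define \<tau> where "\<tau> = (2 * stable_moment \<alpha> 2 / stable_moment \<alpha> 0 + 1) powr (\<alpha> / 2) / c"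
  have G0: "0 < stable_moment \<alpha> 0" using stable_moment_pos alpha by simp
  have G: "0 < 2 * stable_moment \<alpha> 2 / stable_moment \<alpha> 0 + 1"
    using G0 stable_moment_nonneg[of \<alpha> 2] by (intro add_nonneg_pos divide_nonneg_pos) auto
  have tau: "0 < \<tau>" using c G by (simp add: \<tau>_def)
  have sc: "small_scale l h" if l: "0 < l" and h: "\<tau> * l powr \<alpha> \<le> h" for l h
  proof -
    have "(2 * stable_moment \<alpha> 2 / stable_moment \<alpha> 0 + 1) * l\<^sup>2 = (c * (\<tau> * l powr \<alpha>)) powr (2 / \<alpha>)"
      using c alpha G l by (simp add: \<tau>_def powr_mult powr_powr powr_numeral)
    also have "\<dots> \<le> (c * h) powr (2 / \<alpha>)"
      using c tau l h alpha by (intro powr_mono2 mult_left_mono) auto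
    finally have "stable_moment \<alpha> 0 * ((2 * stable_moment \<alpha> 2 / stable_moment \<alpha> 0 + 1) * l\<^sup>2) \<le> stable_moment \<alpha> 0 * (c * h) powr (2 / \<alpha>)"
      using G0 by (intro mult_left_mono) auto
    moreover have "stable_moment \<alpha> 0 * ((2 * stable_moment \<alpha> 2 / stable_moment \<alpha> 0 + 1) * l\<^sup>2) = 2 * l\<^sup>2 * stable_moment \<alpha> 2 + stable_moment \<alpha> 0 * l\<^sup>2"
      using G0 by (simp add: field_simps)
    moreover have "0 \<le> stable_moment \<alpha> 0 * l\<^sup>2" using G0 by simp
    ultimately show ?thesis unfolding small_scale_def by linarith
  qed
  have q: "0 < 1 - hit_prob / 2" "1 - hit_prob / 2 < 1" using hit_prob_bounds by auto
  have K00: "0 \<le> K" using K0 by simp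
  obtain B where B: "\<forall>(a :: real \<Rightarrow> real) (b :: real \<Rightarrow> real \<Rightarrow> real).
    (\<forall>l t h K'. 0 < l \<longrightarrow> t \<in> \<rat> \<longrightarrow> h \<in> \<rat> \<longrightarrow> 0 \<le> t \<longrightarrow> \<tau> * l powr \<alpha> \<le> h \<longrightarrow> K \<le> K' \<longrightarrow>
        a (t + h) \<le> (1 - hit_prob / 2) * a t + (1 - (1 - hit_prob / 2)) * (2 * K' / l + 2 + b K' t)) \<longrightarrow>
    (\<forall>t h d K'. t \<in> \<rat> \<longrightarrow> h \<in> \<rat> \<longrightarrow> 0 \<le> t \<longrightarrow> 0 < h \<longrightarrow> 0 < d \<longrightarrow> K \<le> K' \<longrightarrow>
        b (K' + d) (t + h) \<le> b K' t + tail_const * h * d powr (-\<alpha>) * a t) \<longrightarrow>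
    (\<forall>t t'. 0 \<le> t \<longrightarrow> t \<le> t' \<longrightarrow> a t' \<le> a t) \<longrightarrow> b K 0 \<le> 0 \<longrightarrow> a s \<le> B"
    using instantaneous_bound[OF alpha(1) q tau tail_const_nonneg K00 s] by blast
  show ?thesis
  proof (intro exI[of _ B] allI impI)
    fix n :: nat and x :: "nat \<Rightarrow> real" assume x: "\<forall>i<n. \<bar>r (x i)\<bar> \<le> K"
    show "expected_alive n x s \<le> B"
    proof (rule B[rule_format, of "expected_alive n x" "expected_outside n x"])
      fix l t h K' :: real
      assume H: "0 < l" "t \<in> \<rat>" "h \<in> \<rat>" "0 \<le> t" "\<tau> * l powr \<alpha> \<le> h" "K \<le> K'"
      have "0 < \<tau> * l powr \<alpha>" using tau H(1) by simp
      then have "0 < h" using H(5) by linarith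
      then have "expected_alive n x (t + h) \<le> (1 - hit_prob / 2) * expected_alive n x t + hit_prob / 2 * (2 * K' / l + 2 + expected_outside n x K' t)"
        using H K0 by (intro expected_alive_step sc) auto
      then show "expected_alive n x (t + h) \<le> (1 - hit_prob / 2) * expected_alive n x t + (1 - (1 - hit_prob / 2)) * (2 * K' / l + 2 + expected_outside n x K' t)"
        by simp
    next
      fix t h d K' :: real
      assume "t \<in> \<rat>" "h \<in> \<rat>" "0 \<le> t" "0 < h" "0 < d" "K \<le> K'"
      then show "expected_outside n x (K' + d) (t + h) \<le> expected_outside n x K' t + tail_const * h * d powr (-\<alpha>) * expected_alive n x t"
        using K0 by (intro expected_outside_step) auto
    next
      fix t t' :: real assume "t \<le> t'"
      then show "expected_alive n x t' \<le> expected_alive n x t" by (rule expected_alive_antimono)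
    next
      show "expected_outside n x K 0 \<le> 0" using expected_outside_start[of n x K] x by simp
    qed
  qed
qed

end

section \<open>From free systems to coalescing processes\<close>

lemma jumps_off_coincidence_measurable:
  fixes D :: "'w \<Rightarrow> real \<Rightarrow> real"
  assumes D: "\<And>u. 0 \<le> u \<Longrightarrow> (\<lambda>\<omega>. D \<omega> u) \<in> borel_measurable M"
  shows "{\<omega> \<in> space M. jumps_off_coincidence (D \<omega>) T} \<in> sets M"
proof -
  have [measurable]: "(\<lambda>\<omega>. D \<omega> (real k / real m)) \<in> borel_measurable M" for k m :: nat
    by (rule D) simp
  have J: "{\<omega> \<in> space M. separates_on_grid (D \<omega>) T d e m} \<in> sets M" for d e m
  proof -
    have "{\<omega> \<in> space M. separates_on_grid (D \<omega>) T d e m} =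
      (\<Union>k\<in>{..<T * m}. {\<omega> \<in> space M. D \<omega> (real k / real m) < 1 / Suc e \<and> D \<omega> (real (Suc k) / real m) > 1 / Suc d})"
      by (auto simp: separates_on_grid_def)
    also have "\<dots> \<in> sets M" by (rule sets.finite_UN) (measurable)
    finally show ?thesis .
  qed
  have "{\<omega> \<in> space M. \<forall>m\<in>{m0..}. separates_on_grid (D \<omega>) T d e m} \<in> sets M" for m0 d e
    using J by (intro sets.sets_Collect_countable_Ball) auto
  then have "{\<omega> \<in> space M. \<exists>d. \<forall>e. \<exists>m0. \<forall>m\<in>{m0..}. separates_on_grid (D \<omega>) T d e m} \<in> sets M"
    by (intro sets.sets_Collect_countable_Ex sets.sets_Collect_countable_All)
  then show ?thesis by (simp add: jumps_off_coincidence_def)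
qed

lemma jumps_off_coincidence_cong:
  assumes "\<And>u. 0 \<le> u \<Longrightarrow> D u = D' u"
  shows "jumps_off_coincidence D T \<longleftrightarrow> jumps_off_coincidence D' T"
proof -
  have "separates_on_grid D T d e m \<longleftrightarrow> separates_on_grid D' T d e m" for d e m
    using assms by (simp add: separates_on_grid_def)
  then show ?thesis by (simp add: jumps_off_coincidence_def)
qed

text \<open>The deterministic part of the argument: every \<open>coalesced f i t\<close> is the position of a particle that
survives beyond some fixed rational time \<open>s < t\<close>, and there are only finitely many of these.\<close>

lemma finite_coalesced:
  fixes f :: "nat \<Rightarrow> real \<Rightarrow> 'e::metric_space"
  assumes cl: "\<And>k. cadlag_in E (f k)"
    and nb: "\<And>i j T. i \<noteq> j \<Longrightarrow> \<not> jumps_off_coincidence (\<lambda>u. dist (f i u) (f j u)) T"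
    and ev: "\<And>s. s \<in> \<rat> \<Longrightarrow> 0 < s \<Longrightarrow> \<exists>N. \<forall>j\<ge>N. dead f j s"
    and t: "0 < t"
  shows "finite (range (\<lambda>i. coalesced f i t))"
proof -
  have rc: "(f k \<longlongrightarrow> f k s) (at_right s)" if "0 \<le> s" for k s
    using cl[of k] that by (simp add: cadlag_in_def)
  have ll: "\<exists>l. (f k \<longlongrightarrow> l) (at_left s)" if "0 < s" for k s
    using cl[of k] that by (auto simp: cadlag_in_def)
  have good: "\<exists>u. 0 \<le> u \<and> u \<le> q \<and> f i u = f j u" if "i \<noteq> j" "q \<in> \<rat>" "0 \<le> q" "near f i j q" for i j q
  proof (rule ccontr)
    assume "\<not> ?thesis"
    then have no: "f i u \<noteq> f j u" if "0 \<le> u" "u \<le> q" for u using that by blast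
    obtain T :: nat where T: "q \<le> real T" using real_arch_simple by blast
    have "jumps_off_coincidence (\<lambda>u. dist (f i u) (f j u)) T"
      using near_without_meeting_jumps[of f i j q T, OF rc ll \<open>near f i j q\<close> no T]
      unfolding jumps_off_coincidence_def separates_on_grid_def by (simp add: Ball_def Bex_def)
    with nb[OF \<open>i \<noteq> j\<close>] show False by blast
  qed
  obtain s where s: "s \<in> \<rat>" "0 < s" "s < t" using Rats_dense_in_real[OF t] by blast
  obtain N where N: "\<And>j. j \<ge> N \<Longrightarrow> dead f j s" using ev[OF s(1,2)] by blast
  have "range (\<lambda>i. coalesced f i t) \<subseteq> (\<lambda>j. f j t) ` {..<N}"
  proof safe
    fix i
    obtain j where j: "ereal t < meet_time (f j) (coalesced f) j" "coalesced f i t = f j t"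
      using coalesced_is_free_path[of f i t, OF rc] by blast
    have "\<not> meet_time (f j) (coalesced f) j \<le> ereal s"
      using j(1) s(3) by (meson ereal_less_eq(3) leD le_less_trans less_imp_le)
    then have "\<not> dead f j s"
      using dead_iff_meet_time[of f s j, OF rc good] s by auto
    then have "j < N" using N not_less by blast
    then show "coalesced f i t \<in> (\<lambda>j. f j t) ` {..<N}" using j(2) by auto
  qed
  then show ?thesis by (rule finite_subset) simp
qed

context projected_stable_law begin

text \<open>The path in the state space with lift \<open>z + f\<close>, its law, and the joint path of \<open>n\<close> particles.\<close>

definition proj_path :: "real \<Rightarrow> (real \<Rightarrow> real) \<Rightarrow> real \<Rightarrow> 'e" where
  "proj_path z f = (\<lambda>u\<in>{0..}. \<pi> (z + f u))"

lemma proj_path_measurable: "proj_path z \<in> W \<rightarrow>\<^sub>M path_space"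
  unfolding path_space_def proj_path_def
proof (rule measurable_restrict)
  fix u :: real assume "u \<in> {0..}"
  then have "(\<lambda>f. f u) \<in> borel_measurable W" by simp
  then have "(\<lambda>f. z + f u) \<in> borel_measurable W" by simp
  then show "(\<lambda>f. \<pi> (z + f u)) \<in> borel_measurable W" by (rule measurable_compose) (rule pi_measurable)
qed

definition start_law :: "real \<Rightarrow> (real \<Rightarrow> 'e) measure" where
  "start_law z = distr W path_space (proj_path z)"

definition joint_path :: "nat \<Rightarrow> (nat \<Rightarrow> real) \<Rightarrow> (nat \<Rightarrow> real \<Rightarrow> real) \<Rightarrow> nat \<Rightarrow> real \<Rightarrow> 'e" where
  "joint_path n x F = (\<lambda>i\<in>{..<n}. proj_path (x i) (F i))"

lemma joint_path_measurable: "joint_path n x \<in> sys n \<rightarrow>\<^sub>M PiM {..<n} (\<lambda>_. path_space)"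
  unfolding joint_path_def
proof (rule measurable_restrict)
  fix i assume "i \<in> {..<n}"
  then have "(\<lambda>F. F i) \<in> sys n \<rightarrow>\<^sub>M W" unfolding sys_def by (rule measurable_component_singleton)
  then show "(\<lambda>F. proj_path (x i) (F i)) \<in> sys n \<rightarrow>\<^sub>M path_space"
    by (rule measurable_compose) (rule proj_path_measurable)
qed

lemma joint_law: "distr (sys n) (PiM {..<n} (\<lambda>_. path_space)) (joint_path n x) = PiM {..<n} (\<lambda>i. start_law (x i))"
proof -
  interpret P: product_prob_space "\<lambda>_::nat. W"
    by (rule product_prob_spaceI) (rule prob_space_axioms)
  interpret Q: product_prob_space "\<lambda>i. start_law (x i)"
    unfolding start_law_def by (intro product_prob_spaceI prob_space_distr proj_path_measurable)
  have S: "sets (start_law z) = sets path_space" for z by (simp add: start_law_def)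
  show ?thesis
  proof (rule Q.PiM_eqI)
    show "sets (distr (sys n) (PiM {..<n} (\<lambda>_. path_space)) (joint_path n x)) = sets (PiM {..<n} (\<lambda>i. start_law (x i)))"
      using S by (simp cong: sets_PiM_cong)
    fix A assume A: "\<And>i. i \<in> {..<n} \<Longrightarrow> A i \<in> sets (start_law (x i))"
    have A': "A i \<in> sets path_space" if "i \<in> {..<n}" for i using A[OF that] S by simp
    have "emeasure (distr (sys n) (PiM {..<n} (\<lambda>_. path_space)) (joint_path n x)) (Pi\<^sub>E {..<n} A) =
      emeasure (sys n) (joint_path n x -` Pi\<^sub>E {..<n} A \<inter> space (sys n))"
      using A' by (intro emeasure_distr joint_path_measurable sets_PiM_I_finite) auto
    also have "joint_path n x -` Pi\<^sub>E {..<n} A \<inter> space (sys n) = Pi\<^sub>E {..<n} (\<lambda>i. proj_path (x i) -` A i \<inter> space W)"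
      by (auto simp: sys_def space_PiM joint_path_def PiE_iff)
    also have "emeasure (sys n) \<dots> = (\<Prod>i<n. emeasure W (proj_path (x i) -` A i \<inter> space W))"
      unfolding sys_def using A' by (intro P.emeasure_PiM measurable_sets[OF proj_path_measurable]) auto
    also have "\<dots> = (\<Prod>i<n. emeasure (start_law (x i)) (A i))"
      unfolding start_law_def using A' by (intro prod.cong refl emeasure_distr[symmetric] proj_path_measurable) auto
    finally show "emeasure (distr (sys n) (PiM {..<n} (\<lambda>_. path_space)) (joint_path n x)) (Pi\<^sub>E {..<n} A) = (\<Prod>i\<in>{..<n}. emeasure (start_law (x i)) (A i))" .
  qed simp
qed

lemma joint_path_nth: "i < n \<Longrightarrow> 0 \<le> u \<Longrightarrow> joint_path n x F i u = proj x F i u"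
  by (simp add: joint_path_def proj_path_def proj_def)

text \<open>The events of survival and of jumping off a coincidence depend on finitely many particles and on
countably many times, so their probabilities can be computed in the free system of lifts although
the particles themselves come without lifts.\<close>

lemma independent_copies_finite:
  assumes cop: "independent_copies M E P UNIV y \<xi>"
    and P: "\<And>i. P (y i) = start_law (x i)" and K: "\<And>i. \<bar>r (x i)\<bar> \<le> K"
  shows "AE \<omega> in M. \<forall>t>0. finite (range (\<lambda>i. coalesced (\<lambda>j s. \<xi> j s \<omega>) i t))"
proof -
  interpret M: prob_space M using cop by (simp add: independent_copies_def)
  have indep: "M.indep_vars (\<lambda>_. path_space) (\<lambda>i. path_of (\<xi> i)) UNIV"
    and law: "\<And>i. path_law M (\<xi> i) = P (y i)"
    and cl: "\<And>i. AE \<omega> in M. cadlag_in E (\<lambda>t. \<xi> i t \<omega>)"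
    using cop by (auto simp: independent_copies_def)
  have pm: "path_of (\<xi> i) \<in> M \<rightarrow>\<^sub>M path_space" for i
    using indep by (simp add: M.indep_vars_def)
  have xm: "(\<lambda>\<omega>. \<xi> i u \<omega>) \<in> borel_measurable M" if "0 \<le> u" for i u
  proof -
    have c: "(\<lambda>f. f u) \<in> path_space \<rightarrow>\<^sub>M (borel :: 'e measure)"
      unfolding path_space_def by (rule measurable_component_singleton) (simp add: that)
    have "(\<lambda>\<omega>. path_of (\<xi> i) \<omega> u) \<in> borel_measurable M"
      by (rule measurable_compose[OF pm c])
    then show ?thesis using that by (simp add: path_of_def)
  qed
  define J where "J n \<omega> = (\<lambda>i\<in>{..<n}. path_of (\<xi> i) \<omega>)" for n :: nat and \<omega>
  let ?Pn = "\<lambda>n. PiM {..<n} (\<lambda>_. path_space :: (real \<Rightarrow> 'e) measure)"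
  have Jm: "J n \<in> M \<rightarrow>\<^sub>M ?Pn n" for n
    unfolding J_def by (rule measurable_restrict) (rule pm)
  have Jlaw: "distr M (?Pn n) (J n) = distr (sys n) (?Pn n) (joint_path n x)" if "0 < n" for n
  proof -
    have "M.indep_vars (\<lambda>_. path_space) (\<lambda>i. path_of (\<xi> i)) {..<n}"
      by (rule M.indep_vars_subset[OF indep]) simp
    then have "distr M (?Pn n) (J n) = PiM {..<n} (\<lambda>i. distr M path_space (path_of (\<xi> i)))"
      unfolding J_def using that pm by (subst (asm) M.indep_vars_iff_distr_eq_PiM') auto
    also have "\<dots> = PiM {..<n} (\<lambda>i. start_law (x i))"
      using law P by (intro PiM_cong) (auto simp: path_law_def)
    finally show ?thesis by (simp add: joint_law)
  qed
  have Jnth: "J n \<omega> i u = \<xi> i u \<omega>" if "i < n" "0 \<le> u" for n \<omega> i u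
    using that by (simp add: J_def path_of_def)
  have coord: "(\<lambda>\<Phi>. \<Phi> i u) \<in> borel_measurable (?Pn n)" if "i < n" "0 \<le> u" for i n u
  proof -
    have a: "(\<lambda>\<Phi>. \<Phi> i) \<in> ?Pn n \<rightarrow>\<^sub>M path_space" by (rule measurable_component_singleton) (simp add: that)
    have c: "(\<lambda>f. f u) \<in> path_space \<rightarrow>\<^sub>M (borel :: 'e measure)"
      unfolding path_space_def by (rule measurable_component_singleton) (simp add: that)
    show ?thesis by (rule measurable_compose[OF a c])
  qed
  have transfer: "measure M {\<omega> \<in> space M. J n \<omega> \<in> S} = measure (sys n) {F \<in> space (sys n). joint_path n x F \<in> S}"
    if "0 < n" "S \<in> sets (?Pn n)" for n S
  proof -
    have "measure M {\<omega> \<in> space M. J n \<omega> \<in> S} = measure (distr M (?Pn n) (J n)) S"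
      using that(2) Jm by (subst measure_distr) (auto simp: vimage_def Int_def conj_commute)
    also have "\<dots> = measure (sys n) {F \<in> space (sys n). joint_path n x F \<in> S}"
      unfolding Jlaw[OF that(1)] using that(2) joint_path_measurable
      by (subst measure_distr) (auto simp: vimage_def Int_def conj_commute)
    finally show ?thesis .
  qed
  let ?f = "\<lambda>\<omega> j s. \<xi> j s \<omega>"
  have alive_prob: "measure M {\<omega> \<in> space M. \<not> dead (?f \<omega>) i s} = measure (sys n) (alive n x i s)"
    if i: "i < n" for i n s
  proof -
    let ?S = "space (?Pn n) - {\<Phi> \<in> space (?Pn n). dead \<Phi> i s}"
    have S: "?S \<in> sets (?Pn n)"
      using i by (intro sets.Diff sets.top dead_measurable coord) auto
    have "{\<omega> \<in> space M. J n \<omega> \<in> ?S} = {\<omega> \<in> space M. \<not> dead (?f \<omega>) i s}"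
    proof -
      have "dead (J n \<omega>) i s \<longleftrightarrow> dead (?f \<omega>) i s" for \<omega>
        using i by (intro dead_cong) (simp add: Jnth)
      then show ?thesis using measurable_space[OF Jm[of n]] by auto
    qed
    moreover have "{F \<in> space (sys n). joint_path n x F \<in> ?S} = alive n x i s"
    proof -
      have "dead (joint_path n x F) i s \<longleftrightarrow> dead (proj x F) i s" for F
        using i by (intro dead_cong) (simp add: joint_path_nth)
      then show ?thesis using measurable_space[OF joint_path_measurable[of n x]] by (auto simp: alive_def)
    qed
    ultimately show ?thesis using transfer[OF _ S] i by simp
  qed
  have eventually_dead: "AE \<omega> in M. \<exists>N. \<forall>j\<ge>N. dead (?f \<omega>) j s" if s: "0 < s" for s
  proof -
    define A where "A i = {\<omega> \<in> space M. \<not> dead (?f \<omega>) i s}" for i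
    have A: "A i \<in> sets M" for i
    proof -
      have "space M - {\<omega> \<in> space M. dead (?f \<omega>) i s} \<in> sets M"
        by (intro sets.Diff sets.top dead_measurable xm)
      also have "space M - {\<omega> \<in> space M. dead (?f \<omega>) i s} = A i" by (auto simp: A_def)
      finally show ?thesis .
    qed
    obtain B where B: "\<And>n z. (\<forall>i<n. \<bar>r (z i)\<bar> \<le> max 1 K) \<Longrightarrow> expected_alive n z s \<le> B"
      using expected_alive_bounded[of "max 1 K" s] s by auto
    have "(\<Sum>i<n. measure M (A i)) \<le> B" for n
    proof -
      have "(\<Sum>i<n. measure M (A i)) = expected_alive n x s"
        unfolding expected_alive_def A_def by (intro sum.cong refl alive_prob) simp
      also have "\<dots> \<le> B" using K by (intro B) (auto intro: le_max_iff_disj[THEN iffD2])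
      finally show ?thesis .
    qed
    then have "summable (\<lambda>i. measure M (A i))"
      by (intro summableI_nonneg_bounded) auto
    then have "AE \<omega> in M. eventually (\<lambda>i. \<omega> \<in> space M - A i) sequentially"
      using A by (intro borel_cantelli_AE1) (auto simp: M.emeasure_eq_measure)
    then show ?thesis
      by eventually_elim (auto simp: A_def eventually_sequentially)
  qed
  have no_bad: "AE \<omega> in M. \<not> jumps_off_coincidence (\<lambda>u. dist (\<xi> i u \<omega>) (\<xi> j u \<omega>)) T" if ij: "i \<noteq> j" for i j T
  proof -
    define n where "n = Suc (max i j)"
    have n: "i < n" "j < n" "0 < n" by (auto simp: n_def)
    interpret S: prob_space "sys n" by (rule prob_space_sys)
    let ?S = "{\<Phi> \<in> space (?Pn n). jumps_off_coincidence (\<lambda>u. dist (\<Phi> i u) (\<Phi> j u)) T}"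
    have S: "?S \<in> sets (?Pn n)"
      using n by (intro jumps_off_coincidence_measurable borel_measurable_dist coord)
    have e1: "{\<omega> \<in> space M. J n \<omega> \<in> ?S} = {\<omega> \<in> space M. jumps_off_coincidence (\<lambda>u. dist (\<xi> i u \<omega>) (\<xi> j u \<omega>)) T}"
    proof -
      have "jumps_off_coincidence (\<lambda>u. dist (J n \<omega> i u) (J n \<omega> j u)) T \<longleftrightarrow> jumps_off_coincidence (\<lambda>u. dist (\<xi> i u \<omega>) (\<xi> j u \<omega>)) T" for \<omega>
        using n by (intro jumps_off_coincidence_cong) (simp add: Jnth)
      then show ?thesis using measurable_space[OF Jm[of n]] by auto
    qed
    have e2: "{F \<in> space (sys n). joint_path n x F \<in> ?S} = {F \<in> space (sys n). jumps_off_coincidence (\<lambda>u. dist (proj x F i u) (proj x F j u)) T}"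
    proof -
      have "jumps_off_coincidence (\<lambda>u. dist (joint_path n x F i u) (joint_path n x F j u)) T \<longleftrightarrow> jumps_off_coincidence (\<lambda>u. dist (proj x F i u) (proj x F j u)) T" for F
        using n by (intro jumps_off_coincidence_cong) (simp add: joint_path_nth)
      then show ?thesis using measurable_space[OF joint_path_measurable[of n x]] by auto
    qed
    have m2: "{F \<in> space (sys n). jumps_off_coincidence (\<lambda>u. dist (proj x F i u) (proj x F j u)) T} \<in> sets (sys n)"
      using n by (intro jumps_off_coincidence_measurable borel_measurable_dist proj_measurable)
    have m1: "{\<omega> \<in> space M. jumps_off_coincidence (\<lambda>u. dist (\<xi> i u \<omega>) (\<xi> j u \<omega>)) T} \<in> sets M"
      by (intro jumps_off_coincidence_measurable borel_measurable_dist xm)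
    have "measure (sys n) {F \<in> space (sys n). jumps_off_coincidence (\<lambda>u. dist (proj x F i u) (proj x F j u)) T} = 0"
      using AE_no_jumps_off_coincidence[OF n(1,2) ij, of x T] by (subst S.prob_eq_0[OF m2]) auto
    then have "measure M {\<omega> \<in> space M. jumps_off_coincidence (\<lambda>u. dist (\<xi> i u \<omega>) (\<xi> j u \<omega>)) T} = 0"
      using transfer[OF n(3) S] unfolding e1 e2 by simp
    then show ?thesis
      using M.prob_eq_0[OF m1] AE_space[of M] by (auto elim!: eventually_elim2)
  qed
  have "AE \<omega> in M. \<forall>i. cadlag_in E (?f \<omega> i)" using cl by (simp add: AE_all_countable)
  moreover have "AE \<omega> in M. \<forall>i j T. i \<noteq> j \<longrightarrow> \<not> jumps_off_coincidence (\<lambda>u. dist (\<xi> i u \<omega>) (\<xi> j u \<omega>)) T"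
    using no_bad by (simp add: AE_all_countable)
  moreover have "AE \<omega> in M. \<forall>s\<in>{s\<in>\<rat>. 0 < s}. \<exists>N. \<forall>j\<ge>N. dead (?f \<omega>) j s"
    using eventually_dead by (intro AE_ball_countable') (auto intro: countable_subset[OF _ countable_rat])
  ultimately show ?thesis
  proof eventually_elim
    case (elim \<omega>)
    show ?case
    proof (intro allI impI)
      fix t :: real assume "0 < t"
      then show "finite (range (\<lambda>i. coalesced (?f \<omega>) i t))"
        using elim by (intro finite_coalesced[where E = E]) auto
    qed
  qed
qed

lemma set_coalescing_finite:
  assumes set: "set_coalescing_process M E P Q \<Xi>"
    and start: "\<And>z. z \<in> E \<Longrightarrow> z \<in> Q \<Longrightarrow> \<exists>z'. P z = start_law z' \<and> \<bar>r z'\<bar> \<le> K"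
  shows "AE \<omega> in M. \<forall>t>0. finite (\<Xi> t \<omega>)"
proof -
  from set[unfolded set_coalescing_process_def] obtain I y \<xi> where H:
    "(I = UNIV \<or> (\<exists>n. I = {..<n})) \<and> y ` I \<subseteq> E \<and> (top_of_set E) closure_of (y ` I) = Q \<and>
        independent_copies M E P I y \<xi> \<and>
        (\<forall>\<omega>\<in>space M. \<forall>t\<ge>0. \<Xi> t \<omega> =
           (top_of_set E) closure_of ((\<lambda>i. coalesced (\<lambda>j s. \<xi> j s \<omega>) i t) ` I))"
    by (elim exE)
  have I: "I = UNIV \<or> (\<exists>n. I = {..<n})" and y: "y ` I \<subseteq> E"
    and Q: "(top_of_set E) closure_of (y ` I) = Q" and cop: "independent_copies M E P I y \<xi>"
    using H by simp_all
  have Xi: "\<Xi> t \<omega> = (top_of_set E) closure_of ((\<lambda>i. coalesced (\<lambda>j s. \<xi> j s \<omega>) i t) ` I)"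
    if "\<omega> \<in> space M" "0 \<le> t" for \<omega> t
    using H that by simp
  have fin: "finite ((top_of_set E) closure_of S)" if "finite S" for S
  proof -
    have "(top_of_set E) closure_of S \<subseteq> closure S"
      using closure_of_subtopology_subset[of euclidean E S] by simp
    then show ?thesis using that by (simp add: finite_subset finite_imp_closed)
  qed
  show ?thesis
  proof (cases "I = UNIV")
    case True
    have "y i \<in> Q" for i
      using Q y True closure_of_subset[of "y ` I" "top_of_set E"] by auto
    then have "\<forall>i. \<exists>z'. P (y i) = start_law z' \<and> \<bar>r z'\<bar> \<le> K" using start y True by blast
    then obtain x where x: "\<And>i. P (y i) = start_law (x i)" "\<And>i. \<bar>r (x i)\<bar> \<le> K" by metis
    have "AE \<omega> in M. \<forall>t>0. finite (range (\<lambda>i. coalesced (\<lambda>j s. \<xi> j s \<omega>) i t))"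
      using cop True by (intro independent_copies_finite[where P = P and y = y and x = x and K = K] x) simp
    then show ?thesis using AE_space
      by eventually_elim (use Xi fin True in auto)
  next
    case False
    then have "finite I" using I by auto
    then show ?thesis using Xi fin by (intro AE_I2) auto
  qed
qed

end

section \<open>The line and the circle\<close>

lemma levy_law_path_law:
  assumes "levy_process N X"
  shows "levy_law (path_law N X)"
proof -
  interpret N: prob_space N using assms by (simp add: levy_process_def)
  have Xm [measurable]: "\<And>t. 0 \<le> t \<Longrightarrow> X t \<in> borel_measurable N" and X0: "AE \<omega> in N. X 0 \<omega> = 0"
    and ind: "\<And>s n. 0 \<le> s 0 \<Longrightarrow> mono s \<Longrightarrow> N.indep_vars (\<lambda>_. borel) (\<lambda>k \<omega>. X (s (Suc k)) \<omega> - X (s k) \<omega>) {..<n::nat}"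
    and stat: "\<And>s t. 0 \<le> s \<Longrightarrow> 0 \<le> t \<Longrightarrow> distr N borel (\<lambda>\<omega>. X (s + t) \<omega> - X s \<omega>) = distr N borel (X t)"
    using assms unfolding levy_process_def by blast+
  have p: "path_of X \<in> N \<rightarrow>\<^sub>M path_space" by (rule measurable_path_of[OF Xm])
  have pull: "measure (path_law N X) {f \<in> space (path_law N X). f \<in> S} = measure N {\<omega> \<in> space N. path_of X \<omega> \<in> S}"
    if "S \<in> sets path_space" for S
  proof -
    have "{f \<in> space (path_law N X). f \<in> S} = S"
      using sets.sets_into_space[OF that] by (auto simp: path_law_def)
    then have "measure (path_law N X) {f \<in> space (path_law N X). f \<in> S} = measure (path_law N X) S" by simp
    also have "\<dots> = measure N (path_of X -` S \<inter> space N)"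
      unfolding path_law_def by (rule measure_distr[OF p that])
    also have "path_of X -` S \<inter> space N = {\<omega> \<in> space N. path_of X \<omega> \<in> S}" by auto
    finally show ?thesis .
  qed
  have sp: "space (path_law N X) = space path_space" by (simp add: path_law_def)
  show ?thesis
  proof (intro levy_law.intro levy_law_axioms.intro)
    show "prob_space (path_law N X)"
      unfolding path_law_def by (rule N.prob_space_distr[OF p])
    show "sets (path_law N X) = sets path_space" by (simp add: path_law_def)
    have "AE \<omega> in N. path_of X \<omega> 0 = 0" using X0 by (simp add: path_of_def)
    then show "AE f in path_law N X. f 0 = 0"
      unfolding path_law_def using p by (subst AE_distr_iff) auto
    fix s :: "nat \<Rightarrow> real" and n and B :: "nat \<Rightarrow> real set"
    assume s: "mono s" "0 \<le> s 0" and B: "\<And>k. k < n \<Longrightarrow> B k \<in> sets borel"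
    have s0: "0 \<le> s k" for k using s by (meson le0 monoD order_trans)
    have sd: "0 \<le> s (Suc k) - s k" for k using s(1) by (simp add: mono_iff_le_Suc)
    have one: "measure (path_law N X) {f \<in> space (path_law N X). f (s (Suc k) - s k) \<in> B k} =
      measure N ((\<lambda>\<omega>. X (s (Suc k)) \<omega> - X (s k) \<omega>) -` B k \<inter> space N)" if k: "k < n" for k
    proof -
      let ?S = "{f \<in> space path_space. f (s (Suc k) - s k) \<in> B k}"
      have "?S \<in> sets path_space"
        using measurable_sets[OF measurable_path_coord[OF sd[of k]] B[OF k]] by (simp add: vimage_def Int_def conj_commute)
      then have "measure (path_law N X) {f \<in> space (path_law N X). f \<in> ?S} = measure N {\<omega> \<in> space N. path_of X \<omega> \<in> ?S}" by (rule pull)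
      also have "{\<omega> \<in> space N. path_of X \<omega> \<in> ?S} = X (s (Suc k) - s k) -` B k \<inter> space N"
        using measurable_space[OF p] sd[of k] by (auto simp: path_of_def)
      also have "measure N \<dots> = measure (distr N borel (X (s (Suc k) - s k))) (B k)"
        using B[OF k] sd by (subst measure_distr) auto
      also have "distr N borel (X (s (Suc k) - s k)) = distr N borel (\<lambda>\<omega>. X (s (Suc k)) \<omega> - X (s k) \<omega>)"
        using stat[OF s0[of k] sd[of k]] by simp
      also have "measure \<dots> (B k) = measure N ((\<lambda>\<omega>. X (s (Suc k)) \<omega> - X (s k) \<omega>) -` B k \<inter> space N)"
        using B[OF k] s0 by (subst measure_distr) auto
      finally show ?thesis by (simp add: sp)
    qed
    let ?S = "{f \<in> space path_space. \<forall>k\<in>{..<n}. f (s (Suc k)) - f (s k) \<in> B k}"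
    have S: "?S \<in> sets path_space"
    proof (rule sets.sets_Collect_finite_All)
      fix k assume "k \<in> {..<n}"
      then have [measurable]: "B k \<in> sets borel" using B by simp
      have [measurable]: "(\<lambda>f. f (s (Suc k)) - f (s k)) \<in> borel_measurable (path_space :: (real \<Rightarrow> real) measure)"
        using s0 by (intro borel_measurable_diff measurable_path_coord)
      show "{f \<in> space path_space. f (s (Suc k)) - f (s k) \<in> B k} \<in> sets path_space" by measurable
    qed simp
    have "measure (path_law N X) {f \<in> space (path_law N X). \<forall>k<n. f (s (Suc k)) - f (s k) \<in> B k} =
      measure (path_law N X) {f \<in> space (path_law N X). f \<in> ?S}"
      by (intro arg_cong[where f = "measure (path_law N X)"]) (auto simp: sp)
    also have "\<dots> = measure N {\<omega> \<in> space N. path_of X \<omega> \<in> ?S}" by (rule pull[OF S])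
    also have "{\<omega> \<in> space N. path_of X \<omega> \<in> ?S} = {\<omega> \<in> space N. \<forall>k<n. X (s (Suc k)) \<omega> - X (s k) \<omega> \<in> B k}"
      using measurable_space[OF p] s0 by (auto simp: path_of_def)
    also have "measure N \<dots> = (\<Prod>k<n. measure N ((\<lambda>\<omega>. X (s (Suc k)) \<omega> - X (s k) \<omega>) -` B k \<inter> space N))"
    proof (cases "n = 0")
      case True
      then show ?thesis by (simp add: N.prob_space)
    next
      case False
      then have "{\<omega> \<in> space N. \<forall>k<n. X (s (Suc k)) \<omega> - X (s k) \<omega> \<in> B k} = (\<Inter>k\<in>{..<n}. (\<lambda>\<omega>. X (s (Suc k)) \<omega> - X (s k) \<omega>) -` B k \<inter> space N)"
        by auto
      then show ?thesis using N.indep_varsD_finite[OF ind[OF s(2,1), of n], of B] False B by auto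
    qed
    also have "\<dots> = (\<Prod>k<n. measure (path_law N X) {f \<in> space (path_law N X). f (s (Suc k) - s k) \<in> B k})"
      by (intro prod.cong refl) (simp add: one)
    finally show "measure (path_law N X) {f \<in> space (path_law N X). \<forall>k<n. f (s (Suc k)) - f (s k) \<in> B k} =
      (\<Prod>k<n. measure (path_law N X) {f \<in> space (path_law N X). f (s (Suc k) - s k) \<in> B k})" .
  qed
qed

lemma stable_law_path_law:
  assumes st: "strictly_stable_process N \<alpha> X" and "1 < \<alpha>"
  obtains c \<upsilon> where "stable_law (path_law N X) \<alpha> c \<upsilon>"
proof -
  obtain c \<upsilon> where c: "0 < c" and ch: "\<And>t u. 0 \<le> t \<Longrightarrow> char (distr N borel (X t)) u = exp (- of_real t * stable_exponent \<alpha> c \<upsilon> u)"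
    and lv: "levy_process N X" and al: "\<alpha> \<le> 2"
    using st unfolding strictly_stable_process_def by blast
  interpret L: levy_law "path_law N X" by (rule levy_law_path_law[OF lv])
  have Xm: "\<And>t. 0 \<le> t \<Longrightarrow> X t \<in> borel_measurable N" using lv by (simp add: levy_process_def)
  have "distr (path_law N X) borel (\<lambda>f. f t) = distr N borel (X t)" if "0 \<le> t" for t
  proof -
    have "distr (path_law N X) borel (\<lambda>f. f t) = distr N borel (\<lambda>\<omega>. path_of X \<omega> t)"
      unfolding path_law_def using measurable_path_of[OF Xm] measurable_path_coord[OF that]
      by (subst distr_distr) (auto simp: o_def)
    then show ?thesis using that by (simp add: path_of_def)
  qed
  then have "stable_law (path_law N X) \<alpha> c \<upsilon>"
    using assms c ch al by (intro stable_law.intro stable_law_axioms.intro L.levy_law_axioms) auto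
  then show ?thesis by (rule that)
qed

lemma projection_line: "projection (\<lambda>x::real. x) (\<lambda>x. x)"
proof
  fix e x y :: real assume "dist x y < e"
  then show "\<exists>k::int. \<bar>x - y - k\<bar> < e" by (intro exI[of _ 0]) (simp add: dist_real_def)
qed (auto simp: dist_real_def)

text \<open>A weak form of Jordan's inequality, which suffices to bound the distance of a real number to the
integers by the distance of the corresponding points on the circle.\<close>

lemma two_sin_ge:
  assumes "0 \<le> w" "w \<le> 1 / 2" shows "w \<le> 2 * sin (pi * w)"
proof (cases "w \<le> 1 / 6")
  case True
  have "0 \<le> x \<Longrightarrow> x \<le> w \<Longrightarrow> \<exists>y. ((\<lambda>w. 2 * sin (pi * w) - w) has_real_derivative y) (at x) \<and> 0 \<le> y" for x
  proof -
    assume x: "0 \<le> x" "x \<le> w"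
    have "pi * x \<le> pi * (1 / 6)" using x True by (intro mult_left_mono) auto
    then have "cos (pi / 3) \<le> cos (pi * x)" using x by (intro cos_monotone_0_pi_le) auto
    then have "1 / 2 \<le> cos (pi * x)" by (simp add: cos_60)
    then have "3 * (1 / 2) \<le> pi * cos (pi * x)" using pi_gt3 by (intro mult_mono) auto
    then have "0 \<le> 2 * (cos (pi * x) * pi) - 1" by (simp add: mult.commute)
    moreover have "((\<lambda>w. 2 * sin (pi * w) - w) has_real_derivative 2 * (cos (pi * x) * pi) - 1) (at x)"
      by (auto intro!: derivative_eq_intros)
    ultimately show ?thesis by blast
  qed
  from DERIV_nonneg_imp_nondecreasing[OF assms(1) this] show ?thesis by simp
next
  case False
  have "sin (pi / 6) \<le> sin (pi * w)"
  proof (rule sin_monotone_2pi_le)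
    have "pi * (1 / 6) \<le> pi * w" "pi * w \<le> pi * (1 / 2)" using False assms by (intro mult_left_mono; simp)+
    then show "pi / 6 \<le> pi * w" "pi * w \<le> pi / 2" by simp_all
    show "- (pi / 2) \<le> pi / 6" using pi_gt_zero by linarith
  qed
  then show ?thesis using assms by (simp add: sin_30)
qed

text \<open>The covering of the unit circle by the line.\<close>

definition circle_map :: "real \<Rightarrow> complex" where
  "circle_map x = exp (2 * of_real pi * \<i> * of_real x)"

lemma circle_map_add: "circle_map (x + y) = circle_map x * circle_map y"
  by (simp add: circle_map_def exp_add[symmetric] distrib_left)

lemma norm_circle_map: "norm (circle_map x) = 1"
proof -
  have "2 * of_real pi * \<i> * of_real x = \<i> * complex_of_real (2 * pi * x)" by simp
  then show ?thesis unfolding circle_map_def by (simp only: norm_exp_i_times)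
qed

lemma circle_map_int: "circle_map (of_int k) = 1"
  unfolding circle_map_def using exp_integer_2pi[of "of_int k"] by (simp add: mult_ac)

lemma dist_circle_map: "dist (circle_map x) (circle_map y) = 2 * \<bar>sin (pi * (x - y))\<bar>"
proof -
  have "circle_map x - circle_map y = circle_map y * (circle_map (x - y) - 1)"
    using circle_map_add[of y "x - y"] by (simp add: algebra_simps)
  then have "dist (circle_map x) (circle_map y) = norm (circle_map (x - y) - 1)"
    by (simp add: dist_norm norm_mult norm_circle_map)
  also have "circle_map (x - y) = exp (\<i> * complex_of_real (2 * pi * (x - y)))"
    unfolding circle_map_def by (simp add: mult_ac)
  also have "norm (\<dots> - 1) = 2 * \<bar>sin (2 * pi * (x - y) / 2)\<bar>" by (rule dist_exp_i_1)
  also have "2 * pi * (x - y) / 2 = pi * (x - y)" by simp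
  finally show ?thesis .
qed

lemma projection_circle: "projection circle_map frac"
proof
  fix x y :: real
  have "\<bar>sin (pi * (x - y))\<bar> \<le> \<bar>pi * (x - y)\<bar>" by (rule abs_sin_x_le_abs_x)
  moreover have "pi * \<bar>x - y\<bar> \<le> 7 / 2 * \<bar>x - y\<bar>" using pi_less_4 pi_approx by (intro mult_right_mono) auto
  ultimately show "dist (circle_map x) (circle_map y) \<le> 7 * \<bar>x - y\<bar>"
    unfolding dist_circle_map by (simp add: abs_mult)
next
  fix e x y :: real assume e: "dist (circle_map x) (circle_map y) < e"
  define k where "k = round (x - y)"
  define w where "w = x - y - of_int k"
  have w: "\<bar>w\<bar> \<le> 1 / 2" unfolding w_def k_def using of_int_round_abs_le[of "x - y"] by (simp add: abs_minus_commute)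
  have "circle_map x = circle_map (x - of_int k)"
    using circle_map_add[of "x - of_int k" "of_int k"] by (simp add: circle_map_int)
  then have "dist (circle_map x) (circle_map y) = 2 * \<bar>sin (pi * w)\<bar>"
    using dist_circle_map[of "x - of_int k" y] by (simp add: w_def algebra_simps)
  also have "2 * \<bar>sin (pi * w)\<bar> = \<bar>2 * sin (pi * \<bar>w\<bar>)\<bar>" by (simp add: abs_if)
  also have "\<dots> \<ge> \<bar>w\<bar>" using two_sin_ge[of "\<bar>w\<bar>"] w by linarith
  finally show "\<exists>k::int. \<bar>x - y - k\<bar> < e" using e by (intro exI[of _ k]) (simp add: w_def)
next
  fix x u :: real
  show "circle_map (frac x + u) = circle_map (x + u)"
    using circle_map_add[of "frac x + u" "of_int \<lfloor>x\<rfloor>"] by (simp add: circle_map_int frac_def algebra_simps)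
next
  show "(frac :: real \<Rightarrow> real) \<in> borel_measurable borel"
    unfolding frac_def[abs_def] by (intro borel_measurable_diff borel_measurable_real_floor measurable_ident_sets refl)
next
  fix x d :: real
  show "\<bar>frac (x + d)\<bar> \<le> max 1 (\<bar>frac x\<bar> + \<bar>d\<bar>)"
    using frac_lt_1[of "x + d"] frac_ge_0[of "x + d"] by linarith
qed

lemma path_law_projected:
  fixes \<pi> :: "real \<Rightarrow> 'e::{second_countable_topology, metric_space}"
  assumes "projected_stable_law (path_law N X) \<alpha> c \<upsilon> \<pi> r" and Xm: "\<And>t. 0 \<le> t \<Longrightarrow> X t \<in> borel_measurable N"
  shows "path_law N (\<lambda>t \<omega>. \<pi> (x + X t \<omega>)) = projected_stable_law.start_law (path_law N X) \<pi> x"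
proof -
  interpret P: projected_stable_law "path_law N X" \<alpha> c \<upsilon> \<pi> r by fact
  have p: "path_of X \<in> N \<rightarrow>\<^sub>M path_space" by (rule measurable_path_of[OF Xm])
  have q: "P.proj_path x \<in> path_space \<rightarrow>\<^sub>M path_space"
    using P.proj_path_measurable[of x] P.sets_W by (simp cong: measurable_cong_sets)
  have "P.start_law x = distr N path_space (\<lambda>\<omega>. P.proj_path x (path_of X \<omega>))"
    unfolding P.start_law_def using distr_distr[OF q p] by (simp add: path_law_def o_def)
  also have "(\<lambda>\<omega>. P.proj_path x (path_of X \<omega>)) = path_of (\<lambda>t \<omega>. \<pi> (x + X t \<omega>))"
    by (auto simp: fun_eq_iff path_of_def P.proj_path_def)
  finally show ?thesis by (simp add: path_law_def)
qed

theorem theorem6p1: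
  fixes N :: "'n measure" and X :: "real \<Rightarrow> 'n \<Rightarrow> real" and \<alpha> :: real
    and M\<^sub>R :: "'a measure" and Q\<^sub>R :: "real set" and \<Xi>\<^sub>R :: "real \<Rightarrow> 'a \<Rightarrow> real set"
    and M\<^sub>T :: "'b measure" and Q\<^sub>T :: "complex set" and \<Xi>\<^sub>T :: "real \<Rightarrow> 'b \<Rightarrow> complex set"
  assumes "strictly_stable_process N \<alpha> X" and "\<alpha> > 1"
  shows
    "(set_coalescing_process M\<^sub>R UNIV (line_laws N X) Q\<^sub>R \<Xi>\<^sub>R \<and> compact Q\<^sub>R \<and> Q\<^sub>R \<noteq> {}
        \<longrightarrow> (AE \<omega> in M\<^sub>R. \<forall>t>0. finite (\<Xi>\<^sub>R t \<omega>))) \<and>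
     (set_coalescing_process M\<^sub>T (sphere 0 1) (circle_laws N X) Q\<^sub>T \<Xi>\<^sub>T \<and> compact Q\<^sub>T \<and> Q\<^sub>T \<noteq> {}
        \<longrightarrow> (AE \<omega> in M\<^sub>T. \<forall>t>0. finite (\<Xi>\<^sub>T t \<omega>)))"
proof -
  obtain c \<upsilon> where st: "stable_law (path_law N X) \<alpha> c \<upsilon>"
    using stable_law_path_law[OF assms] .
  have Xm: "X t \<in> borel_measurable N" if "0 \<le> t" for t
    using assms(1) that by (simp add: strictly_stable_process_def levy_process_def)
  have line: "projected_stable_law (path_law N X) \<alpha> c \<upsilon> (\<lambda>x. x) (\<lambda>x. x)"
    by (intro projected_stable_law.intro st projection_line)
  have circle: "projected_stable_law (path_law N X) \<alpha> c \<upsilon> circle_map frac"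
    by (intro projected_stable_law.intro st projection_circle)
  show ?thesis
  proof (intro conjI impI; elim conjE)
    assume set: "set_coalescing_process M\<^sub>R UNIV (line_laws N X) Q\<^sub>R \<Xi>\<^sub>R" and "compact Q\<^sub>R"
    then obtain K where K: "\<And>z. z \<in> Q\<^sub>R \<Longrightarrow> \<bar>z\<bar> \<le> K"
      using compact_imp_bounded[of Q\<^sub>R] by (auto simp: bounded_iff)
    show "AE \<omega> in M\<^sub>R. \<forall>t>0. finite (\<Xi>\<^sub>R t \<omega>)"
    proof (rule projected_stable_law.set_coalescing_finite[OF line set])
      fix z assume "z \<in> Q\<^sub>R"
      then show "\<exists>z'. line_laws N X z = projected_stable_law.start_law (path_law N X) (\<lambda>x. x) z' \<and> \<bar>z'\<bar> \<le> K"
        using K path_law_projected[OF line Xm, of z] by (intro exI[of _ z]) (simp add: line_laws_def)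
    qed
  next
    assume set: "set_coalescing_process M\<^sub>T (sphere 0 1) (circle_laws N X) Q\<^sub>T \<Xi>\<^sub>T"
    show "AE \<omega> in M\<^sub>T. \<forall>t>0. finite (\<Xi>\<^sub>T t \<omega>)"
    proof (rule projected_stable_law.set_coalescing_finite[OF circle set])
      fix z :: complex assume z: "z \<in> sphere 0 1"
      then obtain \<theta> where "z = exp (\<i> * of_real \<theta>)"
        using complex_norm_eq_1_exp[of z] by (metis norm_conv_dist dist_commute mem_sphere)
      then have z: "z = circle_map (\<theta> / (2 * pi))" by (simp add: circle_map_def mult_ac)
      have "circle_laws N X z = path_law N (\<lambda>t \<omega>. circle_map (\<theta> / (2 * pi) + X t \<omega>))"
        unfolding circle_laws_def z circle_map_add by (simp add: circle_map_def)
      then show "\<exists>z'. circle_laws N X z = projected_stable_law.start_law (path_law N X) circle_map z' \<and> \<bar>frac z'\<bar> \<le> 1"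
        using path_law_projected[OF circle Xm, of "\<theta> / (2 * pi)"] frac_lt_1[of "\<theta> / (2 * pi)"]
        by (intro exI[of _ "\<theta> / (2 * pi)"]) (auto intro: less_imp_le)
    qed
  qed
qed

end
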